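(* (i) If $\mathcal E$ satisfies $\mathsf{BE}(K,\infty)$ for some $K\in\mathbb R$, then for all $f,g,\varphi\in D_{L^2}(\Delta)\cap L^\infty(X,\mathfrak m)$ the expression $$\frac12\int_X\Big(\Gamma(f,g)\Delta\varphi+\Delta f\,\Gamma(g,\varphi)+\Delta g\,\Gamma(f,\varphi)+2\varphi\,\Delta f\,\Delta g\Big)d\mathfrak m$$ makes sense (each term of the integrand belongs to $L^1(X,\mathfrak m)$). (ii) If $\mathcal E$ satisfies $\mathsf{BE}(K,N)$, $N\in[1,\infty]$, $\nu:=1/N$ ($\nu=0$ if $N=\infty$), then $$\int_X\Big(\frac12\Gamma(f)\Delta\varphi+\Delta f\,\Gamma(f,\varphi)+\varphi(\Delta f)^2\Big)d\mathfrak m\ge K\int_X\Gamma(f)\,\varphi\,d\mathfrak m+\nu\int_X(\Delta f)^2\varphi\,d\mathfrak m$$ for every $f,\varphi\in D_{L^2}(\Delta)\cap L^\infty(X,\mathfrak m)$ with $\varphi\ge0$.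
   Context: Setting. $(X,\tau)$ is a Polish topological space with a $\sigma$-finite Borel measure $\mathfrak m$ with $\operatorname{supp}(\mathfrak m)=X$. $\mathcal E$ is a symmetric Dirichlet form on $L^2(X,\mathfrak m)$ with dense domain $\mathbb V:=D(\mathcal E)$, strongly local ($\mathcal E(f,g)=0$ whenever $f,g\in\mathbb V$ and $(f+a)g=0$ $\mathfrak m$-a.e. for some $a\in\mathbb R$), admitting a carré du champ, i.e. a symmetric bilinear continuous map $\Gamma:\mathbb V\times\mathbb V\to L^1(X,\mathfrak m)$ with $\int\Gamma(f,f)\varphi\,d\mathfrak m=\mathcal E(f,f\varphi)-\frac12\mathcal E(f^2,\varphi)$ for $f,\varphi\in\mathbb V\cap L^\infty$ and $\mathcal E(f,g)=\int\Gamma(f,g)\,d\mathfrak m$; $\Gamma(f):=\Gamma(f,f)$. The associated Markov semigroup is mass-preserving ($\int \mathsf P_tf\,d\mathfrak m=\int f\,d\mathfrak m$ for $f\in L^1\cap L^2$). For $f\in\mathbb V$, $\Delta f\in\mathbb V'$ is defined by $\langle-\Delta f,g\rangle=\mathcal E(f,g)$; $\Delta f\in L^2$ means $\mathcal E(f,g)=-\int hg\,d\mathfrak m$ for all $g\in\mathbb V$ and some $h\in L^2$, and then $\Delta f:=h$. $D_{L^2}(\Delta):=\{f\in\mathbb V:\Delta f\in L^2\}$; $D_{L^\infty}(\Delta):=\{f\in\mathbb V\cap L^\infty:\Delta f\in L^2\cap L^\infty\}$; $D_{\mathbb V}(\Delta):=\{f\in\mathbb V:\Delta f\in\mathbb V\}$.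 For $f\in D_{\mathbb V}(\Delta)$, $\varphi\in D_{L^\infty}(\Delta)$, $\mathbf\Gamma_2(f;\varphi):=\int_X\big(\frac12\Gamma(f)\Delta\varphi-\Gamma(f,\Delta f)\varphi\big)d\mathfrak m$. For $N\in[1,\infty]$, $\nu:=1/N$, $\mathsf{BE}(K,N)$ means: $\mathbf\Gamma_2(f;\varphi)\ge K\int_X\Gamma(f)\varphi\,d\mathfrak m+\nu\int_X(\Delta f)^2\varphi\,d\mathfrak m$ for all $(f,\varphi)\in D_{\mathbb V}(\Delta)\times D_{L^\infty}(\Delta)$ with $\varphi\ge0$. *)

theory Defs
  imports "HOL-Analysis.Analysis"
begin

text \<open>
  Elements of the Lebesgue spaces are represented by Borel functions. Everything below is
  invariant under a.e. equality: domains are saturated, and identities between functions are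
  stated a.e.
\<close>

definition L2 :: "'a measure \<Rightarrow> ('a \<Rightarrow> real) set" where
  "L2 M = {f \<in> borel_measurable M. integrable M (\<lambda>x. (f x)\<^sup>2)}"

definition Linf :: "'a measure \<Rightarrow> ('a \<Rightarrow> real) set" where
  "Linf M = {f \<in> borel_measurable M. \<exists>C. AE x in M. \<bar>f x\<bar> \<le> C}"

definition L2_norm :: "'a measure \<Rightarrow> ('a \<Rightarrow> real) \<Rightarrow> real" where
  "L2_norm M f = sqrt (\<integral>x. (f x)\<^sup>2 \<partial>M)"

definition form_norm ::
    "'a measure \<Rightarrow> (('a \<Rightarrow> real) \<Rightarrow> ('a \<Rightarrow> real) \<Rightarrow> real) \<Rightarrow> ('a \<Rightarrow> real) \<Rightarrow> real" where
  "form_norm M \<E> f = sqrt ((\<integral>x. (f x)\<^sup>2 \<partial>M) + \<E> f f)"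

text \<open>
  A symmetric, densely defined Dirichlet form with domain \<open>V\<close>: a closed, nonnegative symmetric
  form on which the unit contraction operates.
\<close>

locale dirichlet_form =
  fixes M :: "'a::polish_space measure"
    and V :: "('a \<Rightarrow> real) set"
    and \<E> :: "('a \<Rightarrow> real) \<Rightarrow> ('a \<Rightarrow> real) \<Rightarrow> real"
  assumes sets_M: "sets M = sets borel"
    and sigma_finite: "sigma_finite_measure M"
    and full_support: "\<And>U. open U \<Longrightarrow> U \<noteq> {} \<Longrightarrow> emeasure M U > 0"
    and V_L2: "V \<subseteq> L2 M"
    and V_cong: "\<And>f g. f \<in> V \<Longrightarrow> g \<in> borel_measurable M \<Longrightarrow> (AE x in M. f x = g x) \<Longrightarrow> g \<in> V"
    and V_zero: "(\<lambda>x. 0) \<in> V"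
    and V_add: "\<And>f g. f \<in> V \<Longrightarrow> g \<in> V \<Longrightarrow> (\<lambda>x. f x + g x) \<in> V"
    and V_scale: "\<And>c f. f \<in> V \<Longrightarrow> (\<lambda>x. c * f x) \<in> V"
    and V_dense: "\<And>f e. f \<in> L2 M \<Longrightarrow> e > 0 \<Longrightarrow> \<exists>g\<in>V. L2_norm M (\<lambda>x. f x - g x) < e"
    and E_cong: "\<And>f f' g. f \<in> V \<Longrightarrow> f' \<in> V \<Longrightarrow> g \<in> V \<Longrightarrow> (AE x in M. f x = f' x) \<Longrightarrow> \<E> f g = \<E> f' g"
    and E_sym: "\<And>f g. f \<in> V \<Longrightarrow> g \<in> V \<Longrightarrow> \<E> f g = \<E> g f"
    and E_add: "\<And>f f' g. f \<in> V \<Longrightarrow> f' \<in> V \<Longrightarrow> g \<in> V \<Longrightarrow> \<E> (\<lambda>x. f x + f' x) g = \<E> f g + \<E> f' g"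
    and E_scale: "\<And>c f g. f \<in> V \<Longrightarrow> g \<in> V \<Longrightarrow> \<E> (\<lambda>x. c * f x) g = c * \<E> f g"
    and E_nonneg: "\<And>f. f \<in> V \<Longrightarrow> \<E> f f \<ge> 0"
    and E_closed: "\<And>u. (\<And>n. u n \<in> V) \<Longrightarrow>
          (\<And>e. e > 0 \<Longrightarrow> \<exists>n0. \<forall>m\<ge>n0. \<forall>n\<ge>n0. form_norm M \<E> (\<lambda>x. u m x - u n x) < e) \<Longrightarrow>
          \<exists>f\<in>V. (\<lambda>n. form_norm M \<E> (\<lambda>x. u n x - f x)) \<longlonglongrightarrow> 0"
    and E_contraction_dom: "\<And>f. f \<in> V \<Longrightarrow> (\<lambda>x. max 0 (min 1 (f x))) \<in> V"
    and E_contraction: "\<And>f. f \<in> V \<Longrightarrow>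
          \<E> (\<lambda>x. max 0 (min 1 (f x))) (\<lambda>x. max 0 (min 1 (f x))) \<le> \<E> f f"

definition has_laplacian ::
    "'a measure \<Rightarrow> ('a \<Rightarrow> real) set \<Rightarrow> (('a \<Rightarrow> real) \<Rightarrow> ('a \<Rightarrow> real) \<Rightarrow> real)
      \<Rightarrow> ('a \<Rightarrow> real) \<Rightarrow> ('a \<Rightarrow> real) \<Rightarrow> bool" where
  "has_laplacian M V \<E> f h \<longleftrightarrow>
     f \<in> V \<and> h \<in> L2 M \<and> (\<forall>g\<in>V. \<E> f g = - (\<integral>x. h x * g x \<partial>M))"

text \<open>By density of the domain, \<open>laplacian M V \<E> f\<close> is unique up to a.e. equality.\<close>

definition laplacian ::
    "'a measure \<Rightarrow> ('a \<Rightarrow> real) set \<Rightarrow> (('a \<Rightarrow> real) \<Rightarrow> ('a \<Rightarrow> real) \<Rightarrow> real)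
      \<Rightarrow> ('a \<Rightarrow> real) \<Rightarrow> ('a \<Rightarrow> real)" where
  "laplacian M V \<E> f = (SOME h. has_laplacian M V \<E> f h)"

definition dom_L2 ::
    "'a measure \<Rightarrow> ('a \<Rightarrow> real) set \<Rightarrow> (('a \<Rightarrow> real) \<Rightarrow> ('a \<Rightarrow> real) \<Rightarrow> real) \<Rightarrow> ('a \<Rightarrow> real) set" where
  "dom_L2 M V \<E> = {f. \<exists>h. has_laplacian M V \<E> f h}"

definition dom_Linf ::
    "'a measure \<Rightarrow> ('a \<Rightarrow> real) set \<Rightarrow> (('a \<Rightarrow> real) \<Rightarrow> ('a \<Rightarrow> real) \<Rightarrow> real) \<Rightarrow> ('a \<Rightarrow> real) set" where
  "dom_Linf M V \<E> = {f \<in> dom_L2 M V \<E>. f \<in> Linf M \<and> laplacian M V \<E> f \<in> Linf M}"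

definition dom_V ::
    "'a measure \<Rightarrow> ('a \<Rightarrow> real) set \<Rightarrow> (('a \<Rightarrow> real) \<Rightarrow> ('a \<Rightarrow> real) \<Rightarrow> real) \<Rightarrow> ('a \<Rightarrow> real) set" where
  "dom_V M V \<E> = {f \<in> dom_L2 M V \<E>. laplacian M V \<E> f \<in> V}"

locale local_dirichlet_form = dirichlet_form M V \<E>
  for M :: "'a::polish_space measure"
    and V :: "('a \<Rightarrow> real) set"
    and \<E> :: "('a \<Rightarrow> real) \<Rightarrow> ('a \<Rightarrow> real) \<Rightarrow> real" +
  fixes \<Gamma> :: "('a \<Rightarrow> real) \<Rightarrow> ('a \<Rightarrow> real) \<Rightarrow> ('a \<Rightarrow> real)"
  assumes strongly_local: "\<And>f g a. f \<in> V \<Longrightarrow> g \<in> V \<Longrightarrow> (AE x in M. (f x + a) * g x = 0) \<Longrightarrow> \<E> f g = 0"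
    and Gamma_integrable: "\<And>f g. f \<in> V \<Longrightarrow> g \<in> V \<Longrightarrow> integrable M (\<Gamma> f g)"
    and Gamma_sym: "\<And>f g. f \<in> V \<Longrightarrow> g \<in> V \<Longrightarrow> AE x in M. \<Gamma> f g x = \<Gamma> g f x"
    and Gamma_add: "\<And>f f' g. f \<in> V \<Longrightarrow> f' \<in> V \<Longrightarrow> g \<in> V \<Longrightarrow>
          AE x in M. \<Gamma> (\<lambda>y. f y + f' y) g x = \<Gamma> f g x + \<Gamma> f' g x"
    and Gamma_scale: "\<And>c f g. f \<in> V \<Longrightarrow> g \<in> V \<Longrightarrow>
          AE x in M. \<Gamma> (\<lambda>y. c * f y) g x = c * \<Gamma> f g x"
    and Gamma_continuous: "\<And>u v f g. (\<And>n. u n \<in> V) \<Longrightarrow> (\<And>n. v n \<in> V) \<Longrightarrow> f \<in> V \<Longrightarrow> g \<in> V \<Longrightarrow>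
          (\<lambda>n. form_norm M \<E> (\<lambda>x. u n x - f x)) \<longlonglongrightarrow> 0 \<Longrightarrow>
          (\<lambda>n. form_norm M \<E> (\<lambda>x. v n x - g x)) \<longlonglongrightarrow> 0 \<Longrightarrow>
          (\<lambda>n. \<integral>x. \<bar>\<Gamma> (u n) (v n) x - \<Gamma> f g x\<bar> \<partial>M) \<longlonglongrightarrow> 0"
    and Gamma_E_mult: "\<And>f \<phi>. f \<in> V \<inter> Linf M \<Longrightarrow> \<phi> \<in> V \<inter> Linf M \<Longrightarrow>
          (\<integral>x. \<Gamma> f f x * \<phi> x \<partial>M) = \<E> f (\<lambda>x. f x * \<phi> x) - 1/2 * \<E> (\<lambda>x. (f x)\<^sup>2) \<phi>"
    and Gamma_E: "\<And>f g. f \<in> V \<Longrightarrow> g \<in> V \<Longrightarrow> \<E> f g = (\<integral>x. \<Gamma> f g x \<partial>M)"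

text \<open>
  A symmetric, strongly continuous Markov semigroup of contractions on \<open>L2\<close>; only times
  \<open>t \<ge> 0\<close> are meaningful.
\<close>

locale markov_semigroup =
  fixes M :: "'a measure"
    and P :: "real \<Rightarrow> ('a \<Rightarrow> real) \<Rightarrow> ('a \<Rightarrow> real)"
  assumes P_L2: "\<And>t f. t \<ge> 0 \<Longrightarrow> f \<in> L2 M \<Longrightarrow> P t f \<in> L2 M"
    and P_add: "\<And>t f g. t \<ge> 0 \<Longrightarrow> f \<in> L2 M \<Longrightarrow> g \<in> L2 M \<Longrightarrow>
          AE x in M. P t (\<lambda>y. f y + g y) x = P t f x + P t g x"
    and P_scale: "\<And>t c f. t \<ge> 0 \<Longrightarrow> f \<in> L2 M \<Longrightarrow> AE x in M. P t (\<lambda>y. c * f y) x = c * P t f x"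
    and P_zero: "\<And>f. f \<in> L2 M \<Longrightarrow> AE x in M. P 0 f x = f x"
    and P_semigroup: "\<And>s t f. s \<ge> 0 \<Longrightarrow> t \<ge> 0 \<Longrightarrow> f \<in> L2 M \<Longrightarrow> AE x in M. P (s + t) f x = P s (P t f) x"
    and P_sym: "\<And>t f g. t \<ge> 0 \<Longrightarrow> f \<in> L2 M \<Longrightarrow> g \<in> L2 M \<Longrightarrow>
          (\<integral>x. P t f x * g x \<partial>M) = (\<integral>x. f x * P t g x \<partial>M)"
    and P_contraction: "\<And>t f. t \<ge> 0 \<Longrightarrow> f \<in> L2 M \<Longrightarrow> L2_norm M (P t f) \<le> L2_norm M f"
    and P_continuous: "\<And>f. f \<in> L2 M \<Longrightarrow> ((\<lambda>t. L2_norm M (\<lambda>x. P t f x - f x)) \<longlongrightarrow> 0) (at_right 0)"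
    and P_markov: "\<And>t f. t \<ge> 0 \<Longrightarrow> f \<in> L2 M \<Longrightarrow> (AE x in M. 0 \<le> f x \<and> f x \<le> 1) \<Longrightarrow>
          AE x in M. 0 \<le> P t f x \<and> P t f x \<le> 1"

text \<open>The semigroup associated with the form is the one whose infinitesimal generator is the Laplacian.\<close>

locale mass_preserving_dirichlet_form = local_dirichlet_form M V \<E> \<Gamma> + markov_semigroup M P
  for M :: "'a::polish_space measure"
    and V :: "('a \<Rightarrow> real) set"
    and \<E> :: "('a \<Rightarrow> real) \<Rightarrow> ('a \<Rightarrow> real) \<Rightarrow> real"
    and \<Gamma> :: "('a \<Rightarrow> real) \<Rightarrow> ('a \<Rightarrow> real) \<Rightarrow> ('a \<Rightarrow> real)"
    and P :: "real \<Rightarrow> ('a \<Rightarrow> real) \<Rightarrow> ('a \<Rightarrow> real)" +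
  assumes generator: "\<And>f h. f \<in> L2 M \<Longrightarrow> h \<in> L2 M \<Longrightarrow>
          has_laplacian M V \<E> f h \<longleftrightarrow>
          ((\<lambda>t. L2_norm M (\<lambda>x. (P t f x - f x) / t - h x)) \<longlongrightarrow> 0) (at_right 0)"
    and mass_preserving: "\<And>t f. t \<ge> 0 \<Longrightarrow> f \<in> L2 M \<Longrightarrow> integrable M f \<Longrightarrow>
          integrable M (P t f) \<and> (\<integral>x. P t f x \<partial>M) = (\<integral>x. f x \<partial>M)"

definition Gamma2 ::
    "'a measure \<Rightarrow> ('a \<Rightarrow> real) set \<Rightarrow> (('a \<Rightarrow> real) \<Rightarrow> ('a \<Rightarrow> real) \<Rightarrow> real)
      \<Rightarrow> (('a \<Rightarrow> real) \<Rightarrow> ('a \<Rightarrow> real) \<Rightarrow> ('a \<Rightarrow> real)) \<Rightarrow> ('a \<Rightarrow> real) \<Rightarrow> ('a \<Rightarrow> real) \<Rightarrow> real" where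
  "Gamma2 M V \<E> \<Gamma> f \<phi> =
     (\<integral>x. 1/2 * \<Gamma> f f x * laplacian M V \<E> \<phi> x - \<Gamma> f (laplacian M V \<E> f) x * \<phi> x \<partial>M)"

text \<open>In \<open>ereal\<close>, \<open>1 / \<infinity> = 0\<close>.\<close>

definition BE ::
    "'a measure \<Rightarrow> ('a \<Rightarrow> real) set \<Rightarrow> (('a \<Rightarrow> real) \<Rightarrow> ('a \<Rightarrow> real) \<Rightarrow> real)
      \<Rightarrow> (('a \<Rightarrow> real) \<Rightarrow> ('a \<Rightarrow> real) \<Rightarrow> ('a \<Rightarrow> real)) \<Rightarrow> real \<Rightarrow> ereal \<Rightarrow> bool" where
  "BE M V \<E> \<Gamma> K N \<longleftrightarrow>
     (\<forall>f \<in> dom_V M V \<E>. \<forall>\<phi> \<in> dom_Linf M V \<E>. (AE x in M. \<phi> x \<ge> 0) \<longrightarrow>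
        Gamma2 M V \<E> \<Gamma> f \<phi> \<ge>
          K * (\<integral>x. \<Gamma> f f x * \<phi> x \<partial>M)
          + real_of_ereal (1 / N) * (\<integral>x. (laplacian M V \<E> f x)\<^sup>2 * \<phi> x \<partial>M))"

end

theory Submission
  imports Defs
begin

text \<open>
  Write \<open>\<Delta>\<close> for the Laplacian and \<open>\<Gamma>(f) = \<Gamma>(f,f)\<close>. Everything rests on the interpolation estimate
  \<open>\<parallel>\<Gamma>(f)\<parallel>\<^sup>2 \<le> C\<^sup>2 (2 \<bar>K\<bar> \<E>(f,f) + 11 \<parallel>\<Delta>f\<parallel>\<^sup>2)\<close> in \<open>L\<^sup>2\<close> for \<open>\<bar>f\<bar> \<le> C\<close>, valid under \<open>BE(K,\<infinity>)\<close>
  (\<open>gradient_interpolation_regular\<close>). Once \<open>\<Gamma>(f)\<close> is square integrable, so is \<open>\<Gamma>(f,g)\<close> by the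
  pointwise Cauchy-Schwarz inequality for \<open>\<Gamma>\<close>, and each term of the integrand in the first claim
  is a product of two square integrable functions.

  The estimate comes from testing the Bakry-Emery inequality with \<open>\<phi> = C\<^sup>2 - f\<^sup>2\<close>. Formally
  \<open>\<Delta>(f\<^sup>2) = 2 f \<Delta>f + 2 \<Gamma>(f)\<close>, so the term \<open>1/2 \<integral> \<Gamma>(f) \<Delta>\<phi>\<close> contributes \<open>- \<integral> \<Gamma>(f)\<^sup>2\<close>, whereas an
  integration by parts turns \<open>- \<integral> \<Gamma>(f,\<Delta>f) \<phi>\<close> into
  \<open>\<integral> \<phi> (\<Delta>f)\<^sup>2 - \<integral> \<Delta>f \<Gamma>(f,f\<^sup>2)\<close>; since \<open>\<Gamma>(f\<^sup>2) \<le> 4 C\<^sup>2 \<Gamma>(f)\<close>, what remains is at most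
  \<open>\<bar>K\<bar> C\<^sup>2 \<E>(f,f) + C\<^sup>2 \<parallel>\<Delta>f\<parallel>\<^sup>2 + 3 C \<parallel>\<Delta>f\<parallel> \<parallel>\<Gamma>(f)\<parallel>\<close>. The function \<open>C\<^sup>2 - f\<^sup>2\<close> is not an
  admissible test function: constants need not be square integrable and \<open>\<Delta>(f\<^sup>2)\<close> need not be bounded.
  It is therefore replaced by \<open>R\<^sub>l (C\<^sup>2 \<eta> - f\<^sup>2)\<close> with a cutoff \<open>\<eta>\<close> and the Markovian resolvent
  \<open>R\<^sub>l = l (l - \<Delta>)^(-1)\<close> (\<open>BE_cutoff_estimate\<close>); one lets the cutoff increase to 1 and then
  \<open>l \<rightarrow> \<infinity>\<close> (\<open>BE_limit_estimate\<close>).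

  The resolvent is obtained by minimising \<open>\<E>(u,u) + l \<parallel>u - h\<parallel>\<^sup>2\<close>. It is also the tool that
  turns the Dirichlet form into calculus: the approximations \<open>l \<integral> (f - R\<^sub>l f) g\<close> of \<open>\<E>(f,g)\<close> show that
  bounded elements of the domain form an algebra (\<open>V_square\<close>), that \<open>\<Gamma>(f) \<ge> 0\<close> and that
  \<open>\<Gamma>(f\<^sup>2) \<le> 4 C\<^sup>2 \<Gamma>(f)\<close>; and the product rule enters in integrated form, \<open>E_Leibniz\<close>, which
  follows by polarising the identity defining \<open>\<Gamma>\<close>.

  For the second claim the Bakry-Emery inequality is applied to \<open>R\<^sub>n f\<close> and \<open>R\<^sub>n \<phi>\<close>, rewritten by
  parts with \<open>E_Leibniz\<close>, and passed to the limit: the functions \<open>\<Gamma>(R\<^sub>n f)\<close> and \<open>\<Gamma>(R\<^sub>n f, R\<^sub>n \<phi>)\<close>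
  converge in \<open>L\<^sup>1\<close> and stay bounded in \<open>L\<^sup>2\<close> by the interpolation estimate, while the factors
  multiplying them converge in \<open>L\<^sup>2\<close> (\<open>weak_strong_tendsto\<close>).
\<close>

section \<open>Square integrable and bounded functions\<close>

lemma quadratic_nonneg_imp:
  fixes A B C :: real
  assumes nn: "\<And>t. 0 \<le> A + 2 * t * B + t\<^sup>2 * C" and C: "0 \<le> C"
  shows "B\<^sup>2 \<le> A * C"
proof (cases "C = 0")
  case True
  have "B = 0"
  proof (rule ccontr)
    assume "B \<noteq> 0"
    then show False using nn[of "- (A + 1) / (2 * B)"] True by (simp add: field_simps)
  qed
  with True show ?thesis by simp
next
  case False
  with C have "C > 0" by simp
  with nn[of "- B / C"] show ?thesis
    by (simp add: field_simps power2_eq_square)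
qed

text \<open>
  Exchanges a null set depending on a real parameter for a single one, by way of a countable dense
  set of parameters. It allows the parameter to be replaced afterwards by the value of a function at
  the point considered.
\<close>
lemma AE_all_of_continuous:
  fixes q :: "'a \<Rightarrow> real \<Rightarrow> real"
  assumes cont: "\<And>x. continuous_on UNIV (q x)"
    and ae: "\<And>a. a \<in> I \<Longrightarrow> AE x in M. 0 \<le> q x a"
  shows "AE x in M. \<forall>a\<in>I. 0 \<le> q x a"
proof -
  obtain T where T: "countable T" "T \<subseteq> I" "I \<subseteq> closure T"
    by (rule separable)
  have "AE x in M. \<forall>a\<in>T. 0 \<le> q x a"
    using T ae by (intro AE_ball_countable') auto
  moreover have "\<forall>a\<in>I. 0 \<le> q x a" if "\<forall>a\<in>T. 0 \<le> q x a" for x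
  proof -
    have "closed {a. 0 \<le> q x a}"
      using cont by (intro closed_Collect_le) auto
    then have "closure T \<subseteq> {a. 0 \<le> q x a}"
      using that by (intro closure_minimal) auto
    then show ?thesis using T by auto
  qed
  ultimately show ?thesis by auto
qed

lemma L2_measurable [measurable_dest]: "f \<in> L2 M \<Longrightarrow> f \<in> borel_measurable M"
  and L2_integrable_sq: "f \<in> L2 M \<Longrightarrow> integrable M (\<lambda>x. (f x)\<^sup>2)"
  by (auto simp: L2_def)

lemma L2_bound:
  assumes g: "g \<in> L2 M" and f: "f \<in> borel_measurable M" and le: "AE x in M. \<bar>f x\<bar> \<le> \<bar>g x\<bar>"
  shows "f \<in> L2 M"
proof -
  have "integrable M (\<lambda>x. (f x)\<^sup>2)"
    by (rule Bochner_Integration.integrable_bound[OF L2_integrable_sq[OF g]])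
      (use f le in \<open>auto simp: abs_le_square_iff\<close>)
  with f show ?thesis by (simp add: L2_def)
qed

lemma L2_mult_integrable:
  assumes f: "f \<in> L2 M" and g: "g \<in> L2 M"
  shows "integrable M (\<lambda>x. f x * g x)"
proof (rule Bochner_Integration.integrable_bound)
  show "integrable M (\<lambda>x. (f x)\<^sup>2 + (g x)\<^sup>2)"
    using f g by (auto simp: L2_def)
  show "(\<lambda>x. f x * g x) \<in> borel_measurable M"
    using f g by (auto simp: L2_def)
  have "\<bar>a * b\<bar> \<le> a\<^sup>2 + b\<^sup>2" for a b :: real
  proof -
    have "2 * \<bar>a * b\<bar> \<le> a\<^sup>2 + b\<^sup>2"
      using zero_le_power2[of "\<bar>a\<bar> - \<bar>b\<bar>"] by (simp add: power2_diff abs_mult)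
    then show ?thesis by simp
  qed
  then show "AE x in M. norm (f x * g x) \<le> norm ((f x)\<^sup>2 + (g x)\<^sup>2)"
    by simp
qed

lemma L2_scale: "f \<in> L2 M \<Longrightarrow> (\<lambda>x. c * f x) \<in> L2 M"
  by (auto simp: L2_def power_mult_distrib)

lemma L2_add:
  assumes f: "f \<in> L2 M" and g: "g \<in> L2 M"
  shows "(\<lambda>x. f x + g x) \<in> L2 M"
proof -
  have "integrable M (\<lambda>x. (f x)\<^sup>2 + (g x)\<^sup>2 + 2 * (f x * g x))"
    using f g L2_mult_integrable[OF f g] by (auto simp: L2_def)
  then have "integrable M (\<lambda>x. (f x + g x)\<^sup>2)"
    by (simp add: power2_sum mult.assoc)
  with f g show ?thesis by (auto simp: L2_def)
qed

lemma L2_diff: "f \<in> L2 M \<Longrightarrow> g \<in> L2 M \<Longrightarrow> (\<lambda>x. f x - g x) \<in> L2 M"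
  using L2_add[of f M "\<lambda>x. (-1) * g x"] L2_scale[of g M "-1"] by simp

lemma L2_zero: "(\<lambda>x. 0) \<in> L2 M"
  by (simp add: L2_def)

lemma L2_mult_bounded:
  assumes g: "g \<in> L2 M" and f: "f \<in> borel_measurable M" and le: "AE x in M. \<bar>f x\<bar> \<le> C"
  shows "(\<lambda>x. f x * g x) \<in> L2 M"
proof (rule L2_bound[OF L2_scale[OF g, of C]])
  show "(\<lambda>x. f x * g x) \<in> borel_measurable M" using f g by (auto simp: L2_def)
  show "AE x in M. \<bar>f x * g x\<bar> \<le> \<bar>C * g x\<bar>"
    using le by eventually_elim (auto simp: abs_mult intro!: mult_right_mono)
qed

lemma L2_norm_nonneg [simp]: "0 \<le> L2_norm M f"
  by (simp add: L2_norm_def)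

lemma L2_norm_sq: "(L2_norm M f)\<^sup>2 = (\<integral>x. (f x)\<^sup>2 \<partial>M)"
  by (simp add: L2_norm_def)

lemma L2_norm_le_iff: "0 \<le> B \<Longrightarrow> L2_norm M f \<le> B \<longleftrightarrow> (\<integral>x. (f x)\<^sup>2 \<partial>M) \<le> B\<^sup>2"
  by (metis L2_norm_nonneg L2_norm_sq power2_le_imp_le power_mono)

lemma L2_norm_minus_commute: "L2_norm M (\<lambda>x. f x - g x) = L2_norm M (\<lambda>x. g x - f x)"
  by (simp add: L2_norm_def power2_commute)

lemma L2_norm_scale: "L2_norm M (\<lambda>x. c * f x) = \<bar>c\<bar> * L2_norm M f"
  by (simp add: L2_norm_def power_mult_distrib real_sqrt_mult)

lemma L2_norm_zero [simp]: "L2_norm M (\<lambda>x. 0) = 0"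
  by (simp add: L2_norm_def)

lemma L2_norm_cong_AE:
  "f \<in> borel_measurable M \<Longrightarrow> g \<in> borel_measurable M \<Longrightarrow> (AE x in M. f x = g x) \<Longrightarrow> L2_norm M f = L2_norm M g"
  unfolding L2_norm_def by (intro arg_cong[where f=sqrt] integral_cong_AE) auto

lemma L2_norm_mono:
  assumes g: "g \<in> L2 M" and f: "f \<in> borel_measurable M" and le: "AE x in M. \<bar>f x\<bar> \<le> \<bar>g x\<bar>"
  shows "L2_norm M f \<le> L2_norm M g"
proof -
  have "AE x in M. (f x)\<^sup>2 \<le> (g x)\<^sup>2"
    using le by (simp add: abs_le_square_iff)
  then show ?thesis unfolding L2_norm_def
    using L2_integrable_sq[OF g] L2_integrable_sq[OF L2_bound[OF g f le]]
    by (intro real_sqrt_le_mono integral_mono_AE) auto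
qed

lemma L2_Cauchy_Schwarz:
  assumes f: "f \<in> L2 M" and g: "g \<in> L2 M"
  shows "\<bar>\<integral>x. f x * g x \<partial>M\<bar> \<le> L2_norm M f * L2_norm M g"
proof -
  note [simp] = L2_integrable_sq[OF f] L2_integrable_sq[OF g] L2_mult_integrable[OF f g]
  have "(\<integral>x. f x * g x \<partial>M)\<^sup>2 \<le> (\<integral>x. (f x)\<^sup>2 \<partial>M) * (\<integral>x. (g x)\<^sup>2 \<partial>M)"
  proof (rule quadratic_nonneg_imp)
    fix t :: real
    have "0 \<le> (\<integral>x. (f x + t * g x)\<^sup>2 \<partial>M)" by simp
    also have "\<dots> = (\<integral>x. (f x)\<^sup>2 + 2 * t * (f x * g x) + t\<^sup>2 * (g x)\<^sup>2 \<partial>M)"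
      by (intro Bochner_Integration.integral_cong) (auto simp: power2_eq_square algebra_simps)
    also have "\<dots> = (\<integral>x. (f x)\<^sup>2 \<partial>M) + 2 * t * (\<integral>x. f x * g x \<partial>M) + t\<^sup>2 * (\<integral>x. (g x)\<^sup>2 \<partial>M)"
      by simp
    finally show "0 \<le> \<dots>" .
  qed simp
  then have "\<bar>\<integral>x. f x * g x \<partial>M\<bar>\<^sup>2 \<le> (L2_norm M f * L2_norm M g)\<^sup>2"
    by (simp add: power_mult_distrib L2_norm_sq)
  then show ?thesis by (rule power2_le_imp_le) simp
qed

lemma L2_Cauchy_Schwarz_abs:
  assumes f: "f \<in> L2 M" and g: "g \<in> L2 M"
  shows "(\<integral>x. \<bar>f x * g x\<bar> \<partial>M) \<le> L2_norm M f * L2_norm M g"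
proof -
  have "(\<lambda>x. \<bar>f x\<bar>) \<in> L2 M" "(\<lambda>x. \<bar>g x\<bar>) \<in> L2 M"
    using f g by (auto simp: L2_def)
  from L2_Cauchy_Schwarz[OF this] show ?thesis
    by (simp add: L2_norm_def abs_mult)
qed

lemma L2_norm_triangle:
  assumes f: "f \<in> L2 M" and g: "g \<in> L2 M"
  shows "L2_norm M (\<lambda>x. f x + g x) \<le> L2_norm M f + L2_norm M g"
proof (rule power2_le_imp_le)
  note [simp] = L2_integrable_sq[OF f] L2_integrable_sq[OF g] L2_mult_integrable[OF f g]
  have "(L2_norm M (\<lambda>x. f x + g x))\<^sup>2 = (\<integral>x. (f x)\<^sup>2 + (g x)\<^sup>2 + 2 * (f x * g x) \<partial>M)"
    by (simp add: L2_norm_sq power2_sum mult.assoc)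
  also have "\<dots> = (L2_norm M f)\<^sup>2 + (L2_norm M g)\<^sup>2 + 2 * (\<integral>x. f x * g x \<partial>M)"
    by (simp add: L2_norm_sq)
  also have "\<dots> \<le> (L2_norm M f + L2_norm M g)\<^sup>2"
    using L2_Cauchy_Schwarz[OF f g] by (simp add: power2_sum)
  finally show "(L2_norm M (\<lambda>x. f x + g x))\<^sup>2 \<le> (L2_norm M f + L2_norm M g)\<^sup>2" .
qed simp

lemma L2_norm_triangle_diff:
  assumes "f \<in> L2 M" "g \<in> L2 M" "h \<in> L2 M"
  shows "L2_norm M (\<lambda>x. f x - h x) \<le> L2_norm M (\<lambda>x. f x - g x) + L2_norm M (\<lambda>x. g x - h x)"
  using L2_norm_triangle[OF L2_diff[OF assms(1,2)] L2_diff[OF assms(2,3)]] by simp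

lemma L2_norm_zero_AE:
  assumes "f \<in> L2 M" "L2_norm M f = 0"
  shows "AE x in M. f x = 0"
  using integral_nonneg_eq_0_iff_AE[OF L2_integrable_sq[OF assms(1)]] assms(2)
  by (simp add: L2_norm_def)

lemma tendsto_zero_sandwich:
  fixes f g :: "nat \<Rightarrow> real"
  assumes "g \<longlonglongrightarrow> 0" "\<And>n. \<bar>f n\<bar> \<le> g n"
  shows "f \<longlonglongrightarrow> 0"
proof (rule Lim_null_comparison[OF _ assms(1)])
  show "\<forall>\<^sub>F n in sequentially. norm (f n) \<le> g n"
    unfolding real_norm_def by (rule always_eventually) (rule allI, rule assms(2))
qed

lemma tendsto_of_bound:
  fixes f g :: "nat \<Rightarrow> real"
  assumes "g \<longlonglongrightarrow> 0" "\<And>n. \<bar>f n - l\<bar> \<le> g n"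
  shows "f \<longlonglongrightarrow> l"
  by (rule LIM_zero_cancel, rule tendsto_zero_sandwich[OF assms])

lemma L2_norm_tendsto_integral:
  assumes u: "\<And>n. u n \<in> L2 M" "f \<in> L2 M" and v: "\<And>n. v n \<in> L2 M" "g \<in> L2 M"
    and cu: "(\<lambda>n. L2_norm M (\<lambda>x. u n x - f x)) \<longlonglongrightarrow> 0"
    and cv: "(\<lambda>n. L2_norm M (\<lambda>x. v n x - g x)) \<longlonglongrightarrow> 0"
  shows "(\<lambda>n. \<integral>x. \<bar>u n x * v n x - f x * g x\<bar> \<partial>M) \<longlonglongrightarrow> 0"
proof (rule tendsto_zero_sandwich)
  let ?a = "\<lambda>n. L2_norm M (\<lambda>x. u n x - f x)" and ?b = "\<lambda>n. L2_norm M (\<lambda>x. v n x - g x)"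
  show "(\<lambda>n. ?a n * (?b n + L2_norm M g) + L2_norm M f * ?b n) \<longlonglongrightarrow> 0"
    using cu cv by (auto intro!: tendsto_eq_intros)
  fix n
  have d: "(\<lambda>x. u n x - f x) \<in> L2 M" "(\<lambda>x. v n x - g x) \<in> L2 M"
    by (intro L2_diff u v)+
  have "(\<integral>x. \<bar>u n x * v n x - f x * g x\<bar> \<partial>M)
      \<le> (\<integral>x. \<bar>(u n x - f x) * v n x\<bar> + \<bar>f x * (v n x - g x)\<bar> \<partial>M)"
  proof (rule integral_mono)
    show "integrable M (\<lambda>x. \<bar>u n x * v n x - f x * g x\<bar>)"
      by (intro integrable_abs Bochner_Integration.integrable_diff L2_mult_integrable u v)
    show "integrable M (\<lambda>x. \<bar>(u n x - f x) * v n x\<bar> + \<bar>f x * (v n x - g x)\<bar>)"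
      by (intro integrable_abs Bochner_Integration.integrable_add L2_mult_integrable u v d)
    show "\<bar>u n x * v n x - f x * g x\<bar> \<le> \<bar>(u n x - f x) * v n x\<bar> + \<bar>f x * (v n x - g x)\<bar>" for x
      using abs_triangle_ineq[of "(u n x - f x) * v n x" "f x * (v n x - g x)"] by (simp add: algebra_simps)
  qed
  also have "\<dots> = (\<integral>x. \<bar>(u n x - f x) * v n x\<bar> \<partial>M) + (\<integral>x. \<bar>f x * (v n x - g x)\<bar> \<partial>M)"
    by (intro Bochner_Integration.integral_add integrable_abs L2_mult_integrable u v d)
  also have "\<dots> \<le> ?a n * L2_norm M (v n) + L2_norm M f * ?b n"
    by (intro add_mono L2_Cauchy_Schwarz_abs u v d)
  also have "\<dots> \<le> ?a n * (?b n + L2_norm M g) + L2_norm M f * ?b n"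
    using L2_norm_triangle[OF d(2) v(2)] by (intro add_mono mult_left_mono) auto
  finally show "\<bar>\<integral>x. \<bar>u n x * v n x - f x * g x\<bar> \<partial>M\<bar> \<le> \<dots>" by simp
qed

lemma L1_tendsto_integral:
  fixes a :: "nat \<Rightarrow> 'a \<Rightarrow> real"
  assumes i: "\<And>n. integrable M (a n)" "integrable M b"
    and c: "(\<lambda>n. \<integral>x. \<bar>a n x - b x\<bar> \<partial>M) \<longlonglongrightarrow> 0"
  shows "(\<lambda>n. \<integral>x. a n x \<partial>M) \<longlonglongrightarrow> (\<integral>x. b x \<partial>M)"
proof (rule tendsto_of_bound[OF c])
  fix n
  have "(\<integral>x. a n x \<partial>M) - (\<integral>x. b x \<partial>M) = (\<integral>x. a n x - b x \<partial>M)"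
    using i by simp
  then show "\<bar>(\<integral>x. a n x \<partial>M) - (\<integral>x. b x \<partial>M)\<bar> \<le> (\<integral>x. \<bar>a n x - b x\<bar> \<partial>M)"
    by simp
qed

lemma L2_tendsto_inner:
  assumes u: "\<And>n. u n \<in> L2 M" "f \<in> L2 M" and g: "g \<in> L2 M"
    and cu: "(\<lambda>n. L2_norm M (\<lambda>x. u n x - f x)) \<longlonglongrightarrow> 0"
  shows "(\<lambda>n. \<integral>x. u n x * g x \<partial>M) \<longlonglongrightarrow> (\<integral>x. f x * g x \<partial>M)"
  by (rule L1_tendsto_integral[OF _ _ L2_norm_tendsto_integral[OF u g g cu]])
    (simp_all add: L2_mult_integrable u g)

text \<open>
  Large values are replaced by 0 instead of being clipped, so that \<open>a * cutoff k a = (cutoff k a)\<^sup>2\<close>.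
\<close>
definition cutoff :: "real \<Rightarrow> ('a \<Rightarrow> real) \<Rightarrow> 'a \<Rightarrow> real" where
  "cutoff k a x = (if \<bar>a x\<bar> \<le> k then a x else 0)"

lemma cutoff_measurable [measurable]:
  assumes [measurable]: "a \<in> borel_measurable M"
  shows "cutoff k a \<in> borel_measurable M"
  unfolding cutoff_def[abs_def] by measurable

lemma cutoff_le: "0 \<le> k \<Longrightarrow> \<bar>cutoff k a x\<bar> \<le> k" "\<bar>cutoff k a x\<bar> \<le> \<bar>a x\<bar>"
    "\<bar>a x - cutoff k a x\<bar> \<le> \<bar>a x\<bar>"
  by (auto simp: cutoff_def)

lemma cutoff_tendsto: "(\<lambda>k. cutoff (real k) a x) \<longlonglongrightarrow> a x"
proof (rule tendsto_eventually)
  show "\<forall>\<^sub>F k in sequentially. cutoff (real k) a x = a x"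
    using eventually_ge_at_top[of "nat \<lceil>\<bar>a x\<bar>\<rceil>"]
  proof eventually_elim
    case (elim k)
    then have "\<bar>a x\<bar> \<le> real k" by linarith
    then show ?case by (simp add: cutoff_def)
  qed
qed

lemma cutoff_L2_of_integrable:
  assumes "integrable M a" "0 \<le> k"
  shows "cutoff k a \<in> L2 M"
proof -
  have "integrable M (\<lambda>x. (cutoff k a x)\<^sup>2)"
  proof (rule Bochner_Integration.integrable_bound)
    show "integrable M (\<lambda>x. k * a x)" using assms by simp
    show "(\<lambda>x. (cutoff k a x)\<^sup>2) \<in> borel_measurable M" using assms by measurable
    have "(cutoff k a x)\<^sup>2 \<le> \<bar>k * a x\<bar>" for x
    proof -
      have "\<bar>cutoff k a x\<bar> * \<bar>cutoff k a x\<bar> \<le> k * \<bar>a x\<bar>"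
        using assms(2) by (intro mult_mono cutoff_le) auto
      then show ?thesis using assms(2) by (simp add: power2_eq_square abs_mult)
    qed
    then show "AE x in M. norm ((cutoff k a x)\<^sup>2) \<le> norm (k * a x)" by simp
  qed
  then show ?thesis using assms by (auto simp: L2_def)
qed

lemma cutoff_tendsto_L1:
  assumes a: "integrable M a"
  shows "(\<lambda>k. \<integral>x. \<bar>a x - cutoff (real k) a x\<bar> \<partial>M) \<longlonglongrightarrow> 0"
proof -
  have [measurable]: "a \<in> borel_measurable M" using a by auto
  have "(\<lambda>k. \<integral>x. \<bar>a x - cutoff (real k) a x\<bar> \<partial>M) \<longlonglongrightarrow> (\<integral>x. 0 \<partial>M)"
  proof (rule integral_dominated_convergence)
    show "integrable M (\<lambda>x. \<bar>a x\<bar>)" using a by simp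
    have "(\<lambda>k. \<bar>a x - cutoff (real k) a x\<bar>) \<longlonglongrightarrow> \<bar>a x - a x\<bar>" for x
      by (intro tendsto_intros cutoff_tendsto)
    then show "AE x in M. (\<lambda>k. \<bar>a x - cutoff (real k) a x\<bar>) \<longlonglongrightarrow> 0" by simp
  qed (auto simp: cutoff_le)
  then show ?thesis by simp
qed

lemma cutoff_tendsto_L2:
  assumes a: "a \<in> L2 M"
  shows "(\<lambda>k. L2_norm M (\<lambda>x. a x - cutoff (real k) a x)) \<longlonglongrightarrow> 0"
proof -
  have [measurable]: "a \<in> borel_measurable M" using a by (auto simp: L2_def)
  have "(\<lambda>k. \<integral>x. (a x - cutoff (real k) a x)\<^sup>2 \<partial>M) \<longlonglongrightarrow> (\<integral>x. 0 \<partial>M)"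
  proof (rule integral_dominated_convergence)
    show "integrable M (\<lambda>x. (a x)\<^sup>2)" using a by (rule L2_integrable_sq)
    have "(\<lambda>k. (a x - cutoff (real k) a x)\<^sup>2) \<longlonglongrightarrow> (a x - a x)\<^sup>2" for x
      by (intro tendsto_intros cutoff_tendsto)
    then show "AE x in M. (\<lambda>k. (a x - cutoff (real k) a x)\<^sup>2) \<longlonglongrightarrow> 0" by simp
  qed (auto simp: abs_le_square_iff[symmetric] cutoff_le)
  from tendsto_real_sqrt[OF this] show ?thesis by (simp add: L2_norm_def)
qed

text \<open>
  Square integrability by monotone convergence along the truncations: this turns an a priori
  inequality between integrals that need not be finite into one that can be absorbed.
\<close>
lemma cutoff_bounded_imp_L2:
  assumes a: "integrable M a" and B: "\<And>k. (\<integral>x. (cutoff (real k) a x)\<^sup>2 \<partial>M) \<le> B"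
  shows "a \<in> L2 M" "(\<integral>x. (a x)\<^sup>2 \<partial>M) \<le> B"
proof -
  let ?I = "\<lambda>k. \<integral>x. (cutoff (real k) a x)\<^sup>2 \<partial>M"
  have [measurable]: "a \<in> borel_measurable M" using a by auto
  have mono: "(cutoff (real k) a x)\<^sup>2 \<le> (cutoff (real l) a x)\<^sup>2" if "k \<le> l" for k l x
    using that by (auto simp: cutoff_def)
  have int: "integrable M (\<lambda>x. (cutoff (real k) a x)\<^sup>2)" for k
    by (rule L2_integrable_sq[OF cutoff_L2_of_integrable[OF a]]) simp
  have "incseq ?I"
    using mono int by (auto simp: incseq_def intro!: integral_mono)
  then obtain L where L: "?I \<longlonglongrightarrow> L"
    using incseq_convergent[of ?I B] B by blast
  have lim: "AE x in M. (\<lambda>k. (cutoff (real k) a x)\<^sup>2) \<longlonglongrightarrow> (a x)\<^sup>2"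
    by (intro AE_I2 tendsto_intros cutoff_tendsto)
  have m: "AE x in M. mono (\<lambda>k. (cutoff (real k) a x)\<^sup>2)"
    using mono by (auto simp: mono_def)
  have m2: "(\<lambda>x. (a x)\<^sup>2) \<in> borel_measurable M" by measurable
  have "integrable M (\<lambda>x. (a x)\<^sup>2)"
    by (rule integrable_monotone_convergence[OF int m lim L m2])
  then show "a \<in> L2 M" by (simp add: L2_def)
  have "(\<integral>x. (a x)\<^sup>2 \<partial>M) = L"
    by (rule integral_monotone_convergence[OF int m lim L m2])
  also have "L \<le> B" using L B by (intro LIMSEQ_le_const2) auto
  finally show "(\<integral>x. (a x)\<^sup>2 \<partial>M) \<le> B" .
qed

lemma abs_integral_mult_le:
  fixes a v :: "'a \<Rightarrow> real"
  assumes a: "integrable M a" and v: "v \<in> borel_measurable M" and C: "AE x in M. \<bar>v x\<bar> \<le> C"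
  shows "integrable M (\<lambda>x. a x * v x)" "\<bar>\<integral>x. a x * v x \<partial>M\<bar> \<le> C * (\<integral>x. \<bar>a x\<bar> \<partial>M)"
proof -
  have le: "AE x in M. \<bar>a x * v x\<bar> \<le> C * \<bar>a x\<bar>"
    using C by eventually_elim (metis abs_ge_zero abs_mult mult.commute mult_left_mono)
  show i: "integrable M (\<lambda>x. a x * v x)"
  proof (rule Bochner_Integration.integrable_bound)
    show "integrable M (\<lambda>x. C * \<bar>a x\<bar>)" using a by simp
    show "AE x in M. norm (a x * v x) \<le> norm (C * \<bar>a x\<bar>)"
      using le by eventually_elim simp
  qed (use a v in auto)
  have "\<bar>\<integral>x. a x * v x \<partial>M\<bar> \<le> (\<integral>x. \<bar>a x * v x\<bar> \<partial>M)" by simp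
  also have "\<dots> \<le> (\<integral>x. C * \<bar>a x\<bar> \<partial>M)"
    using i a le by (intro integral_mono_AE) auto
  finally show "\<bar>\<integral>x. a x * v x \<partial>M\<bar> \<le> C * (\<integral>x. \<bar>a x\<bar> \<partial>M)" by simp
qed

text \<open>
  The integrable factor is split into a bounded square integrable part, which sees the convergence
  in mean square, and a part of small integral, which only sees the uniform bound.
\<close>
lemma L1_pairing_tendsto:
  fixes a :: "'a \<Rightarrow> real"
  assumes a: "integrable M a" and v: "\<And>n. v n \<in> L2 M" "w \<in> L2 M"
    and C: "\<And>n. AE x in M. \<bar>v n x - w x\<bar> \<le> C" and Cw: "AE x in M. \<bar>w x\<bar> \<le> C"
    and c: "(\<lambda>n. L2_norm M (\<lambda>x. v n x - w x)) \<longlonglongrightarrow> 0"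
  shows "(\<lambda>n. \<integral>x. a x * v n x \<partial>M) \<longlonglongrightarrow> (\<integral>x. a x * w x \<partial>M)"
proof -
  have [measurable]: "a \<in> borel_measurable M" using a by auto
  define d where "d n x = v n x - w x" for n x
  have d: "d n \<in> L2 M" for n unfolding d_def[abs_def] by (intro L2_diff v)
  then have [measurable]: "d n \<in> borel_measurable M" for n by (auto simp: L2_def)
  have Cd: "AE x in M. \<bar>d n x\<bar> \<le> C" for n using C by (simp add: d_def)
  have Cd': "AE x in M. \<bar>d n x\<bar> \<le> max 0 C" for n using Cd[of n] by eventually_elim simp
  have [simp]: "integrable M (\<lambda>x. a x * d n x)" for n
    by (rule abs_integral_mult_le(1)[OF a L2_measurable[OF d] Cd])
  have [simp]: "integrable M (\<lambda>x. a x * w x)"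
    by (rule abs_integral_mult_le(1)[OF a L2_measurable[OF v(2)] Cw])
  have "(\<lambda>n. \<integral>x. a x * d n x \<partial>M) \<longlonglongrightarrow> 0"
  proof (rule LIMSEQ_I)
    fix e :: real assume e: "e > 0"
    let ?C = "max 0 C"
    have "(\<lambda>k. ?C * (\<integral>x. \<bar>a x - cutoff (real k) a x\<bar> \<partial>M)) \<longlonglongrightarrow> ?C * 0"
      by (intro tendsto_intros cutoff_tendsto_L1 a)
    then have "\<forall>\<^sub>F k in sequentially. ?C * (\<integral>x. \<bar>a x - cutoff (real k) a x\<bar> \<partial>M) < e / 2"
      by (rule order_tendstoD) (use e in auto)
    from eventually_happens'[OF sequentially_bot this]
    obtain k where k: "?C * (\<integral>x. \<bar>a x - cutoff (real k) a x\<bar> \<partial>M) < e / 2"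
      by blast
    let ?b = "cutoff (real k) a"
    have b: "?b \<in> L2 M" by (rule cutoff_L2_of_integrable[OF a]) simp
    have ib: "integrable M (\<lambda>x. ?b x)"
      by (rule Bochner_Integration.integrable_bound[OF a]) (auto simp: cutoff_le)
    have "(\<lambda>n. L2_norm M ?b * L2_norm M (d n)) \<longlonglongrightarrow> L2_norm M ?b * 0"
      using c by (intro tendsto_intros) (simp add: d_def[abs_def])
    then have "\<forall>\<^sub>F n in sequentially. L2_norm M ?b * L2_norm M (d n) < e / 2"
      by (rule order_tendstoD) (use e in auto)
    then obtain N where N: "\<And>n. n \<ge> N \<Longrightarrow> L2_norm M ?b * L2_norm M (d n) < e / 2"
      unfolding eventually_sequentially by blast
    have "norm ((\<integral>x. a x * d n x \<partial>M) - 0) < e" if "n \<ge> N" for n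
    proof -
      have ab: "integrable M (\<lambda>x. a x - ?b x)" using a ib by simp
      have "(\<integral>x. a x * d n x \<partial>M) = (\<integral>x. (a x - ?b x) * d n x + ?b x * d n x \<partial>M)"
        by (simp add: algebra_simps)
      also have "\<dots> = (\<integral>x. (a x - ?b x) * d n x \<partial>M) + (\<integral>x. ?b x * d n x \<partial>M)"
        by (intro Bochner_Integration.integral_add L2_mult_integrable b d
            abs_integral_mult_le(1)[OF ab L2_measurable[OF d] Cd])
      finally have "\<bar>\<integral>x. a x * d n x \<partial>M\<bar> \<le> \<bar>\<integral>x. (a x - ?b x) * d n x \<partial>M\<bar> + \<bar>\<integral>x. ?b x * d n x \<partial>M\<bar>"
        by simp
      also have "\<dots> \<le> ?C * (\<integral>x. \<bar>a x - ?b x\<bar> \<partial>M) + L2_norm M ?b * L2_norm M (d n)"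
        using abs_integral_mult_le(2)[OF ab L2_measurable[OF d] Cd', of n] L2_Cauchy_Schwarz[OF b d, of n]
        by linarith
      also have "\<dots> < e" using k N[OF that] by simp
      finally show ?thesis by simp
    qed
    then show "\<exists>N. \<forall>n\<ge>N. norm ((\<integral>x. a x * d n x \<partial>M) - 0) < e" by blast
  qed
  then have "(\<lambda>n. (\<integral>x. a x * d n x \<partial>M) + (\<integral>x. a x * w x \<partial>M)) \<longlonglongrightarrow> 0 + (\<integral>x. a x * w x \<partial>M)"
    by (intro tendsto_intros)
  moreover have "(\<integral>x. a x * d n x \<partial>M) + (\<integral>x. a x * w x \<partial>M) = (\<integral>x. a x * v n x \<partial>M)" for n
  proof -
    have "(\<integral>x. a x * d n x \<partial>M) + (\<integral>x. a x * w x \<partial>M) = (\<integral>x. a x * d n x + a x * w x \<partial>M)"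
      by simp
    also have "\<dots> = (\<integral>x. a x * v n x \<partial>M)"
      by (intro Bochner_Integration.integral_cong) (auto simp: d_def algebra_simps)
    finally show ?thesis .
  qed
  ultimately show ?thesis by simp
qed

text \<open>
  Lower semicontinuity of the \<open>L\<^sup>2\<close> norm along \<open>L\<^sup>1\<close> convergence, obtained by testing against
  truncations of the limit.
\<close>
lemma L1_limit_in_L2:
  assumes d: "\<And>n. d n \<in> L2 M" "\<And>n. integrable M (d n)" and a: "integrable M a"
    and c: "(\<lambda>n. \<integral>x. \<bar>d n x - a x\<bar> \<partial>M) \<longlonglongrightarrow> 0"
    and B: "\<And>n. L2_norm M (d n) \<le> B"
  shows "a \<in> L2 M" "L2_norm M a \<le> B"
proof -
  have B0: "0 \<le> B" using B[of 0] L2_norm_nonneg[of M "d 0"] by linarith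
  have [measurable]: "a \<in> borel_measurable M" using a by auto
  have "(\<integral>x. (cutoff (real k) a x)\<^sup>2 \<partial>M) \<le> B\<^sup>2" for k
  proof -
    let ?b = "cutoff (real k) a"
    have b: "?b \<in> L2 M" by (rule cutoff_L2_of_integrable[OF a]) simp
    have bk: "AE x in M. \<bar>?b x\<bar> \<le> real k" by (simp add: cutoff_le)
    have "(\<lambda>n. real k * (\<integral>x. \<bar>d n x - a x\<bar> \<partial>M)) \<longlonglongrightarrow> real k * 0"
      by (intro tendsto_intros c)
    then have "(\<lambda>n. real k * (\<integral>x. \<bar>d n x - a x\<bar> \<partial>M)) \<longlonglongrightarrow> 0" by simp
    then have "(\<lambda>n. \<integral>x. d n x * ?b x \<partial>M) \<longlonglongrightarrow> (\<integral>x. a x * ?b x \<partial>M)"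
    proof (rule tendsto_of_bound)
      fix n
      have "(\<integral>x. d n x * ?b x \<partial>M) - (\<integral>x. a x * ?b x \<partial>M) = (\<integral>x. (d n x - a x) * ?b x \<partial>M)"
        unfolding left_diff_distrib
        by (intro Bochner_Integration.integral_diff[symmetric] abs_integral_mult_le(1)[OF _ L2_measurable[OF b] bk] a d)
      then show "\<bar>(\<integral>x. d n x * ?b x \<partial>M) - (\<integral>x. a x * ?b x \<partial>M)\<bar> \<le> real k * (\<integral>x. \<bar>d n x - a x\<bar> \<partial>M)"
        using abs_integral_mult_le(2)[OF Bochner_Integration.integrable_diff[OF d(2) a] L2_measurable[OF b] bk]
        by simp
    qed
    moreover have "(\<integral>x. d n x * ?b x \<partial>M) \<le> B * L2_norm M ?b" for n
    proof -
      have "(\<integral>x. d n x * ?b x \<partial>M) \<le> L2_norm M (d n) * L2_norm M ?b"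
        using L2_Cauchy_Schwarz[OF d(1) b, of n] by linarith
      also have "\<dots> \<le> B * L2_norm M ?b" using B by (intro mult_right_mono) auto
      finally show ?thesis .
    qed
    ultimately have "(\<integral>x. a x * ?b x \<partial>M) \<le> B * L2_norm M ?b"
      by (intro LIMSEQ_le_const2) auto
    moreover have "(\<integral>x. a x * ?b x \<partial>M) = (L2_norm M ?b)\<^sup>2"
      unfolding L2_norm_sq
      by (intro Bochner_Integration.integral_cong) (auto simp: cutoff_def power2_eq_square)
    ultimately have "L2_norm M ?b \<le> B"
      using B0 by (metis L2_norm_nonneg linorder_not_le mult_less_cancel_right_pos order_le_less power2_eq_square)
    then show ?thesis using B0 by (simp add: L2_norm_le_iff)
  qed
  note * = cutoff_bounded_imp_L2[OF a this]
  show "a \<in> L2 M" by (rule *(1))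
  show "L2_norm M a \<le> B"
    using *(2) by (subst L2_norm_le_iff[OF B0])
qed

text \<open>
  Convergence in \<open>L\<^sup>1\<close> together with a bound in \<open>L\<^sup>2\<close> implies weak convergence in \<open>L\<^sup>2\<close>, and weakly
  convergent sequences pair continuously with strongly convergent ones.
\<close>
lemma weak_strong_tendsto:
  assumes d: "\<And>n. d n \<in> L2 M" "\<And>n. integrable M (d n)" and a: "integrable M a"
    and c: "(\<lambda>n. \<integral>x. \<bar>d n x - a x\<bar> \<partial>M) \<longlonglongrightarrow> 0"
    and B: "\<And>n. L2_norm M (d n) \<le> B"
    and b: "\<And>n. b n \<in> L2 M" "g \<in> L2 M"
    and cb: "(\<lambda>n. L2_norm M (\<lambda>x. b n x - g x)) \<longlonglongrightarrow> 0"
  shows "(\<lambda>n. \<integral>x. d n x * b n x \<partial>M) \<longlonglongrightarrow> (\<integral>x. a x * g x \<partial>M)"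
proof -
  have a2: "a \<in> L2 M" "L2_norm M a \<le> B" using L1_limit_in_L2[OF d a c B] by auto
  have B0: "0 \<le> B" using B[of 0] L2_norm_nonneg[of M "d 0"] by linarith
  have [measurable]: "g \<in> borel_measurable M" using b by (auto simp: L2_def)
  have "(\<lambda>n. (\<integral>x. d n x * b n x \<partial>M) - (\<integral>x. a x * g x \<partial>M)) \<longlonglongrightarrow> 0"
  proof (rule LIMSEQ_I)
    fix e :: real assume e: "e > 0"
    have "(\<lambda>k. 2 * B * L2_norm M (\<lambda>x. g x - cutoff (real k) g x)) \<longlonglongrightarrow> 2 * B * 0"
      by (intro tendsto_intros cutoff_tendsto_L2 b)
    then have "\<forall>\<^sub>F k in sequentially. 2 * B * L2_norm M (\<lambda>x. g x - cutoff (real k) g x) < e / 3"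
      by (rule order_tendstoD) (use e in auto)
    from eventually_happens'[OF sequentially_bot this]
    obtain k where k: "2 * B * L2_norm M (\<lambda>x. g x - cutoff (real k) g x) < e / 3"
      by blast
    let ?h = "cutoff (real k) g"
    have h: "?h \<in> L2 M" by (rule L2_bound[OF b(2)]) (auto simp: cutoff_le)
    have hk: "AE x in M. \<bar>?h x\<bar> \<le> real k" by (simp add: cutoff_le)
    have "(\<lambda>n. B * L2_norm M (\<lambda>x. b n x - g x)) \<longlonglongrightarrow> B * 0"
      by (intro tendsto_intros cb)
    then have "\<forall>\<^sub>F n in sequentially. B * L2_norm M (\<lambda>x. b n x - g x) < e / 3"
      by (rule order_tendstoD) (use e in auto)
    moreover have "(\<lambda>n. real k * (\<integral>x. \<bar>d n x - a x\<bar> \<partial>M)) \<longlonglongrightarrow> real k * 0"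
      by (intro tendsto_intros c)
    then have "\<forall>\<^sub>F n in sequentially. real k * (\<integral>x. \<bar>d n x - a x\<bar> \<partial>M) < e / 3"
      by (rule order_tendstoD) (use e in auto)
    ultimately have "\<forall>\<^sub>F n in sequentially. B * L2_norm M (\<lambda>x. b n x - g x) < e / 3
        \<and> real k * (\<integral>x. \<bar>d n x - a x\<bar> \<partial>M) < e / 3" by eventually_elim simp
    then obtain N where N: "\<And>n. n \<ge> N \<Longrightarrow> B * L2_norm M (\<lambda>x. b n x - g x) < e / 3"
        "\<And>n. n \<ge> N \<Longrightarrow> real k * (\<integral>x. \<bar>d n x - a x\<bar> \<partial>M) < e / 3"
      unfolding eventually_sequentially by blast
    have "norm ((\<integral>x. d n x * b n x \<partial>M) - (\<integral>x. a x * g x \<partial>M) - 0) < e" if "n \<ge> N" for n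
    proof -
      have L: "(\<lambda>x. b n x - g x) \<in> L2 M" "(\<lambda>x. d n x - a x) \<in> L2 M" "(\<lambda>x. g x - ?h x) \<in> L2 M"
        by (intro L2_diff b d a2 h)+
      have "(\<integral>x. d n x * b n x \<partial>M) - (\<integral>x. a x * g x \<partial>M) = (\<integral>x. d n x * b n x - a x * g x \<partial>M)"
        by (intro Bochner_Integration.integral_diff[symmetric] L2_mult_integrable d b a2)
      also have "\<dots> = (\<integral>x. d n x * (b n x - g x) + (d n x - a x) * (g x - ?h x) + (d n x - a x) * ?h x \<partial>M)"
        by (intro Bochner_Integration.integral_cong) (auto simp: algebra_simps)
      also have "\<dots> = (\<integral>x. d n x * (b n x - g x) \<partial>M) + (\<integral>x. (d n x - a x) * (g x - ?h x) \<partial>M)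
          + (\<integral>x. (d n x - a x) * ?h x \<partial>M)"
        using L2_mult_integrable[OF d(1) L(1)] L2_mult_integrable[OF L(2,3)] L2_mult_integrable[OF L(2) h]
        by simp
      finally have "\<bar>(\<integral>x. d n x * b n x \<partial>M) - (\<integral>x. a x * g x \<partial>M)\<bar> \<le>
          \<bar>\<integral>x. d n x * (b n x - g x) \<partial>M\<bar> + \<bar>\<integral>x. (d n x - a x) * (g x - ?h x) \<partial>M\<bar>
          + \<bar>\<integral>x. (d n x - a x) * ?h x \<partial>M\<bar>" by linarith
      moreover have "\<bar>\<integral>x. d n x * (b n x - g x) \<partial>M\<bar> < e / 3"
        using L2_Cauchy_Schwarz[OF d(1) L(1), of n] mult_right_mono[OF B[of n] L2_norm_nonneg[of M "\<lambda>x. b n x - g x"]]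
          N(1)[OF that] by linarith
      moreover have "\<bar>\<integral>x. (d n x - a x) * (g x - ?h x) \<partial>M\<bar> < e / 3"
      proof -
        have "L2_norm M (\<lambda>x. d n x - a x) \<le> 2 * B"
          using L2_norm_triangle_diff[OF d(1) L2_zero a2(1), of n] B[of n] a2(2)
            L2_norm_scale[of M "-1" a] by simp
        then show ?thesis
          using L2_Cauchy_Schwarz[OF L(2,3)] k
            mult_right_mono[of "L2_norm M (\<lambda>x. d n x - a x)" "2 * B" "L2_norm M (\<lambda>x. g x - ?h x)"] by simp
      qed
      moreover have "\<bar>\<integral>x. (d n x - a x) * ?h x \<partial>M\<bar> < e / 3"
        using abs_integral_mult_le(2)[OF Bochner_Integration.integrable_diff[OF d(2) a] L2_measurable[OF h] hk, of n]
          N(2)[OF that] by linarith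
      ultimately show ?thesis by simp
    qed
    then show "\<exists>N. \<forall>n\<ge>N. norm ((\<integral>x. d n x * b n x \<partial>M) - (\<integral>x. a x * g x \<partial>M) - 0) < e" by blast
  qed
  then show ?thesis by (simp add: LIM_zero_iff)
qed

text \<open>
  The test function \<open>min 1 (max 0 (- a))\<close> is admissible and detects exactly where \<open>a\<close> is negative.
\<close>
lemma AE_nonneg_of_tests:
  fixes a :: "'a \<Rightarrow> real"
  assumes a: "integrable M a \<or> a \<in> L2 M"
    and test: "\<And>\<psi>. \<psi> \<in> L2 M \<Longrightarrow> (\<And>x. 0 \<le> \<psi> x) \<Longrightarrow> (\<And>x. \<psi> x \<le> 1) \<Longrightarrow> 0 \<le> (\<integral>x. a x * \<psi> x \<partial>M)"
  shows "AE x in M. 0 \<le> a x"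
proof -
  define \<psi> where "\<psi> x = min 1 (max 0 (- a x))" for x
  have am [measurable]: "a \<in> borel_measurable M" using a by (auto simp: L2_def)
  have \<psi>m [measurable]: "\<psi> \<in> borel_measurable M" unfolding \<psi>_def[abs_def] by measurable
  have b: "0 \<le> \<psi> x" "\<psi> x \<le> 1" "\<bar>\<psi> x\<bar> \<le> \<bar>a x\<bar>" for x by (auto simp: \<psi>_def)
  have \<psi>: "\<psi> \<in> L2 M"
  proof (cases "a \<in> L2 M")
    case True
    then show ?thesis using b \<psi>m by (intro L2_bound[OF True]) auto
  next
    case False
    with a have "integrable M a" by simp
    then have "integrable M (\<lambda>x. (\<psi> x)\<^sup>2)"
    proof (rule Bochner_Integration.integrable_bound)
      have "(\<psi> x)\<^sup>2 \<le> \<bar>a x\<bar>" for x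
        using b[of x] mult_mono[of "\<psi> x" "\<bar>a x\<bar>" "\<psi> x" 1] by (simp add: power2_eq_square)
      then show "AE x in M. norm ((\<psi> x)\<^sup>2) \<le> norm (a x)" by simp
    qed measurable
    then show ?thesis by (simp add: L2_def)
  qed
  have i: "integrable M (\<lambda>x. a x * \<psi> x)"
  proof (cases "a \<in> L2 M")
    case True then show ?thesis using \<psi> by (rule L2_mult_integrable)
  next
    case False
    then show ?thesis using a b by (intro abs_integral_mult_le(1)[where C=1]) auto
  qed
  have le: "a x * \<psi> x \<le> 0" for x by (auto simp: \<psi>_def mult_le_0_iff min_def)
  have "(\<integral>x. - (a x * \<psi> x) \<partial>M) = 0"
    using test[OF \<psi> b(1,2)] integral_nonneg_AE[where M=M and f="\<lambda>x. - (a x * \<psi> x)"] le by simp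
  then have "AE x in M. - (a x * \<psi> x) = 0"
    using integral_nonneg_eq_0_iff_AE[where M=M and f="\<lambda>x. - (a x * \<psi> x)"] i le by simp
  then show ?thesis
    by eventually_elim (auto simp: \<psi>_def min_def max_def split: if_splits)
qed

lemma LinfE:
  assumes "f \<in> Linf M"
  obtains C where "0 \<le> C" "AE x in M. \<bar>f x\<bar> \<le> C"
proof -
  obtain C where "AE x in M. \<bar>f x\<bar> \<le> C" using assms by (auto simp: Linf_def)
  then have "AE x in M. \<bar>f x\<bar> \<le> max 0 C" by eventually_elim simp
  then show ?thesis by (intro that[of "max 0 C"]) auto
qed

lemma LinfI: "f \<in> borel_measurable M \<Longrightarrow> AE x in M. \<bar>f x\<bar> \<le> C \<Longrightarrow> f \<in> Linf M"
  by (auto simp: Linf_def)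

lemma Linf_measurable: "f \<in> Linf M \<Longrightarrow> f \<in> borel_measurable M"
  by (simp add: Linf_def)

lemma Linf_add:
  assumes "f \<in> Linf M" "g \<in> Linf M" shows "(\<lambda>x. f x + g x) \<in> Linf M"
proof -
  obtain C where C: "AE x in M. \<bar>f x\<bar> \<le> C" using assms by (auto elim: LinfE)
  obtain D where D: "AE x in M. \<bar>g x\<bar> \<le> D" using assms by (auto elim: LinfE)
  have "AE x in M. \<bar>f x + g x\<bar> \<le> C + D" using C D by eventually_elim linarith
  then show ?thesis
    by (rule LinfI[rotated]) (intro borel_measurable_add Linf_measurable assms)
qed

lemma Linf_mult:
  assumes "f \<in> Linf M" "g \<in> Linf M" shows "(\<lambda>x. f x * g x) \<in> Linf M"
proof -
  obtain C where C: "0 \<le> C" "AE x in M. \<bar>f x\<bar> \<le> C" using assms by (auto elim: LinfE)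
  obtain D where D: "AE x in M. \<bar>g x\<bar> \<le> D" using assms by (auto elim: LinfE)
  have "AE x in M. \<bar>f x * g x\<bar> \<le> C * D" using C(2) D
  proof eventually_elim
    case (elim x) then show ?case unfolding abs_mult using C(1) by (intro mult_mono) auto
  qed
  then show ?thesis
    by (rule LinfI[rotated]) (intro borel_measurable_times Linf_measurable assms)
qed

lemma Linf_scale: "f \<in> Linf M \<Longrightarrow> (\<lambda>x. c * f x) \<in> Linf M"
  using Linf_mult[of "\<lambda>_. c" M f] by (auto simp: Linf_def)

lemma integrable_mult_Linf:
  "integrable M a \<Longrightarrow> v \<in> Linf M \<Longrightarrow> integrable M (\<lambda>x. a x * v x :: real)"
  using abs_integral_mult_le(1)[of M a v] by (auto simp: Linf_def)

lemma L2_indicator: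
  fixes M :: "'a measure"
  assumes "A \<in> sets M" "emeasure M A \<noteq> \<infinity>"
  shows "(indicator A :: 'a \<Rightarrow> real) \<in> L2 M"
proof -
  have "(\<lambda>x. (indicator A x :: real)\<^sup>2) = indicator A"
    by (auto simp: indicator_def)
  then show ?thesis
    using assms by (auto simp: L2_def less_top[symmetric])
qed

text \<open>
  A name for the pairing, so that it can be expanded by the same bilinear rewriting as the
  form itself.
\<close>
definition L2_inner :: "'a measure \<Rightarrow> ('a \<Rightarrow> real) \<Rightarrow> ('a \<Rightarrow> real) \<Rightarrow> real" where
  "L2_inner M f g = (\<integral>x. f x * g x \<partial>M)"

lemma L2_inner_commute: "L2_inner M f g = L2_inner M g f"
  by (simp add: L2_inner_def mult.commute)

lemma L2_inner_add_left:
  assumes "f \<in> L2 M" "f' \<in> L2 M" "g \<in> L2 M"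
  shows "L2_inner M (\<lambda>x. f x + f' x) g = L2_inner M f g + L2_inner M f' g"
  unfolding L2_inner_def distrib_right
  by (intro Bochner_Integration.integral_add L2_mult_integrable assms)

lemma L2_inner_diff_left:
  assumes "f \<in> L2 M" "f' \<in> L2 M" "g \<in> L2 M"
  shows "L2_inner M (\<lambda>x. f x - f' x) g = L2_inner M f g - L2_inner M f' g"
  unfolding L2_inner_def left_diff_distrib
  by (intro Bochner_Integration.integral_diff L2_mult_integrable assms)

lemma L2_inner_scale_left: "L2_inner M (\<lambda>x. c * f x) g = c * L2_inner M f g"
  by (simp add: L2_inner_def mult.assoc)

lemma L2_inner_add_right:
  assumes "f \<in> L2 M" "f' \<in> L2 M" "g \<in> L2 M"
  shows "L2_inner M g (\<lambda>x. f x + f' x) = L2_inner M g f + L2_inner M g f'"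
  using L2_inner_add_left[OF assms] by (simp add: L2_inner_commute)

lemma L2_inner_diff_right:
  assumes "f \<in> L2 M" "f' \<in> L2 M" "g \<in> L2 M"
  shows "L2_inner M g (\<lambda>x. f x - f' x) = L2_inner M g f - L2_inner M g f'"
  using L2_inner_diff_left[OF assms] by (simp add: L2_inner_commute)

lemma L2_inner_scale_right: "L2_inner M g (\<lambda>x. c * f x) = c * L2_inner M g f"
  using L2_inner_scale_left[of M c f g] by (simp add: L2_inner_commute)

lemmas L2_inner_bilinear = L2_inner_add_left L2_inner_add_right L2_inner_diff_left
  L2_inner_diff_right L2_inner_scale_left L2_inner_scale_right

lemma L2_inner_self: "L2_inner M f f = (L2_norm M f)\<^sup>2"
  unfolding L2_inner_def L2_norm_sq by (simp add: power2_eq_square)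

lemma L2_inner_le: "f \<in> L2 M \<Longrightarrow> g \<in> L2 M \<Longrightarrow> \<bar>L2_inner M f g\<bar> \<le> L2_norm M f * L2_norm M g"
  unfolding L2_inner_def by (rule L2_Cauchy_Schwarz)

lemma L2_norm_tendsto_unique:
  assumes u: "\<And>n. u n \<in> L2 M" and f: "f \<in> L2 M" and g: "g \<in> L2 M"
    and cf: "(\<lambda>n. L2_norm M (\<lambda>x. u n x - f x)) \<longlonglongrightarrow> 0"
    and cg: "(\<lambda>n. L2_norm M (\<lambda>x. u n x - g x)) \<longlonglongrightarrow> 0"
  shows "AE x in M. f x = g x"
proof -
  have "(\<lambda>n. L2_norm M (\<lambda>x. u n x - f x) + L2_norm M (\<lambda>x. u n x - g x)) \<longlonglongrightarrow> 0 + 0"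
    by (intro tendsto_intros cf cg)
  moreover have "L2_norm M (\<lambda>x. f x - g x) \<le> L2_norm M (\<lambda>x. u n x - f x) + L2_norm M (\<lambda>x. u n x - g x)" for n
    using L2_norm_triangle_diff[OF f u g, of n] L2_norm_minus_commute[of M f "u n"] by simp
  ultimately have "L2_norm M (\<lambda>x. f x - g x) \<le> 0 + 0"
    by (intro LIMSEQ_le_const) blast+
  then have "L2_norm M (\<lambda>x. f x - g x) = 0"
    using L2_norm_nonneg[of M "\<lambda>x. f x - g x"] by linarith
  from L2_norm_zero_AE[OF L2_diff[OF f g] this] show ?thesis by simp
qed

(* Resolvent parameters are written real (Suc n), which the simplifier would rewrite. *)
declare of_nat_Suc [simp del]

section \<open>The resolvent of a Dirichlet form\<close>

context dirichlet_form
begin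

lemma V_imp_L2: "f \<in> V \<Longrightarrow> f \<in> L2 M"
  using V_L2 by blast

lemma V_diff: "f \<in> V \<Longrightarrow> g \<in> V \<Longrightarrow> (\<lambda>x. f x - g x) \<in> V"
  using V_add[of f "\<lambda>x. (-1) * g x"] V_scale[of g "-1"] by simp

lemma E_add_right: "f \<in> V \<Longrightarrow> f' \<in> V \<Longrightarrow> g \<in> V \<Longrightarrow> \<E> g (\<lambda>x. f x + f' x) = \<E> g f + \<E> g f'"
  using E_sym[of g "\<lambda>x. f x + f' x"] E_sym[of g f] E_sym[of g f'] by (simp add: V_add E_add)

lemma E_scale_right: "f \<in> V \<Longrightarrow> g \<in> V \<Longrightarrow> \<E> g (\<lambda>x. c * f x) = c * \<E> g f"
  using E_sym[of g "\<lambda>x. c * f x"] E_sym[of g f] by (simp add: V_scale E_scale)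

lemma E_diff: "f \<in> V \<Longrightarrow> f' \<in> V \<Longrightarrow> g \<in> V \<Longrightarrow> \<E> (\<lambda>x. f x - f' x) g = \<E> f g - \<E> f' g"
  using E_add[of f "\<lambda>x. (-1) * f' x" g] E_scale[of f' g "-1"] V_scale[of f' "-1"] by simp

lemma E_diff_right: "f \<in> V \<Longrightarrow> f' \<in> V \<Longrightarrow> g \<in> V \<Longrightarrow> \<E> g (\<lambda>x. f x - f' x) = \<E> g f - \<E> g f'"
  using E_sym[of g "\<lambda>x. f x - f' x"] E_sym[of g f] E_sym[of g f'] by (simp add: V_diff E_diff)

lemma E_cong_right: "f \<in> V \<Longrightarrow> f' \<in> V \<Longrightarrow> g \<in> V \<Longrightarrow> (AE x in M. f x = f' x) \<Longrightarrow> \<E> g f = \<E> g f'"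
  using E_sym[of g f] E_sym[of g f'] E_cong[of f f' g] by simp

lemmas E_bilinear = E_add E_add_right E_scale E_scale_right E_diff E_diff_right

lemma E_Cauchy_Schwarz:
  assumes f: "f \<in> V" and g: "g \<in> V"
  shows "\<bar>\<E> f g\<bar> \<le> sqrt (\<E> f f) * sqrt (\<E> g g)"
proof -
  have "(\<E> f g)\<^sup>2 \<le> \<E> f f * \<E> g g"
  proof (rule quadratic_nonneg_imp)
    fix t :: real
    have "0 \<le> \<E> (\<lambda>x. f x + t * g x) (\<lambda>x. f x + t * g x)"
      by (intro E_nonneg V_add V_scale f g)
    also have "\<dots> = \<E> f f + 2 * t * \<E> f g + t\<^sup>2 * \<E> g g"
      by (simp add: E_bilinear V_add V_scale f g E_sym[OF g f] power2_eq_square algebra_simps)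
    finally show "0 \<le> \<dots>" .
  qed (rule E_nonneg[OF g])
  then have "sqrt ((\<E> f g)\<^sup>2) \<le> sqrt (\<E> f f * \<E> g g)"
    by (rule real_sqrt_le_mono)
  then show ?thesis by (simp add: real_sqrt_mult)
qed

lemma form_norm_tendsto_iff:
  assumes u: "\<And>n. u n \<in> V" and f: "f \<in> V"
  shows "(\<lambda>n. form_norm M \<E> (\<lambda>x. u n x - f x)) \<longlonglongrightarrow> 0 \<longleftrightarrow>
    (\<lambda>n. L2_norm M (\<lambda>x. u n x - f x)) \<longlonglongrightarrow> 0 \<and>
    (\<lambda>n. \<E> (\<lambda>x. u n x - f x) (\<lambda>x. u n x - f x)) \<longlonglongrightarrow> 0" (is "?l \<longleftrightarrow> ?r1 \<and> ?r2")
proof -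
  let ?I = "\<lambda>n. \<integral>x. (u n x - f x)\<^sup>2 \<partial>M" and ?E = "\<lambda>n. \<E> (\<lambda>x. u n x - f x) (\<lambda>x. u n x - f x)"
  have E0: "0 \<le> ?E n" for n by (intro E_nonneg V_diff u f)
  have I0: "0 \<le> ?I n" for n by simp
  have sq: "(\<lambda>n. sqrt (a n)) \<longlonglongrightarrow> 0 \<longleftrightarrow> a \<longlonglongrightarrow> 0" if "\<And>n. 0 \<le> a n" for a :: "nat \<Rightarrow> real"
  proof
    assume "(\<lambda>n. sqrt (a n)) \<longlonglongrightarrow> 0"
    then have "(\<lambda>n. (sqrt (a n))\<^sup>2) \<longlonglongrightarrow> 0\<^sup>2" by (intro tendsto_intros)
    then show "a \<longlonglongrightarrow> 0" using that by simp
  next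
    assume "a \<longlonglongrightarrow> 0"
    from tendsto_real_sqrt[OF this] show "(\<lambda>n. sqrt (a n)) \<longlonglongrightarrow> 0" by simp
  qed
  have l: "?l \<longleftrightarrow> (\<lambda>n. ?I n + ?E n) \<longlonglongrightarrow> 0"
    unfolding form_norm_def by (rule sq) (use E0 I0 in \<open>auto intro!: add_nonneg_nonneg\<close>)
  have r: "?r1 \<longleftrightarrow> ?I \<longlonglongrightarrow> 0"
    unfolding L2_norm_def by (rule sq) (rule I0)
  show ?thesis unfolding l r
  proof safe
    assume s: "(\<lambda>n. ?I n + ?E n) \<longlonglongrightarrow> 0"
    show "?I \<longlonglongrightarrow> 0" by (rule tendsto_zero_sandwich[OF s]) (use E0 I0 in auto)
    show "?E \<longlonglongrightarrow> 0" by (rule tendsto_zero_sandwich[OF s]) (use E0 I0 in auto)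
  next
    assume "?I \<longlonglongrightarrow> 0" "?E \<longlonglongrightarrow> 0"
    from tendsto_add[OF this] show "(\<lambda>n. ?I n + ?E n) \<longlonglongrightarrow> 0" by simp
  qed
qed

lemma E_tendsto:
  assumes u: "\<And>n. u n \<in> V" and f: "f \<in> V" and g: "g \<in> V"
    and c: "(\<lambda>n. form_norm M \<E> (\<lambda>x. u n x - f x)) \<longlonglongrightarrow> 0"
  shows "(\<lambda>n. \<E> (u n) g) \<longlonglongrightarrow> \<E> f g"
proof (rule tendsto_of_bound)
  let ?E = "\<lambda>n. \<E> (\<lambda>x. u n x - f x) (\<lambda>x. u n x - f x)"
  have "?E \<longlonglongrightarrow> 0" using form_norm_tendsto_iff[of u f, OF u f] c by blast
  from tendsto_mult_left_zero[OF tendsto_real_sqrt[OF this, simplified]]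
  show "(\<lambda>n. sqrt (?E n) * sqrt (\<E> g g)) \<longlonglongrightarrow> 0" .
  show "\<bar>\<E> (u n) g - \<E> f g\<bar> \<le> sqrt (?E n) * sqrt (\<E> g g)" for n
    using E_Cauchy_Schwarz[OF V_diff[OF u f] g, of n] by (simp add: E_diff u f g)
qed

text \<open>
  The Riesz representation theorem for the inner product \<open>\<E> u v + l \<langle>u, v\<rangle>\<close>, by the direct method:
  a minimising sequence of the quadratic functional \<open>Q\<close> is Cauchy by the parallelogram identity and
  converges by closedness of the form. The Euler-Lagrange equation of the limit is read off from the
  almost minimality of the members of the sequence.
\<close>
lemma resolvent_exists:
  assumes l: "0 < l" and h: "h \<in> L2 M"
  shows "\<exists>u\<in>V. \<forall>v\<in>V. \<E> u v + l * L2_inner M u v = l * L2_inner M h v"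
proof -
  define B where "B u v = \<E> u v + l * L2_inner M u v" for u v
  define Q where "Q u = B u u - 2 * l * L2_inner M h u" for u
  note vs = V_add V_scale V_diff V_imp_L2 h
  have Bpos: "0 \<le> B u u" if "u \<in> V" for u
    using E_nonneg[OF that] l by (simp add: B_def L2_inner_self)
  have Qlow: "- (l * (L2_norm M h)\<^sup>2) \<le> Q u" if u: "u \<in> V" for u
  proof -
    have "0 \<le> l * L2_inner M (\<lambda>x. u x - h x) (\<lambda>x. u x - h x)"
      using l by (simp add: L2_inner_self)
    also have "\<dots> = l * L2_inner M u u - 2 * l * L2_inner M h u + l * L2_inner M h h"
      using u by (simp add: L2_inner_bilinear L2_diff vs L2_inner_commute[of M u h] algebra_simps)
    finally show ?thesis using E_nonneg[OF u] by (simp add: Q_def B_def L2_inner_self)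
  qed
  define m where "m = Inf (Q ` V)"
  have bdd: "bdd_below (Q ` V)" using Qlow by (intro bdd_belowI2) auto
  have m_le: "m \<le> Q u" if "u \<in> V" for u
    unfolding m_def by (intro cInf_lower bdd imageI that)
  have "\<exists>u\<in>V. Q u < m + 1 / Suc n" for n
  proof -
    have "Inf (Q ` V) < m + 1 / Suc n" by (simp add: m_def)
    then obtain y where "y \<in> Q ` V" "y < m + 1 / Suc n"
      using V_zero by (metis cInf_lessD image_is_empty empty_iff)
    then show ?thesis by blast
  qed
  then obtain u where u: "\<And>n. u n \<in> V" "\<And>n. Q (u n) < m + 1 / Suc n" by metis
  have cau: "(form_norm M \<E> (\<lambda>x. u i x - u j x))\<^sup>2 \<le> (1 / l + 1) * (2 / Suc i + 2 / Suc j)" for i j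
  proof -
    define d where "d = (\<lambda>x. u i x - u j x)"
    obtain c :: real where c: "c = 1/2" by blast
    define s where "s = (\<lambda>x. c * (u i x + u j x))"
    have s: "s \<in> V" and d: "d \<in> V" unfolding s_def d_def by (intro vs u)+
    note expand = E_bilinear L2_inner_bilinear vs L2_diff L2_add L2_scale u(1) E_sym[OF u(1) u(1), of i j]
          L2_inner_commute[of M "u i" "u j"]
    have Qs: "Q s = c * c * (B (u i) (u i) + 2 * B (u j) (u i) + B (u j) (u j))
        - 2 * c * (l * L2_inner M h (u i) + l * L2_inner M h (u j))"
      unfolding s_def Q_def B_def by (simp add: expand algebra_simps)
    have Bd: "B d d = B (u i) (u i) - 2 * B (u j) (u i) + B (u j) (u j)"
      unfolding d_def B_def by (simp add: expand algebra_simps)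
    have "B d d = 2 * Q (u i) + 2 * Q (u j) - 4 * Q s"
      unfolding Bd Qs c unfolding Q_def by (simp add: algebra_simps)
    also have "\<dots> \<le> 2 / Suc i + 2 / Suc j"
      using u(2)[of i] u(2)[of j] m_le[OF s] by simp
    finally have Bd: "B d d \<le> 2 / Suc i + 2 / Suc j" .
    have "(form_norm M \<E> d)\<^sup>2 = L2_inner M d d + \<E> d d"
      using E_nonneg[OF d] by (simp add: form_norm_def L2_inner_self L2_norm_sq)
    also have "\<dots> \<le> (1 / l) * B d d + B d d"
      using E_nonneg[OF d] l by (intro add_mono) (auto simp: B_def field_simps L2_inner_self)
    also have "\<dots> = (1 / l + 1) * B d d" by (simp add: algebra_simps)
    also have "\<dots> \<le> (1 / l + 1) * (2 / Suc i + 2 / Suc j)"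
      using l by (intro mult_left_mono Bd) auto
    finally show ?thesis unfolding d_def .
  qed
  have "\<exists>f\<in>V. (\<lambda>n. form_norm M \<E> (\<lambda>x. u n x - f x)) \<longlonglongrightarrow> 0"
  proof (rule E_closed)
    fix e :: real assume e: "e > 0"
    have "(\<lambda>n. (1 / l + 1) * (4 * inverse (real (Suc n)))) \<longlonglongrightarrow> (1 / l + 1) * (4 * 0)"
      by (intro tendsto_intros LIMSEQ_inverse_real_of_nat)
    then have "\<forall>\<^sub>F n in sequentially. (1 / l + 1) * (4 * inverse (real (Suc n))) < e\<^sup>2"
      by (rule order_tendstoD) (use e in auto)
    from eventually_happens'[OF sequentially_bot this]
    obtain N where N: "(1 / l + 1) * (4 * inverse (real (Suc N))) < e\<^sup>2" by blast
    have four: "2 / real (Suc N) + 2 / real (Suc N) = 4 * inverse (real (Suc N))"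
      unfolding divide_inverse by (simp only: distrib_right[symmetric]) simp
    have "form_norm M \<E> (\<lambda>x. u i x - u j x) < e" if "i \<ge> N" "j \<ge> N" for i j
    proof -
      have "(form_norm M \<E> (\<lambda>x. u i x - u j x))\<^sup>2 \<le> (1 / l + 1) * (2 / Suc i + 2 / Suc j)"
        by (rule cau)
      also have "\<dots> \<le> (1 / l + 1) * (2 / Suc N + 2 / Suc N)"
        using l that by (intro mult_left_mono add_mono divide_left_mono) auto
      also have "\<dots> < e\<^sup>2" using N unfolding four .
      finally show ?thesis using e by (intro power_less_imp_less_base[of _ 2 e]) auto
    qed
    then show "\<exists>n0. \<forall>m\<ge>n0. \<forall>n\<ge>n0. form_norm M \<E> (\<lambda>x. u m x - u n x) < e" by blast
  qed (rule u)
  then obtain f where f: "f \<in> V" and c: "(\<lambda>n. form_norm M \<E> (\<lambda>x. u n x - f x)) \<longlonglongrightarrow> 0" by blast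
  have cL: "(\<lambda>n. L2_norm M (\<lambda>x. u n x - f x)) \<longlonglongrightarrow> 0"
    using form_norm_tendsto_iff[of u f, OF u(1) f] c by blast
  have "B f v - l * L2_inner M h v = 0" if v: "v \<in> V" for v
  proof -
    have lim: "(\<lambda>n. B (u n) v - l * L2_inner M h v) \<longlonglongrightarrow> B f v - l * L2_inner M h v"
      unfolding B_def L2_inner_def
      by (intro tendsto_intros E_tendsto[OF u(1) f v c] L2_tendsto_inner[OF V_imp_L2[OF u(1)] V_imp_L2[OF f] V_imp_L2[OF v] cL])
    have "(B f v - l * L2_inner M h v)\<^sup>2 \<le> 0 * B v v"
    proof (rule quadratic_nonneg_imp)
      fix t :: real
      have ineq: "0 \<le> inverse (real (Suc n)) + 2 * t * (B (u n) v - l * L2_inner M h v) + t\<^sup>2 * B v v" for n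
      proof -
        have "m \<le> Q (\<lambda>x. u n x + t * v x)" by (intro m_le vs u v)
        also have "\<dots> = Q (u n) + 2 * t * (B (u n) v - l * L2_inner M h v) + t\<^sup>2 * B v v"
          unfolding Q_def B_def using u(1) v
          by (simp add: E_bilinear L2_inner_bilinear vs L2_diff L2_add L2_scale E_sym[of v "u n"]
            L2_inner_commute[of M v "u n"] power2_eq_square algebra_simps)
        finally show ?thesis using u(2)[of n] unfolding inverse_eq_divide by linarith
      qed
      have "(\<lambda>n. inverse (real (Suc n)) + 2 * t * (B (u n) v - l * L2_inner M h v) + t\<^sup>2 * B v v)
          \<longlonglongrightarrow> 0 + 2 * t * (B f v - l * L2_inner M h v) + t\<^sup>2 * B v v"
        by (intro tendsto_intros LIMSEQ_inverse_real_of_nat lim)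
      then show "0 \<le> 0 + 2 * t * (B f v - l * L2_inner M h v) + t\<^sup>2 * B v v"
        by (rule LIMSEQ_le_const) (use ineq in blast)
    qed (rule Bpos[OF v])
    then show ?thesis by simp
  qed
  with f show ?thesis unfolding B_def by auto
qed

text \<open>
  The operator \<open>l (l - \<Delta>)^(-1)\<close>. The factor \<open>l\<close> makes it a Markovian contraction that tends to
  the identity as \<open>l \<rightarrow> \<infinity>\<close>.
\<close>
definition resolvent :: "real \<Rightarrow> ('a \<Rightarrow> real) \<Rightarrow> 'a \<Rightarrow> real" where
  "resolvent l h = (SOME u. u \<in> V \<and> (\<forall>v\<in>V. \<E> u v + l * L2_inner M u v = l * L2_inner M h v))"

lemma
  assumes "0 < l" and "h \<in> L2 M"
  shows resolvent_V: "resolvent l h \<in> V"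
    and resolvent_eq: "\<And>v. v \<in> V \<Longrightarrow> \<E> (resolvent l h) v + l * L2_inner M (resolvent l h) v = l * L2_inner M h v"
proof -
  have "\<exists>u. u \<in> V \<and> (\<forall>v\<in>V. \<E> u v + l * L2_inner M u v = l * L2_inner M h v)"
    using resolvent_exists[OF assms] by blast
  from someI_ex[OF this] show "resolvent l h \<in> V"
    and "\<And>v. v \<in> V \<Longrightarrow> \<E> (resolvent l h) v + l * L2_inner M (resolvent l h) v = l * L2_inner M h v"
    by (auto simp: resolvent_def)
qed

lemma resolvent_L2: "0 < l \<Longrightarrow> h \<in> L2 M \<Longrightarrow> resolvent l h \<in> L2 M"
  by (rule V_imp_L2[OF resolvent_V])

lemma E_resolvent:
  assumes l: "0 < l" and h: "h \<in> L2 M" and v: "v \<in> V"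
  shows "\<E> (resolvent l h) v = l * L2_inner M (\<lambda>x. h x - resolvent l h x) v"
  using resolvent_eq[OF l h v] by (simp add: L2_inner_diff_left h V_imp_L2[OF v] resolvent_L2[OF l h] algebra_simps)

lemma resolvent_unique:
  assumes l: "0 < l" and h: "h \<in> L2 M" and u: "u \<in> V"
    and eq: "\<And>v. v \<in> V \<Longrightarrow> \<E> u v + l * L2_inner M u v = l * L2_inner M h v"
  shows "AE x in M. u x = resolvent l h x"
proof -
  let ?w = "resolvent l h" let ?d = "\<lambda>x. u x - ?w x"
  have w: "?w \<in> V" by (rule resolvent_V[OF l h])
  have d: "?d \<in> V" by (rule V_diff[OF u w])
  have "\<E> ?d ?d + l * L2_inner M ?d ?d = 0"
    using eq[OF d] resolvent_eq[OF l h d]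
    by (simp add: E_diff[OF u w d] L2_inner_diff_left[OF V_imp_L2[OF u] V_imp_L2[OF w] V_imp_L2[OF d]] algebra_simps)
  then have "l * (L2_norm M ?d)\<^sup>2 \<le> 0"
    using E_nonneg[OF d] by (simp add: L2_inner_self)
  then have "L2_norm M ?d = 0" using l by (simp add: mult_le_0_iff)
  from L2_norm_zero_AE[OF V_imp_L2[OF d] this] show ?thesis by simp
qed

lemma resolvent_lin:
  assumes l: "0 < l" and f: "f \<in> L2 M" and g: "g \<in> L2 M"
  shows "AE x in M. resolvent l (\<lambda>x. a * f x + b * g x) x = a * resolvent l f x + b * resolvent l g x"
proof -
  let ?f = "resolvent l f" and ?g = "resolvent l g"
  have V: "?f \<in> V" "?g \<in> V" by (intro resolvent_V l f g)+
  have "AE x in M. a * ?f x + b * ?g x = resolvent l (\<lambda>x. a * f x + b * g x) x"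
  proof (rule resolvent_unique[OF l])
    show "(\<lambda>x. a * f x + b * g x) \<in> L2 M" by (intro L2_add L2_scale f g)
    show "(\<lambda>x. a * ?f x + b * ?g x) \<in> V" by (intro V_add V_scale V)
    fix v assume v: "v \<in> V"
    note simps = E_bilinear L2_inner_bilinear V_add V_scale V V_imp_L2 L2_add L2_scale f g v
    have "\<E> (\<lambda>x. a * ?f x + b * ?g x) v + l * L2_inner M (\<lambda>x. a * ?f x + b * ?g x) v
      = a * (\<E> ?f v + l * L2_inner M ?f v) + b * (\<E> ?g v + l * L2_inner M ?g v)"
      by (simp add: simps algebra_simps)
    also have "\<dots> = l * L2_inner M (\<lambda>x. a * f x + b * g x) v"
      unfolding resolvent_eq[OF l f v] resolvent_eq[OF l g v] by (simp add: simps algebra_simps)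
    finally show "\<E> (\<lambda>x. a * ?f x + b * ?g x) v + l * L2_inner M (\<lambda>x. a * ?f x + b * ?g x) v = \<dots>" .
  qed
  then show ?thesis by eventually_elim simp
qed

lemma resolvent_sym:
  assumes l: "0 < l" and f: "f \<in> L2 M" and g: "g \<in> L2 M"
  shows "L2_inner M (resolvent l f) g = L2_inner M f (resolvent l g)"
proof -
  let ?f = "resolvent l f" and ?g = "resolvent l g"
  have V: "?f \<in> V" "?g \<in> V" by (intro resolvent_V l f g)+
  have "l * L2_inner M f ?g = \<E> ?f ?g + l * L2_inner M ?f ?g"
    using resolvent_eq[OF l f V(2)] by simp
  also have "\<dots> = \<E> ?g ?f + l * L2_inner M ?g ?f"
    using E_sym[OF V] L2_inner_commute[of M ?f ?g] by simp
  also have "\<dots> = l * L2_inner M g ?f" by (rule resolvent_eq[OF l g V(1)])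
  finally show ?thesis using l L2_inner_commute[of M g ?f] by simp
qed

lemma resolvent_contraction:
  assumes l: "0 < l" and h: "h \<in> L2 M"
  shows "L2_norm M (resolvent l h) \<le> L2_norm M h"
proof -
  let ?w = "resolvent l h"
  have w: "?w \<in> V" by (rule resolvent_V[OF l h])
  have "l * (L2_norm M ?w)\<^sup>2 \<le> l * L2_inner M h ?w"
    using resolvent_eq[OF l h w] E_nonneg[OF w] unfolding L2_inner_self by linarith
  also have "\<dots> \<le> l * (L2_norm M h * L2_norm M ?w)"
    using L2_inner_le[OF h V_imp_L2[OF w]] l by (intro mult_left_mono) auto
  finally have "l * (L2_norm M ?w)\<^sup>2 \<le> l * (L2_norm M h * L2_norm M ?w)" .
  then have "L2_norm M ?w * L2_norm M ?w \<le> L2_norm M h * L2_norm M ?w"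
    using l by (simp add: power2_eq_square)
  then show ?thesis
    by (metis L2_norm_nonneg mult_right_le_imp_le order_le_less)
qed

text \<open>
  The Yosida approximation \<open>l \<langle>f, f - R f\<rangle>\<close> of the energy is the minimal value of
  \<open>\<E>(u,u) + l \<parallel>u - f\<parallel>\<^sup>2\<close>. It is compared with the value at \<open>u = f\<close>, and the remaining term is what strict
  convexity adds.
\<close>
lemma resolvent_energy_le:
  assumes l: "0 < l" and f: "f \<in> V"
  shows "l * L2_inner M f (\<lambda>x. f x - resolvent l f x) + l * (L2_norm M (\<lambda>x. f x - resolvent l f x))\<^sup>2 \<le> \<E> f f"
proof -
  let ?w = "resolvent l f" let ?d = "\<lambda>x. f x - ?w x"
  have f2: "f \<in> L2 M" by (rule V_imp_L2[OF f])
  have w: "?w \<in> V" by (rule resolvent_V[OF l f2])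
  have d: "?d \<in> V" by (rule V_diff[OF f w])
  have "0 \<le> \<E> ?d ?d" by (rule E_nonneg[OF d])
  also have "\<E> ?d ?d = \<E> f f - \<E> ?w f - \<E> ?w ?d"
    using E_sym[OF f w] by (simp add: E_bilinear f w d)
  also have "\<E> ?w f = l * L2_inner M f ?d"
    by (simp add: E_resolvent[OF l f2 f] L2_inner_commute)
  also have "\<E> ?w ?d = l * (L2_norm M ?d)\<^sup>2"
    by (simp add: E_resolvent[OF l f2 d] L2_inner_self)
  finally show ?thesis by simp
qed

text \<open>
  On the domain of the form the energy bound gives the rate \<open>1 / sqrt l\<close>; the general case follows by
  density because the resolvents are contractions.
\<close>
lemma resolvent_tendsto_L2:
  assumes h: "h \<in> L2 M"
  shows "(\<lambda>n. L2_norm M (\<lambda>x. resolvent (real (Suc n)) h x - h x)) \<longlonglongrightarrow> 0"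
proof (rule LIMSEQ_I)
  fix e :: real assume e: "e > 0"
  then obtain g where g: "g \<in> V" and hg: "L2_norm M (\<lambda>x. h x - g x) < e / 3"
    using V_dense[OF h, of "e / 3"] by auto
  have g2: "g \<in> L2 M" by (rule V_imp_L2[OF g])
  have "(\<lambda>n. \<E> g g * inverse (real (Suc n))) \<longlonglongrightarrow> \<E> g g * 0"
    by (intro tendsto_intros LIMSEQ_inverse_real_of_nat)
  then have "\<forall>\<^sub>F n in sequentially. \<E> g g * inverse (real (Suc n)) < (e / 3)\<^sup>2"
    by (rule order_tendstoD) (use e in auto)
  then obtain N where N: "\<And>n. n \<ge> N \<Longrightarrow> \<E> g g * inverse (real (Suc n)) < (e / 3)\<^sup>2"
    unfolding eventually_sequentially by blast
  have "norm (L2_norm M (\<lambda>x. resolvent (real (Suc n)) h x - h x) - 0) < e" if n: "n \<ge> N" for n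
  proof -
    let ?l = "real (Suc n)" let ?R = "resolvent ?l"
    have l: "0 < ?l" by simp
    note R = resolvent_L2[OF l]
    have "?l * L2_inner M g (\<lambda>x. g x - ?R g x) \<ge> 0"
    proof -
      have "L2_inner M g (?R g) \<le> L2_norm M g * L2_norm M (?R g)"
        using L2_inner_le[OF g2 R[OF g2]] by simp
      also have "\<dots> \<le> L2_norm M g * L2_norm M g"
        by (intro mult_left_mono resolvent_contraction[OF l g2]) simp
      finally have "0 \<le> L2_inner M g (\<lambda>x. g x - ?R g x)"
        by (simp add: L2_inner_bilinear g2 R L2_inner_self power2_eq_square)
      then show ?thesis by simp
    qed
    with resolvent_energy_le[OF l g] have "?l * (L2_norm M (\<lambda>x. g x - ?R g x))\<^sup>2 \<le> \<E> g g" by linarith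
    then have "(L2_norm M (\<lambda>x. g x - ?R g x))\<^sup>2 \<le> \<E> g g * inverse ?l"
      by (simp add: field_simps)
    also have "\<dots> < (e / 3)\<^sup>2" by (rule N[OF n])
    finally have 1: "L2_norm M (\<lambda>x. ?R g x - g x) < e / 3"
      using e by (subst L2_norm_minus_commute) (intro power_less_imp_less_base[of _ 2 "e/3"], auto)
    have hg2: "(\<lambda>x. h x - g x) \<in> L2 M" by (rule L2_diff[OF h g2])
    have "L2_norm M (\<lambda>x. ?R h x - ?R g x) = L2_norm M (?R (\<lambda>x. h x - g x))"
    proof (rule L2_norm_cong_AE)
      show "AE x in M. ?R h x - ?R g x = ?R (\<lambda>x. h x - g x) x"
        using resolvent_lin[OF l h g2, of 1 "-1"] by eventually_elim simp
    qed (rule L2_measurable, intro L2_diff R h g2 hg2)+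
    also have "\<dots> \<le> L2_norm M (\<lambda>x. h x - g x)" by (rule resolvent_contraction[OF l hg2])
    finally have 2: "L2_norm M (\<lambda>x. ?R h x - ?R g x) < e / 3" using hg by linarith
    have 3: "L2_norm M (\<lambda>x. g x - h x) < e / 3" using hg by (subst L2_norm_minus_commute)
    have "L2_norm M (\<lambda>x. ?R h x - h x) \<le> L2_norm M (\<lambda>x. ?R h x - ?R g x) + L2_norm M (\<lambda>x. ?R g x - h x)"
      by (rule L2_norm_triangle_diff[OF R[OF h] R[OF g2] h])
    also have "\<dots> \<le> L2_norm M (\<lambda>x. ?R h x - ?R g x) + (L2_norm M (\<lambda>x. ?R g x - g x) + L2_norm M (\<lambda>x. g x - h x))"
      by (intro add_left_mono L2_norm_triangle_diff[OF R[OF g2] g2 h])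
    also have "\<dots> < e" using 1 2 3 by linarith
    finally show ?thesis by simp
  qed
  then show "\<exists>N. \<forall>n\<ge>N. norm (L2_norm M (\<lambda>x. resolvent (real (Suc n)) h x - h x) - 0) < e" by blast
qed

text \<open>
  A square integrable function belongs to the domain of the form as soon as its approximate
  energies stay bounded. These energies are minimal values, hence increasing in the parameter, and by
  strict convexity their increments control the distance in the form norm between two resolvents; so
  the resolvents of \<open>F\<close> form a Cauchy sequence.
\<close>
lemma resolvent_bounded_form:
  assumes F: "F \<in> L2 M"
    and B: "\<And>n. real (Suc n) * L2_inner M F (\<lambda>x. F x - resolvent (real (Suc n)) F x) \<le> B"
  shows "F \<in> V" "(\<lambda>n. form_norm M \<E> (\<lambda>x. resolvent (real (Suc n)) F x - F x)) \<longlonglongrightarrow> 0"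
proof -
  let ?R = "\<lambda>n. resolvent (real (Suc n)) F"
  define En where "En n = real (Suc n) * L2_inner M F (\<lambda>x. F x - ?R n x)" for n
  have RV: "?R n \<in> V" for n by (intro resolvent_V F) simp
  have R2: "?R n \<in> L2 M" for n by (rule V_imp_L2[OF RV])
  \<comment> \<open>Compare the minimiser for the larger parameter with the minimum for the smaller one.\<close>
  have key: "(form_norm M \<E> (\<lambda>x. ?R j x - ?R i x))\<^sup>2 \<le> En j - En i" if ij: "i \<le> j" for i j
  proof -
    define d where "d = (\<lambda>x. ?R j x - ?R i x)"
    define a where "a = ?R i"
    define b where "b = ?R j"
    have d: "d \<in> V" and a: "a \<in> V" and b: "b \<in> V" unfolding d_def a_def b_def by (intro V_diff RV)+
    have dd: "d = (\<lambda>x. b x - a x)" by (simp add: a_def b_def d_def)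
    let ?l = "real (Suc i)" and ?m = "real (Suc j)"
    have lm: "?l \<le> ?m" using ij by simp
    note simps = E_bilinear L2_inner_bilinear V_diff V_imp_L2 L2_diff F a b d
    have ea: "\<E> a v + ?l * L2_inner M a v = ?l * L2_inner M F v" if "v \<in> V" for v
      unfolding a_def by (rule resolvent_eq[OF _ F that]) simp
    have eb: "\<E> b v + ?m * L2_inner M b v = ?m * L2_inner M F v" if "v \<in> V" for v
      unfolding b_def by (rule resolvent_eq[OF _ F that]) simp
    have Ei: "En i = ?l * (L2_inner M F F - L2_inner M F a)"
      unfolding En_def by (simp add: L2_inner_bilinear F R2 a_def)
    have Ej: "En j = ?m * (L2_inner M F F - L2_inner M F b)"
      unfolding En_def by (simp add: L2_inner_bilinear F R2 b_def)
    have "?l * L2_inner M (\<lambda>x. b x - F x) (\<lambda>x. b x - F x) \<le> ?m * L2_inner M (\<lambda>x. b x - F x) (\<lambda>x. b x - F x)"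
      using lm by (intro mult_right_mono) (auto simp: L2_inner_self)
    then have 1: "?l * (L2_inner M b b - 2 * L2_inner M F b + L2_inner M F F)
        \<le> ?m * (L2_inner M b b - 2 * L2_inner M F b + L2_inner M F F)"
      by (simp add: L2_inner_bilinear V_imp_L2 L2_diff F a b L2_inner_commute[of M b F] algebra_simps)
    have dE: "\<E> d d = \<E> b b - 2 * \<E> a b + \<E> a a"
      unfolding dd by (simp add: E_bilinear V_diff a b E_sym[OF b a])
    have dL: "L2_inner M d d = L2_inner M b b - 2 * L2_inner M a b + L2_inner M a a"
      unfolding dd by (simp add: L2_inner_bilinear V_imp_L2 L2_diff a b L2_inner_commute[of M b a])
    have "(form_norm M \<E> d)\<^sup>2 = L2_inner M d d + \<E> d d"
      using E_nonneg[OF d] by (simp add: form_norm_def L2_inner_self L2_norm_sq)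
    also have "\<dots> \<le> ?l * L2_inner M d d + \<E> d d"
      using mult_right_mono[of 1 ?l "L2_inner M d d"] by (simp add: L2_inner_self)
    also have "\<dots> \<le> En j - En i"
      using 1 ea[OF a] ea[OF b] eb[OF b] unfolding dE dL Ei Ej
      by (simp only: right_diff_distrib distrib_left)
    finally show ?thesis unfolding d_def .
  qed
  have inc: "incseq En"
    unfolding incseq_def
  proof safe
    fix i j :: nat assume "i \<le> j"
    from key[OF this] show "En i \<le> En j" by (smt (verit) zero_le_power2)
  qed
  then obtain L where L: "En \<longlonglongrightarrow> L" "\<And>i. En i \<le> L"
    using incseq_convergent[OF inc, of B] B unfolding En_def by blast
  have "\<exists>G\<in>V. (\<lambda>n. form_norm M \<E> (\<lambda>x. ?R n x - G x)) \<longlonglongrightarrow> 0"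
  proof (rule E_closed)
    fix e :: real assume e: "e > 0"
    have "\<forall>\<^sub>F n in sequentially. L - e\<^sup>2 < En n"
      by (rule order_tendstoD(1)[OF L(1)]) (use e in auto)
    from eventually_happens'[OF sequentially_bot this]
    obtain N where N: "L - e\<^sup>2 < En N" by blast
    have lt: "form_norm M \<E> (\<lambda>x. ?R j x - ?R i x) < e" if "N \<le> i" "i \<le> j" for i j
    proof -
      have "(form_norm M \<E> (\<lambda>x. ?R j x - ?R i x))\<^sup>2 \<le> En j - En i" by (rule key[OF that(2)])
      also have "\<dots> < e\<^sup>2" using L(2)[of j] N incseqD[OF inc that(1)] by linarith
      finally show ?thesis using e by (intro power_less_imp_less_base[of _ 2 e]) auto
    qed
    have sym: "form_norm M \<E> (\<lambda>x. ?R j x - ?R i x) = form_norm M \<E> (\<lambda>x. ?R i x - ?R j x)" for i j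
    proof -
      have "\<E> (\<lambda>x. ?R j x - ?R i x) (\<lambda>x. ?R j x - ?R i x) = \<E> (\<lambda>x. ?R i x - ?R j x) (\<lambda>x. ?R i x - ?R j x)"
        by (simp add: E_bilinear V_diff RV)
      then show ?thesis by (simp add: form_norm_def power2_commute)
    qed
    have "form_norm M \<E> (\<lambda>x. ?R j x - ?R i x) < e" if "N \<le> i" "N \<le> j" for i j
      using lt[of i j] lt[of j i] sym[of j i] that by (cases "i \<le> j") auto
    then show "\<exists>n0. \<forall>m\<ge>n0. \<forall>n\<ge>n0. form_norm M \<E> (\<lambda>x. ?R m x - ?R n x) < e" by blast
  qed (rule RV)
  then obtain G where G: "G \<in> V" and c: "(\<lambda>n. form_norm M \<E> (\<lambda>x. ?R n x - G x)) \<longlonglongrightarrow> 0" by blast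
  have "AE x in M. G x = F x"
    using form_norm_tendsto_iff[of ?R G, OF RV G] c
    by (intro L2_norm_tendsto_unique[OF R2 V_imp_L2[OF G] F _ resolvent_tendsto_L2[OF F]]) blast
  then show FV: "F \<in> V" by (intro V_cong[OF G L2_measurable[OF F]])
  have "form_norm M \<E> (\<lambda>x. ?R n x - F x) = form_norm M \<E> (\<lambda>x. ?R n x - G x)" for n
  proof -
    have ae: "AE x in M. ?R n x - F x = ?R n x - G x"
      using \<open>AE x in M. G x = F x\<close> by eventually_elim simp
    have v: "(\<lambda>x. ?R n x - F x) \<in> V" "(\<lambda>x. ?R n x - G x) \<in> V" by (intro V_diff RV FV G)+
    have "\<E> (\<lambda>x. ?R n x - F x) (\<lambda>x. ?R n x - F x) = \<E> (\<lambda>x. ?R n x - G x) (\<lambda>x. ?R n x - G x)"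
      using E_cong[OF v v(1) ae] E_cong_right[OF v v(2) ae] by simp
    moreover have "L2_norm M (\<lambda>x. ?R n x - F x) = L2_norm M (\<lambda>x. ?R n x - G x)"
      by (rule L2_norm_cong_AE[OF _ _ ae]; rule L2_measurable; rule V_imp_L2; rule v)
    ultimately show ?thesis unfolding form_norm_def L2_norm_sq[symmetric] by simp
  qed
  with c show "(\<lambda>n. form_norm M \<E> (\<lambda>x. ?R n x - F x)) \<longlonglongrightarrow> 0" by simp
qed

lemma resolvent_tendsto_V:
  assumes F: "F \<in> V"
  shows "(\<lambda>n. form_norm M \<E> (\<lambda>x. resolvent (real (Suc n)) F x - F x)) \<longlonglongrightarrow> 0"
proof (rule resolvent_bounded_form(2)[OF V_imp_L2[OF F]])
  fix n
  show "real (Suc n) * L2_inner M F (\<lambda>x. F x - resolvent (real (Suc n)) F x) \<le> \<E> F F"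
    using resolvent_energy_le[OF _ F, of "real (Suc n)"]
    by (smt (verit) mult_nonneg_nonneg of_nat_0_le_iff of_nat_0_less_iff zero_le_power2 zero_less_Suc)
qed

section \<open>The Markov property of the resolvent\<close>

lemma exhaustion:
  obtains A :: "nat \<Rightarrow> 'a set"
  where "\<And>i. A i \<in> sets M" "\<And>i. emeasure M (A i) \<noteq> \<infinity>" "incseq A" "(\<Union>i. A i) = space M"
proof -
  interpret sigma_finite_measure M by (rule sigma_finite)
  obtain A :: "nat \<Rightarrow> 'a set" where A: "range A \<subseteq> sets M" "(\<Union>i. A i) = space M"
    "\<And>i. emeasure M (A i) \<noteq> \<infinity>" "incseq A"
    using sigma_finite_incseq by blast
  have "A i \<in> sets M" for i using A(1) by blast
  then show ?thesis using A(3,4,2) by (rule that)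
qed

lemma exhaustion_indicator_tendsto:
  assumes "incseq A" "(\<Union>i. A i) = space M" "x \<in> space M"
  shows "(\<lambda>i. indicator (A i) x :: real) \<longlonglongrightarrow> 1"
proof -
  obtain N where N: "x \<in> A N" using assms by blast
  have "\<forall>\<^sub>F i in sequentially. indicator (A i) x = (1 :: real)"
    using eventually_ge_at_top[of N]
  proof eventually_elim
    case (elim i)
    then have "x \<in> A i" using N incseqD[OF assms(1), of N i] by blast
    then show ?case by simp
  qed
  then show ?thesis by (rule tendsto_eventually)
qed

lemma exhaustion_tail:
  fixes a :: "'a \<Rightarrow> real"
  assumes A: "\<And>i. A i \<in> sets M" "incseq A" "(\<Union>i. A i) = space M" and a: "integrable M a"
  shows "(\<lambda>i. \<integral>x. \<bar>a x\<bar> * (1 - indicator (A i) x) \<partial>M) \<longlonglongrightarrow> 0"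
proof -
  have [measurable]: "A i \<in> sets M" for i by (rule A)
  have [measurable]: "a \<in> borel_measurable M" using a by auto
  have "(\<lambda>i. \<integral>x. \<bar>a x\<bar> * (1 - indicator (A i) x) \<partial>M) \<longlonglongrightarrow> (\<integral>x. 0 \<partial>M)"
  proof (rule integral_dominated_convergence)
    show "integrable M (\<lambda>x. \<bar>a x\<bar>)" using a by simp
    show "AE x in M. (\<lambda>i. \<bar>a x\<bar> * (1 - indicator (A i) x)) \<longlonglongrightarrow> 0"
    proof (rule AE_I2)
      fix x assume x: "x \<in> space M"
      have "(\<lambda>i. \<bar>a x\<bar> * (1 - indicator (A i) x)) \<longlonglongrightarrow> \<bar>a x\<bar> * (1 - 1)"
        by (intro tendsto_intros exhaustion_indicator_tendsto A x)
      then show "(\<lambda>i. \<bar>a x\<bar> * (1 - indicator (A i) x)) \<longlonglongrightarrow> 0" by simp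
    qed
  qed (auto simp: indicator_def)
  then show ?thesis by simp
qed

text \<open>
  For \<open>0 \<le> h \<le> 1\<close> the unit contraction of the minimiser \<open>R h\<close> has no larger energy and is no farther
  from \<open>h\<close>, so it is again a minimiser and equals \<open>R h\<close>.
\<close>
lemma resolvent_markov:
  assumes l: "0 < l" and h: "h \<in> L2 M" and b: "AE x in M. 0 \<le> h x \<and> h x \<le> 1"
  shows "AE x in M. 0 \<le> resolvent l h x \<and> resolvent l h x \<le> 1"
proof -
  define u where "u = resolvent l h"
  define v where "v = (\<lambda>x. max 0 (min 1 (u x)))"
  define d where "d = (\<lambda>x. v x - u x)"
  have u: "u \<in> V" unfolding u_def by (rule resolvent_V[OF l h])
  have v: "v \<in> V" unfolding v_def by (rule E_contraction_dom[OF u])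
  have d: "d \<in> V" unfolding d_def by (rule V_diff[OF v u])
  note L2s = V_imp_L2[OF u] V_imp_L2[OF v] V_imp_L2[OF d]
  have "L2_norm M (\<lambda>x. v x - h x) \<le> L2_norm M (\<lambda>x. u x - h x)"
  proof (rule L2_norm_mono)
    show "(\<lambda>x. u x - h x) \<in> L2 M" by (intro L2_diff L2s h)
    show "(\<lambda>x. v x - h x) \<in> borel_measurable M" by (intro L2_measurable L2_diff L2s h)
    show "AE x in M. \<bar>v x - h x\<bar> \<le> \<bar>u x - h x\<bar>"
      using b by eventually_elim (auto simp: v_def)
  qed
  then have "(L2_norm M (\<lambda>x. v x - h x))\<^sup>2 \<le> (L2_norm M (\<lambda>x. u x - h x))\<^sup>2"
    by (intro power_mono) auto
  then have 1: "l * L2_inner M (\<lambda>x. v x - h x) (\<lambda>x. v x - h x) \<le> l * L2_inner M (\<lambda>x. u x - h x) (\<lambda>x. u x - h x)"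
    unfolding L2_inner_self using l by (intro mult_left_mono) auto
  have 2: "\<E> v v \<le> \<E> u u" unfolding v_def by (rule E_contraction[OF u])
  have 3: "\<E> u d + l * L2_inner M u d = l * L2_inner M h d"
    unfolding u_def by (rule resolvent_eq[OF l h d])
  have dE: "\<E> v v = \<E> u u + 2 * \<E> u d + \<E> d d"
    unfolding d_def by (simp add: E_bilinear u v V_diff E_sym[OF v u])
  have dL: "L2_inner M (\<lambda>x. v x - h x) (\<lambda>x. v x - h x) = L2_inner M (\<lambda>x. u x - h x) (\<lambda>x. u x - h x)
      + 2 * (L2_inner M u d - L2_inner M h d) + L2_inner M d d"
    unfolding d_def by (simp add: L2_inner_bilinear L2s L2_diff h L2_inner_commute[of M v u]
        L2_inner_commute[of M h u] L2_inner_commute[of M h v])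
  have "\<E> d d + l * L2_inner M d d \<le> 0"
    using 1 2 3 unfolding dE dL by (simp add: algebra_simps)
  then have "l * (L2_norm M d)\<^sup>2 \<le> 0"
    using E_nonneg[OF d] by (simp add: L2_inner_self)
  then have "L2_norm M d = 0" using l by (simp add: mult_le_0_iff)
  from L2_norm_zero_AE[OF L2s(3) this] show ?thesis
    by eventually_elim (auto simp: d_def v_def u_def[symmetric])
qed

lemma resolvent_between:
  assumes l: "0 < l" and h: "h \<in> L2 M" and c: "0 \<le> c" and b: "AE x in M. 0 \<le> h x \<and> h x \<le> c"
  shows "AE x in M. 0 \<le> resolvent l h x \<and> resolvent l h x \<le> c"
proof (cases "c = 0")
  case True
  have "AE x in M. h x = 0" using b by eventually_elim (use True in auto)
  then have "L2_norm M h = 0"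
    using L2_norm_cong_AE[OF L2_measurable[OF h], of "\<lambda>_. 0"] by simp
  then have "L2_norm M (resolvent l h) = 0"
    using resolvent_contraction[OF l h] L2_norm_nonneg[of M "resolvent l h"] by linarith
  from L2_norm_zero_AE[OF resolvent_L2[OF l h] this] True show ?thesis by auto
next
  case False
  with c have c: "c > 0" by simp
  have "AE x in M. 0 \<le> resolvent l (\<lambda>x. 1 / c * h x + 0 * h x) x \<and> resolvent l (\<lambda>x. 1 / c * h x + 0 * h x) x \<le> 1"
  proof (rule resolvent_markov[OF l])
    show "(\<lambda>x. 1 / c * h x + 0 * h x) \<in> L2 M" by (intro L2_add L2_scale h)
    show "AE x in M. 0 \<le> 1 / c * h x + 0 * h x \<and> 1 / c * h x + 0 * h x \<le> 1"
      using b by eventually_elim (use c in auto)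
  qed
  with resolvent_lin[OF l h h, of "1 / c" 0] show ?thesis
  proof eventually_elim
    case (elim x)
    let ?w = "resolvent l (\<lambda>x. 1 / c * h x + 0 * h x) x"
    have "resolvent l h x = c * ?w" using elim(1) c by (simp add: field_simps)
    moreover have "0 \<le> c * ?w" "c * ?w \<le> c * 1"
      using elim(2) c by (intro mult_nonneg_nonneg mult_left_mono; simp)+
    ultimately show ?case by simp
  qed
qed

text \<open>
  Negative and positive parts are treated separately, so that \<open>m\<close> only bounds \<open>g\<close> from below.
  The conclusion is what a sub-Markovian kernel gives: the constant \<open>-m \<le> 0\<close> is mapped to a function
  \<open>\<ge> -m\<close>.
\<close>
lemma resolvent_lower:
  assumes l: "0 < l" and g: "g \<in> L2 M" "g \<in> Linf M" and m: "0 \<le> m" and b: "AE x in M. - m \<le> g x"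
  shows "AE x in M. - m \<le> resolvent l g x"
proof -
  let ?p = "\<lambda>x. max 0 (g x)" and ?n = "\<lambda>x. max 0 (- g x)"
  obtain C where C: "0 \<le> C" "AE x in M. \<bar>g x\<bar> \<le> C" using g(2) by (rule LinfE)
  have [measurable]: "g \<in> borel_measurable M" by (rule L2_measurable[OF g(1)])
  have p: "?p \<in> L2 M" and n: "?n \<in> L2 M" by (rule L2_bound[OF g(1)]; auto)+
  have 1: "AE x in M. 0 \<le> resolvent l ?p x \<and> resolvent l ?p x \<le> C"
  proof (rule resolvent_between[OF l p C(1)])
    show "AE x in M. 0 \<le> ?p x \<and> ?p x \<le> C" using C(2) by eventually_elim auto
  qed
  have 2: "AE x in M. 0 \<le> resolvent l ?n x \<and> resolvent l ?n x \<le> m"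
  proof (rule resolvent_between[OF l n m])
    show "AE x in M. 0 \<le> ?n x \<and> ?n x \<le> m" using b by eventually_elim (use m in auto)
  qed
  have e: "(\<lambda>x. 1 * ?p x + (-1) * ?n x) = g" by (auto simp: max_def)
  have "AE x in M. resolvent l g x = 1 * resolvent l ?p x + (-1) * resolvent l ?n x"
    using resolvent_lin[OF l p n, of 1 "-1"] unfolding e .
  with 1 2 show ?thesis by eventually_elim simp
qed

lemma resolvent_abs_le:
  assumes l: "0 < l" and g: "g \<in> L2 M" and m: "0 \<le> m" and b: "AE x in M. \<bar>g x\<bar> \<le> m"
  shows "AE x in M. \<bar>resolvent l g x\<bar> \<le> m"
proof -
  have i: "g \<in> Linf M" by (rule LinfI[OF L2_measurable[OF g] b])
  have "AE x in M. - m \<le> g x" using b by eventually_elim auto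
  then have 1: "AE x in M. - m \<le> resolvent l g x"
    by (rule resolvent_lower[OF l g i m])
  have "AE x in M. - m \<le> (-1) * g x" using b by eventually_elim auto
  then have 2: "AE x in M. - m \<le> resolvent l (\<lambda>x. (-1) * g x) x"
    by (rule resolvent_lower[OF l L2_scale[OF g] Linf_scale[OF i] m])
  from 1 2 resolvent_lin[OF l g g, of "-1" 0] show ?thesis by eventually_elim auto
qed

lemma resolvent_Linf:
  assumes "0 < l" "g \<in> L2 M" "g \<in> Linf M"
  shows "resolvent l g \<in> Linf M"
proof -
  obtain C where "0 \<le> C" "AE x in M. \<bar>g x\<bar> \<le> C" using assms(3) by (rule LinfE)
  from resolvent_abs_le[OF assms(1,2) this] show ?thesis
    by (rule LinfI[OF L2_measurable[OF resolvent_L2[OF assms(1,2)]]])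
qed

text \<open>
  By symmetry, integrating \<open>R g\<close> over a set of finite measure is integrating \<open>g\<close> against the resolvent
  of its indicator, which is at most 1.
\<close>
lemma resolvent_integral_le:
  assumes l: "0 < l" and g: "g \<in> L2 M" "g \<in> Linf M" "integrable M g" and b: "AE x in M. 0 \<le> g x"
  shows "integrable M (resolvent l g)" "(\<integral>x. resolvent l g x \<partial>M) \<le> (\<integral>x. g x \<partial>M)"
proof -
  let ?w = "resolvent l g"
  obtain A :: "nat \<Rightarrow> 'a set" where A: "\<And>i. A i \<in> sets M" "\<And>i. emeasure M (A i) \<noteq> \<infinity>" "incseq A" "(\<Union>i. A i) = space M"
    by (rule exhaustion) blast
  have w2: "?w \<in> L2 M" by (rule resolvent_L2[OF l g(1)])
  have [measurable]: "?w \<in> borel_measurable M" by (rule L2_measurable[OF w2])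
  have w0: "AE x in M. 0 \<le> ?w x" using resolvent_lower[OF l g(1,2), of 0] b by simp
  let ?c = "\<lambda>i x. indicator (A i) x :: real"
  have c2: "?c i \<in> L2 M" for i by (rule L2_indicator[OF A(1,2)])
  let ?I = "\<lambda>i. \<integral>x. ?w x * ?c i x \<partial>M"
  have int: "integrable M (\<lambda>x. ?w x * ?c i x)" for i by (rule L2_mult_integrable[OF w2 c2])
  have mono: "AE x in M. mono (\<lambda>i. ?w x * ?c i x)"
    using w0
  proof eventually_elim
    case (elim x)
    have "?c i x \<le> ?c j x" if "i \<le> j" for i j
      using incseqD[OF A(3) that] by (auto simp: indicator_def)
    then show ?case using elim by (auto simp: mono_def intro!: mult_left_mono)
  qed
  have lim: "AE x in M. (\<lambda>i. ?w x * ?c i x) \<longlonglongrightarrow> ?w x"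
  proof (rule AE_I2)
    fix x assume "x \<in> space M"
    then have "(\<lambda>i. ?w x * ?c i x) \<longlonglongrightarrow> ?w x * 1"
      by (intro tendsto_intros exhaustion_indicator_tendsto A)
    then show "(\<lambda>i. ?w x * ?c i x) \<longlonglongrightarrow> ?w x" by simp
  qed
  have le: "?I i \<le> (\<integral>x. g x \<partial>M)" for i
  proof -
    have r: "AE x in M. 0 \<le> resolvent l (?c i) x \<and> resolvent l (?c i) x \<le> 1"
      by (rule resolvent_markov[OF l c2]) (auto simp: indicator_def)
    have "?I i = (\<integral>x. g x * resolvent l (?c i) x \<partial>M)"
      using resolvent_sym[OF l g(1) c2] by (simp add: L2_inner_def)
    also have "\<dots> \<le> (\<integral>x. g x \<partial>M)"
    proof (rule integral_mono_AE)
      show "integrable M (\<lambda>x. g x * resolvent l (?c i) x)" by (rule L2_mult_integrable[OF g(1) resolvent_L2[OF l c2]])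
      show "AE x in M. g x * resolvent l (?c i) x \<le> g x"
        using r b by eventually_elim (auto intro: mult_right_le_one_le)
    qed (rule g)
    finally show ?thesis .
  qed
  have "incseq ?I"
    unfolding incseq_def
  proof safe
    fix i j :: nat assume "i \<le> j"
    have "AE x in M. ?w x * ?c i x \<le> ?w x * ?c j x"
      using mono by eventually_elim (use \<open>i \<le> j\<close> in \<open>auto simp: mono_def\<close>)
    then show "?I i \<le> ?I j" by (intro integral_mono_AE int)
  qed
  then obtain L where L: "?I \<longlonglongrightarrow> L" using incseq_convergent[of ?I] le by blast
  show "integrable M ?w" by (rule integrable_monotone_convergence[OF int mono lim L]) measurable
  have "(\<integral>x. ?w x \<partial>M) = L" by (rule integral_monotone_convergence[OF int mono lim L]) measurable
  also have "L \<le> (\<integral>x. g x \<partial>M)" using L le by (intro LIMSEQ_le_const2) auto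
  finally show "(\<integral>x. ?w x \<partial>M) \<le> (\<integral>x. g x \<partial>M)" .
qed

lemma L2_square:
  assumes "f \<in> L2 M" "f \<in> Linf M" shows "(\<lambda>x. (f x)\<^sup>2) \<in> L2 M" "(\<lambda>x. (f x)\<^sup>2) \<in> Linf M"
proof -
  obtain C where "AE x in M. \<bar>f x\<bar> \<le> C" using assms(2) by (rule LinfE)
  from L2_mult_bounded[OF assms(1) L2_measurable[OF assms(1)] this]
  show "(\<lambda>x. (f x)\<^sup>2) \<in> L2 M" by (simp add: power2_eq_square)
  show "(\<lambda>x. (f x)\<^sup>2) \<in> Linf M" using Linf_mult[OF assms(2,2)] by (simp add: power2_eq_square)
qed

section \<open>The domain of the form as an algebra\<close>

text \<open>
  If \<open>R\<close> were given by a sub-probability kernel, the expression would be the integral of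
  \<open>(f(y) - f(x))\<^sup>2\<close> over \<open>y\<close>, plus the lost mass times \<open>f(x)\<^sup>2\<close>. In place of a kernel, the Markov property is
  applied to \<open>(f - a)\<^sup>2 - a\<^sup>2\<close> for each constant \<open>a\<close>, and then \<open>a = f(x)\<close> is inserted.
\<close>
lemma resolvent_variance_nonneg:
  assumes l: "0 < l" and f: "f \<in> L2 M" "f \<in> Linf M"
  shows "AE x in M. 0 \<le> resolvent l (\<lambda>x. (f x)\<^sup>2) x - 2 * f x * resolvent l f x + (f x)\<^sup>2"
proof -
  let ?F = "\<lambda>x. (f x)\<^sup>2"
  have F: "?F \<in> L2 M" "?F \<in> Linf M" by (rule L2_square[OF f])+
  have "AE x in M. \<forall>a\<in>UNIV. 0 \<le> resolvent l ?F x - 2 * a * resolvent l f x + a\<^sup>2"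
  proof (rule AE_all_of_continuous)
    fix a :: real
    have "AE x in M. - (a\<^sup>2) \<le> resolvent l (\<lambda>x. 1 * ?F x + (-2*a) * f x) x"
    proof (rule resolvent_lower[OF l])
      show "AE x in M. - (a\<^sup>2) \<le> 1 * ?F x + (-2*a) * f x"
      proof (rule AE_I2)
        show "- (a\<^sup>2) \<le> 1 * ?F x + (-2*a) * f x" for x
          using zero_le_power2[of "f x - a"] by (simp add: power2_diff algebra_simps)
      qed
    qed (intro L2_add L2_scale Linf_add Linf_scale f F zero_le_power2)+
    with resolvent_lin[OF l F(1) f(1), of 1 "-2*a"]
    show "AE x in M. 0 \<le> resolvent l ?F x - 2 * a * resolvent l f x + a\<^sup>2"
      by eventually_elim simp
  qed (intro continuous_intros)
  then show ?thesis by eventually_elim blast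
qed

text \<open>
  The analogue for kernels of \<open>(f(y)\<^sup>2 - f(x)\<^sup>2)\<^sup>2 \<le> 4 C\<^sup>2 (f(y) - f(x))\<^sup>2\<close>. With \<open>a\<close> in place of \<open>f(x)\<close> and \<open>f\<close> for \<open>f(y)\<close>,
  the difference of the two sides is \<open>(f - a)\<^sup>2 (4 C\<^sup>2 - (f + a)\<^sup>2) \<ge> 0\<close>; the mass lost by the kernel
  enters with the nonnegative factor \<open>m = 4 C\<^sup>2 a\<^sup>2 - a\<^sup>4\<close>.
\<close>
lemma resolvent_variance_square_le:
  assumes l: "0 < l" and f: "f \<in> L2 M" and C: "0 \<le> C" "AE x in M. \<bar>f x\<bar> \<le> C"
  shows "AE x in M. resolvent l (\<lambda>x. ((f x)\<^sup>2)\<^sup>2) x - 2 * (f x)\<^sup>2 * resolvent l (\<lambda>x. (f x)\<^sup>2) x + ((f x)\<^sup>2)\<^sup>2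
      \<le> 4 * C\<^sup>2 * (resolvent l (\<lambda>x. (f x)\<^sup>2) x - 2 * f x * resolvent l f x + (f x)\<^sup>2)"
proof -
  let ?F = "\<lambda>x. (f x)\<^sup>2" let ?F2 = "\<lambda>x. ((f x)\<^sup>2)\<^sup>2"
  have fi: "f \<in> Linf M" by (rule LinfI[OF L2_measurable[OF f] C(2)])
  have F: "?F \<in> L2 M" "?F \<in> Linf M" by (rule L2_square[OF f fi])+
  have F2: "?F2 \<in> L2 M" "?F2 \<in> Linf M" by (rule L2_square[OF F])+
  let ?q = "\<lambda>x a. 4 * C\<^sup>2 * (resolvent l ?F x - 2 * a * resolvent l f x + a\<^sup>2)
      - (resolvent l ?F2 x - 2 * a\<^sup>2 * resolvent l ?F x + (a\<^sup>2)\<^sup>2)"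
  have "AE x in M. \<forall>a\<in>{-C..C}. 0 \<le> ?q x a"
  proof (rule AE_all_of_continuous)
    fix a assume a: "a \<in> {-C..C}"
    define m where "m = 4 * C\<^sup>2 * a\<^sup>2 - (a\<^sup>2)\<^sup>2"
    have aC: "a\<^sup>2 \<le> C\<^sup>2" using a C(1) by (auto simp: abs_le_square_iff[symmetric])
    have m0: "0 \<le> m"
      using mult_right_mono[OF aC, of "a\<^sup>2"] zero_le_power2[of "C * a"]
      by (simp add: m_def power2_eq_square algebra_simps)
    define p where "p = (\<lambda>x. (4 * C\<^sup>2 + 2 * a\<^sup>2) * ?F x + (-8 * C\<^sup>2 * a) * f x)"
    have p: "p \<in> L2 M" "p \<in> Linf M" unfolding p_def by (intro L2_add L2_scale Linf_add Linf_scale f fi F)+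
    have "AE x in M. - m \<le> resolvent l (\<lambda>x. 1 * p x + (-1) * ?F2 x) x"
    proof (rule resolvent_lower[OF l])
      show "AE x in M. - m \<le> 1 * p x + (-1) * ?F2 x"
        using C(2)
      proof eventually_elim
        case (elim x)
        have "\<bar>f x + a\<bar> \<le> \<bar>2 * C\<bar>" using elim a by auto
        then have "(f x + a)\<^sup>2 \<le> (2 * C)\<^sup>2" by (simp only: abs_le_square_iff)
        then have "0 \<le> (f x - a)\<^sup>2 * (4 * C\<^sup>2 - (f x + a)\<^sup>2)"
          by (intro mult_nonneg_nonneg) (auto simp: power_mult_distrib)
        also have "\<dots> = 1 * p x + (-1) * ?F2 x + m"
          by (simp add: p_def m_def power2_eq_square algebra_simps)
        finally show ?case by linarith
      qed
    qed (intro L2_add L2_scale Linf_add Linf_scale p F2 m0)+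
    with resolvent_lin[OF l p(1) F2(1), of 1 "-1"]
      resolvent_lin[OF l F(1) f, of "4 * C\<^sup>2 + 2 * a\<^sup>2" "-8 * C\<^sup>2 * a"]
    show "AE x in M. 0 \<le> ?q x a"
      unfolding p_def[symmetric]
      by eventually_elim (simp add: m_def algebra_simps)
  qed (intro continuous_intros)
  with C(2) show ?thesis
  proof eventually_elim
    case (elim x)
    then have "f x \<in> {-C..C}" by auto
    from bspec[OF elim(2) this] show ?case by simp
  qed
qed

text \<open>
  Integrating the previous comparison bounds the approximate energies of \<open>f\<^sup>2\<close> by \<open>4 C\<^sup>2 \<E>(f,f)\<close>. The
  mass lost by the resolvent enters both sides, and is compared through \<open>f\<^sup>4 \<le> 4 C\<^sup>2 f\<^sup>2\<close>.
\<close>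
lemma V_square:
  assumes f: "f \<in> V" "f \<in> Linf M"
  shows "(\<lambda>x. (f x)\<^sup>2) \<in> V"
proof -
  obtain C where C: "0 \<le> C" "AE x in M. \<bar>f x\<bar> \<le> C" using f(2) by (rule LinfE)
  define F where "F = (\<lambda>x. (f x)\<^sup>2)"
  define F2 where "F2 = (\<lambda>x. (F x)\<^sup>2)"
  have f2: "f \<in> L2 M" by (rule V_imp_L2[OF f(1)])
  have F: "F \<in> L2 M" "F \<in> Linf M" unfolding F_def by (rule L2_square[OF f2 f(2)])+
  have F2: "F2 \<in> L2 M" "F2 \<in> Linf M" unfolding F2_def by (rule L2_square[OF F])+
  have Fi: "integrable M F" unfolding F_def by (rule L2_integrable_sq[OF f2])
  have F2i: "integrable M F2" unfolding F2_def by (rule L2_integrable_sq[OF F(1)])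
  have "F \<in> V"
  proof (rule resolvent_bounded_form(1)[OF F(1)])
    fix n
    let ?l = "real (Suc n)" let ?R = "resolvent ?l"
    have l: "0 < ?l" by simp
    have RF: "integrable M (?R F)"
      by (rule resolvent_integral_le[OF l F Fi]) (simp add: F_def)
    have RF2: "integrable M (?R F2)"
      by (rule resolvent_integral_le[OF l F2 F2i]) (simp add: F2_def)
    have FRF: "integrable M (\<lambda>x. F x * ?R F x)" by (rule L2_mult_integrable[OF F(1) resolvent_L2[OF l F(1)]])
    have fRf: "integrable M (\<lambda>x. f x * ?R f x)" by (rule L2_mult_integrable[OF f2 resolvent_L2[OF l f2]])
    note [simp] = RF RF2 FRF fRf Fi F2i
    have "(\<integral>x. ?R F2 x - 2 * (F x * ?R F x) + F2 x \<partial>M) \<le> (\<integral>x. 4 * C\<^sup>2 * (?R F x - 2 * (f x * ?R f x) + F x) \<partial>M)"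
    proof (rule integral_mono_AE)
      show "AE x in M. ?R F2 x - 2 * (F x * ?R F x) + F2 x \<le> 4 * C\<^sup>2 * (?R F x - 2 * (f x * ?R f x) + F x)"
        using resolvent_variance_square_le[OF l f2 C] unfolding F2_def F_def by (simp only: mult.assoc)
    qed simp_all
    then have 1: "(\<integral>x. ?R F2 x \<partial>M) - 2 * (\<integral>x. F x * ?R F x \<partial>M) + (\<integral>x. F2 x \<partial>M)
        \<le> 4 * C\<^sup>2 * ((\<integral>x. ?R F x \<partial>M) - 2 * (\<integral>x. f x * ?R f x \<partial>M) + (\<integral>x. F x \<partial>M))"
      by simp
    \<comment> \<open>The lost mass of \<open>F\<^sup>2\<close> is at most \<open>4 C\<^sup>2\<close> times that of \<open>F\<close>.\<close>
    define G where "G = (\<lambda>x. 4 * C\<^sup>2 * F x + (-1) * F2 x)"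
    have G: "G \<in> L2 M" "G \<in> Linf M" unfolding G_def by (intro L2_add L2_scale Linf_add Linf_scale F F2)+
    have Gi: "integrable M G" unfolding G_def by simp
    have "AE x in M. 0 \<le> G x"
      using C(2)
    proof eventually_elim
      case (elim x)
      then have "F x \<le> C\<^sup>2" using C(1) by (auto simp: F_def abs_le_square_iff[symmetric])
      moreover have "0 \<le> F x" by (simp add: F_def)
      ultimately have "F x * F x \<le> C\<^sup>2 * F x" "0 \<le> C\<^sup>2 * F x" by (intro mult_right_mono mult_nonneg_nonneg; simp)+
      then show ?case by (simp add: G_def F2_def power2_eq_square)
    qed
    from resolvent_integral_le(2)[OF l G Gi this]
    have "(\<integral>x. ?R G x \<partial>M) \<le> (\<integral>x. G x \<partial>M)" .
    moreover have "(\<integral>x. ?R G x \<partial>M) = (\<integral>x. 4 * C\<^sup>2 * ?R F x + (-1) * ?R F2 x \<partial>M)"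
      using resolvent_lin[OF l F(1) F2(1), of "4 * C\<^sup>2" "-1"]
      by (intro integral_cong_AE L2_measurable L2_add L2_scale resolvent_L2[OF l] G F F2) (simp add: G_def)
    ultimately have 2: "4 * C\<^sup>2 * (\<integral>x. ?R F x \<partial>M) - (\<integral>x. ?R F2 x \<partial>M) \<le> 4 * C\<^sup>2 * (\<integral>x. F x \<partial>M) - (\<integral>x. F2 x \<partial>M)"
      by (simp add: G_def)
    have iF: "L2_inner M F (\<lambda>x. F x - ?R F x) = (\<integral>x. F2 x \<partial>M) - (\<integral>x. F x * ?R F x \<partial>M)"
      by (simp add: L2_inner_diff_right F resolvent_L2[OF l] F2_def power2_eq_square) (simp add: L2_inner_def)
    have ef: "L2_inner M f (\<lambda>x. f x - ?R f x) = (\<integral>x. F x \<partial>M) - (\<integral>x. f x * ?R f x \<partial>M)"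
      by (simp add: L2_inner_diff_right f2 resolvent_L2[OF l] F_def power2_eq_square) (simp add: L2_inner_def)
    have "2 * L2_inner M F (\<lambda>x. F x - ?R F x) \<le> 2 * (4 * C\<^sup>2 * L2_inner M f (\<lambda>x. f x - ?R f x))"
      using 1 2 unfolding iF ef by (simp add: algebra_simps)
    then have "?l * L2_inner M F (\<lambda>x. F x - ?R F x) \<le> ?l * (4 * C\<^sup>2 * L2_inner M f (\<lambda>x. f x - ?R f x))"
      by (intro mult_left_mono) auto
    also have "\<dots> = 4 * C\<^sup>2 * (?l * L2_inner M f (\<lambda>x. f x - ?R f x))" by simp
    also have "\<dots> \<le> 4 * C\<^sup>2 * \<E> f f"
    proof (rule mult_left_mono)
      have "0 \<le> ?l * (L2_norm M (\<lambda>x. f x - ?R f x))\<^sup>2" by simp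
      with resolvent_energy_le[OF l f(1)] show "?l * L2_inner M f (\<lambda>x. f x - ?R f x) \<le> \<E> f f" by linarith
    qed simp
    finally show "?l * L2_inner M F (\<lambda>x. F x - ?R F x) \<le> 4 * C\<^sup>2 * \<E> f f" .
  qed
  then show ?thesis by (simp add: F_def)
qed

lemma V_mult:
  assumes f: "f \<in> V" "f \<in> Linf M" and g: "g \<in> V" "g \<in> Linf M"
  shows "(\<lambda>x. f x * g x) \<in> V"
proof -
  have "(\<lambda>x. (1/2) * (((f x + g x)\<^sup>2 - (f x)\<^sup>2) - (g x)\<^sup>2)) \<in> V"
    by (intro V_scale V_diff V_square V_add Linf_add f g)
  also have "(\<lambda>x. (1/2) * (((f x + g x)\<^sup>2 - (f x)\<^sup>2) - (g x)\<^sup>2)) = (\<lambda>x. f x * g x)"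
    by (auto simp: power2_sum)
  finally show ?thesis .
qed

text \<open>
  Arbitrary bounded test functions are reached from the domain of the form by resolvents.
\<close>
lemma AE_nonneg_of_V_tests:
  assumes a: "integrable M a"
    and test: "\<And>\<psi>. \<psi> \<in> V \<Longrightarrow> \<psi> \<in> Linf M \<Longrightarrow> AE x in M. 0 \<le> \<psi> x \<Longrightarrow> 0 \<le> (\<integral>x. a x * \<psi> x \<partial>M)"
  shows "AE x in M. 0 \<le> a x"
proof (rule AE_nonneg_of_tests)
  show "integrable M a \<or> a \<in> L2 M" using a by simp
  fix \<psi> assume \<psi>: "\<psi> \<in> L2 M" and b: "\<And>x. 0 \<le> \<psi> x" "\<And>x. \<psi> x \<le> 1"
  let ?R = "\<lambda>n. resolvent (real (Suc n)) \<psi>"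
  have r: "AE x in M. 0 \<le> ?R n x \<and> ?R n x \<le> 1" for n
    by (rule resolvent_markov[OF _ \<psi>]) (use b in auto)
  have R2: "?R n \<in> L2 M" for n by (rule resolvent_L2[OF _ \<psi>]) simp
  have "(\<lambda>n. \<integral>x. a x * ?R n x \<partial>M) \<longlonglongrightarrow> (\<integral>x. a x * \<psi> x \<partial>M)"
  proof (rule L1_pairing_tendsto[OF a R2 \<psi>, where C=1])
    show "AE x in M. \<bar>?R n x - \<psi> x\<bar> \<le> 1" for n
      using r[of n]
    proof eventually_elim
      case (elim x)
      then show ?case using b[of x] by linarith
    qed
    show "AE x in M. \<bar>\<psi> x\<bar> \<le> 1" using b by simp
  qed (rule resolvent_tendsto_L2[OF \<psi>])
  moreover have "0 \<le> (\<integral>x. a x * ?R n x \<partial>M)" for n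
  proof (rule test)
    show "?R n \<in> V" by (rule resolvent_V[OF _ \<psi>]) simp
    show "AE x in M. 0 \<le> ?R n x" using r[of n] by eventually_elim simp
    have "AE x in M. \<bar>?R n x\<bar> \<le> 1" using r[of n] by eventually_elim simp
    then show "?R n \<in> Linf M" by (rule LinfI[OF L2_measurable[OF R2]])
  qed
  ultimately show "0 \<le> (\<integral>x. a x * \<psi> x \<partial>M)" by (intro LIMSEQ_le_const) auto
qed

section \<open>The Laplacian and the resolvent\<close>

lemma has_laplacianD:
  assumes "has_laplacian M V \<E> f h"
  shows "f \<in> V" "h \<in> L2 M" "\<And>g. g \<in> V \<Longrightarrow> \<E> f g = - L2_inner M h g"
  using assms by (auto simp: has_laplacian_def L2_inner_def)

lemma has_laplacianI:
  assumes "f \<in> V" "h \<in> L2 M" "\<And>g. g \<in> V \<Longrightarrow> \<E> f g = - L2_inner M h g"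
  shows "has_laplacian M V \<E> f h"
  using assms by (auto simp: has_laplacian_def L2_inner_def)

lemma has_laplacian_unique:
  assumes h: "has_laplacian M V \<E> f h" and k: "has_laplacian M V \<E> f k"
  shows "AE x in M. h x = k x"
proof -
  let ?d = "\<lambda>x. h x - k x"
  note h2 = has_laplacianD(2)[OF h] and k2 = has_laplacianD(2)[OF k]
  have d: "?d \<in> L2 M" by (rule L2_diff[OF h2 k2])
  have R: "resolvent (real (Suc n)) ?d \<in> V" for n by (rule resolvent_V[OF _ d]) simp
  have "L2_inner M (resolvent (real (Suc n)) ?d) ?d = 0" for n
    using has_laplacianD(3)[OF h R] has_laplacianD(3)[OF k R]
    by (simp add: L2_inner_diff_right h2 k2 V_imp_L2[OF R] L2_inner_commute[of M h] L2_inner_commute[of M k])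
  with L2_tendsto_inner[OF V_imp_L2[OF R] d d resolvent_tendsto_L2[OF d]]
  have "(\<lambda>n::nat. 0) \<longlonglongrightarrow> L2_inner M ?d ?d" unfolding L2_inner_def by simp
  then have "L2_inner M ?d ?d = 0" by (simp add: LIMSEQ_const_iff)
  then have "L2_norm M ?d = 0" by (simp add: L2_inner_self)
  from L2_norm_zero_AE[OF d this] show ?thesis by simp
qed

lemma has_laplacian_laplacian: "f \<in> dom_L2 M V \<E> \<Longrightarrow> has_laplacian M V \<E> f (laplacian M V \<E> f)"
  using someI_ex[of "has_laplacian M V \<E> f"] unfolding laplacian_def by (simp add: dom_L2_def)

lemma has_laplacian_dom: "has_laplacian M V \<E> f h \<Longrightarrow> f \<in> dom_L2 M V \<E>"
  by (auto simp: dom_L2_def)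

lemma laplacian_AE_eq: "has_laplacian M V \<E> f h \<Longrightarrow> AE x in M. laplacian M V \<E> f x = h x"
  by (rule has_laplacian_unique[OF has_laplacian_laplacian[OF has_laplacian_dom]])

lemma has_laplacian_resolvent:
  assumes l: "0 < l" and h: "h \<in> L2 M"
  shows "has_laplacian M V \<E> (resolvent l h) (\<lambda>x. l * (resolvent l h x - h x))"
proof (rule has_laplacianI)
  note R = resolvent_L2[OF l h]
  show "(\<lambda>x. l * (resolvent l h x - h x)) \<in> L2 M" by (intro L2_scale L2_diff R h)
  fix g assume g: "g \<in> V"
  show "\<E> (resolvent l h) g = - L2_inner M (\<lambda>x. l * (resolvent l h x - h x)) g"
    unfolding E_resolvent[OF l h g]
    by (simp add: L2_inner_bilinear R h V_imp_L2[OF g]) (simp add: algebra_simps)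
qed (rule resolvent_V[OF l h])

text \<open>
  Both \<open>R f\<close> and \<open>f + (1 / l) R (\<Delta>f)\<close> solve the resolvent equation with datum \<open>f\<close>.
\<close>
lemma has_laplacian_resolvent_commute:
  assumes l: "0 < l" and f: "has_laplacian M V \<E> f h"
  shows "has_laplacian M V \<E> (resolvent l f) (resolvent l h)"
proof -
  note fV = has_laplacianD(1)[OF f] and h = has_laplacianD(2)[OF f]
  note f2 = V_imp_L2[OF fV]
  have eq: "AE x in M. f x + 1 / l * resolvent l h x = resolvent l f x"
  proof (rule resolvent_unique[OF l f2])
    show "(\<lambda>x. f x + 1 / l * resolvent l h x) \<in> V" by (intro V_add V_scale fV resolvent_V l h)
    fix v assume v: "v \<in> V"
    have "\<E> (\<lambda>x. f x + 1 / l * resolvent l h x) v + l * L2_inner M (\<lambda>x. f x + 1 / l * resolvent l h x) v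
      = \<E> f v + l * L2_inner M f v + 1 / l * (\<E> (resolvent l h) v + l * L2_inner M (resolvent l h) v)"
      by (simp only: E_add E_scale L2_inner_add_left L2_inner_scale_left V_scale V_imp_L2 fV f2 h v resolvent_V[OF l h] L2_scale
        algebra_simps)
    also have "\<dots> = l * L2_inner M f v"
      using l unfolding resolvent_eq[OF l h v] has_laplacianD(3)[OF f v] by simp
    finally show "\<E> (\<lambda>x. f x + 1 / l * resolvent l h x) v + l * L2_inner M (\<lambda>x. f x + 1 / l * resolvent l h x) v
      = l * L2_inner M f v" .
  qed
  show ?thesis
  proof (rule has_laplacianI)
    fix g assume g: "g \<in> V"
    have "L2_inner M (resolvent l h) g = L2_inner M (\<lambda>x. l * (resolvent l f x - f x)) g"
      unfolding L2_inner_def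
    proof (rule integral_cong_AE)
      show "AE x in M. resolvent l h x * g x = l * (resolvent l f x - f x) * g x"
        using eq
      proof eventually_elim
        case (elim x)
        have "resolvent l h x = l * (resolvent l f x - f x)" unfolding elim[symmetric] using l by simp
        then show ?case by simp
      qed
    qed (intro borel_measurable_times L2_measurable resolvent_L2[OF l] L2_scale L2_diff f2 h V_imp_L2[OF g])+
    then show "\<E> (resolvent l f) g = - L2_inner M (resolvent l h) g"
      using has_laplacianD(3)[OF has_laplacian_resolvent[OF l f2] g] by simp
  qed (intro resolvent_V resolvent_L2 l f2 h)+
qed

lemma resolvent_dom_Linf:
  assumes l: "0 < l" and h: "h \<in> L2 M" "h \<in> Linf M"
  shows "resolvent l h \<in> dom_Linf M V \<E>"
    and "AE x in M. laplacian M V \<E> (resolvent l h) x = l * (resolvent l h x - h x)"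
proof -
  note L = has_laplacian_resolvent[OF l h(1)]
  show ae: "AE x in M. laplacian M V \<E> (resolvent l h) x = l * (resolvent l h x - h x)"
    by (rule laplacian_AE_eq[OF L])
  have "(\<lambda>x. l * (resolvent l h x + (-1) * h x)) \<in> Linf M"
    by (intro Linf_scale Linf_add resolvent_Linf l h)
  then obtain C where "AE x in M. \<bar>l * (resolvent l h x + (-1) * h x)\<bar> \<le> C" by (rule LinfE)
  with ae have "AE x in M. \<bar>laplacian M V \<E> (resolvent l h) x\<bar> \<le> C" by eventually_elim simp
  then have "laplacian M V \<E> (resolvent l h) \<in> Linf M"
    by (rule LinfI[OF L2_measurable[OF has_laplacianD(2)[OF has_laplacian_laplacian[OF has_laplacian_dom[OF L]]]]])
  then show "resolvent l h \<in> dom_Linf M V \<E>"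
    using has_laplacian_dom[OF L] resolvent_Linf[OF l h] by (simp add: dom_Linf_def)
qed

lemma resolvent_mono:
  assumes l: "0 < l" and f: "f \<in> L2 M" "f \<in> Linf M" and g: "g \<in> L2 M" "g \<in> Linf M"
    and le: "AE x in M. f x \<le> g x"
  shows "AE x in M. resolvent l f x \<le> resolvent l g x"
proof -
  have "AE x in M. - 0 \<le> resolvent l (\<lambda>x. 1 * g x + (-1) * f x) x"
  proof (rule resolvent_lower[OF l])
    show "AE x in M. - 0 \<le> 1 * g x + (-1) * f x" using le by eventually_elim simp
  qed (intro L2_add L2_scale Linf_add Linf_scale f g order_refl)+
  with resolvent_lin[OF l g(1) f(1), of 1 "-1"] show ?thesis by eventually_elim simp
qed

text \<open>
  Resolvents of bounded functions converge weakly against integrable functions; this carries the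
  limit \<open>l \<rightarrow> \<infinity>\<close> in the gradient estimate, where \<open>\<Gamma>(f)\<close> is not yet known to be better than integrable.
\<close>
lemma resolvent_weak_tendsto:
  assumes a: "integrable M a" and u: "u \<in> L2 M" "u \<in> Linf M"
  shows "(\<lambda>n. \<integral>x. a x * resolvent (real (Suc n)) u x \<partial>M) \<longlonglongrightarrow> (\<integral>x. a x * u x \<partial>M)"
proof -
  obtain C where C: "0 \<le> C" "AE x in M. \<bar>u x\<bar> \<le> C" using u(2) by (rule LinfE)
  have C2: "AE x in M. \<bar>u x\<bar> \<le> 2 * C" using C(2) by eventually_elim (use C(1) in linarith)
  have R2: "resolvent (real (Suc n)) u \<in> L2 M" for n by (rule resolvent_L2[OF _ u(1)]) simp
  have D: "AE x in M. \<bar>resolvent (real (Suc n)) u x - u x\<bar> \<le> 2 * C" for n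
    using resolvent_abs_le[OF _ u(1) C, of "real (Suc n)", simplified] C(2) by eventually_elim linarith
  show ?thesis
    by (rule L1_pairing_tendsto[OF a R2 u(1) D C2 resolvent_tendsto_L2[OF u(1)]])
qed

text \<open>
  One application of the resolvent makes \<open>f\<close> admissible in both arguments of the Bakry-Emery inequality,
  because \<open>\<Delta>(R f) = l (R f - f)\<close> is bounded and lies in the domain of the form together with \<open>f\<close>.
\<close>
lemma resolvent_regular:
  assumes l: "0 < l" and f: "f \<in> dom_L2 M V \<E>" "f \<in> Linf M"
  shows "resolvent l f \<in> dom_V M V \<E>" "resolvent l f \<in> dom_Linf M V \<E>"
    and "AE x in M. laplacian M V \<E> (resolvent l f) x = resolvent l (laplacian M V \<E> f) x"
proof -
  note lap = has_laplacian_laplacian[OF f(1)]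
  note fV = has_laplacianD(1)[OF lap]
  note f2 = V_imp_L2[OF fV]
  show "AE x in M. laplacian M V \<E> (resolvent l f) x = resolvent l (laplacian M V \<E> f) x"
    by (rule laplacian_AE_eq[OF has_laplacian_resolvent_commute[OF l lap]])
  show "resolvent l f \<in> dom_Linf M V \<E>" by (rule resolvent_dom_Linf(1)[OF l f2 f(2)])
  then have dom: "resolvent l f \<in> dom_L2 M V \<E>" by (simp add: dom_Linf_def)
  have "(\<lambda>x. l * (resolvent l f x - f x)) \<in> V" by (intro V_scale V_diff resolvent_V l f2 fV)
  moreover have "AE x in M. l * (resolvent l f x - f x) = laplacian M V \<E> (resolvent l f) x"
    using resolvent_dom_Linf(2)[OF l f2 f(2)] by eventually_elim simp
  ultimately have "laplacian M V \<E> (resolvent l f) \<in> V"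
    using V_cong L2_measurable[OF has_laplacianD(2)[OF has_laplacian_laplacian[OF dom]]] by blast
  then show "resolvent l f \<in> dom_V M V \<E>" using dom by (simp add: dom_V_def)
qed

end

section \<open>The carre du champ\<close>

context local_dirichlet_form
begin

lemma Gamma_add_right:
  assumes "f \<in> V" "f' \<in> V" "g \<in> V"
  shows "AE x in M. \<Gamma> g (\<lambda>y. f y + f' y) x = \<Gamma> g f x + \<Gamma> g f' x"
  using Gamma_add[OF assms] Gamma_sym[OF assms(3) V_add[OF assms(1,2)]] Gamma_sym[OF assms(3,1)] Gamma_sym[OF assms(3,2)]
  by eventually_elim simp

lemma Gamma_scale_right:
  assumes "f \<in> V" "g \<in> V"
  shows "AE x in M. \<Gamma> g (\<lambda>y. c * f y) x = c * \<Gamma> g f x"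
  using Gamma_scale[OF assms, of c] Gamma_sym[OF assms(2) V_scale[OF assms(1)], of c] Gamma_sym[OF assms(2,1)]
  by eventually_elim simp

lemma Gamma_quadratic:
  assumes f: "f \<in> V" and g: "g \<in> V"
  shows "AE x in M. \<Gamma> (\<lambda>y. f y + t * g y) (\<lambda>y. f y + t * g y) x = \<Gamma> f f x + 2 * t * \<Gamma> f g x + t\<^sup>2 * \<Gamma> g g x"
proof -
  have tg: "(\<lambda>y. t * g y) \<in> V" by (rule V_scale[OF g])
  have s: "(\<lambda>y. f y + t * g y) \<in> V" by (rule V_add[OF f tg])
  show ?thesis
    using Gamma_add[OF f tg s] Gamma_add_right[OF f tg f] Gamma_scale_right[OF g f, of t]
      Gamma_scale[OF g s, of t] Gamma_add_right[OF f tg g] Gamma_scale_right[OF g g, of t] Gamma_sym[OF g f]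
    by eventually_elim (simp add: power2_eq_square algebra_simps)
qed

lemma Gamma_mult_integrable: "f \<in> V \<Longrightarrow> g \<in> V \<Longrightarrow> \<phi> \<in> Linf M \<Longrightarrow> integrable M (\<lambda>x. \<Gamma> f g x * \<phi> x)"
  by (intro integrable_mult_Linf Gamma_integrable)

lemma Gamma_polarized:
  assumes f: "f \<in> V" "f \<in> Linf M" and g: "g \<in> V" "g \<in> Linf M" and \<phi>: "\<phi> \<in> V" "\<phi> \<in> Linf M"
  shows "2 * (\<integral>x. \<Gamma> f g x * \<phi> x \<partial>M)
    = \<E> f (\<lambda>x. g x * \<phi> x) + \<E> g (\<lambda>x. f x * \<phi> x) - \<E> (\<lambda>x. f x * g x) \<phi>"
proof -
  let ?s = "\<lambda>x. f x + 1 * g x"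
  have s: "?s \<in> V" "?s \<in> Linf M" by (intro V_add V_scale Linf_add Linf_scale f g)+
  note prods = V_mult[OF f g] V_mult[OF f \<phi>] V_mult[OF g \<phi>] V_square[OF f] V_square[OF g]
  have "(\<integral>x. \<Gamma> ?s ?s x * \<phi> x \<partial>M) = (\<integral>x. \<Gamma> f f x * \<phi> x + 2 * (\<Gamma> f g x * \<phi> x) + \<Gamma> g g x * \<phi> x \<partial>M)"
  proof (rule integral_cong_AE)
    show "AE x in M. \<Gamma> ?s ?s x * \<phi> x = \<Gamma> f f x * \<phi> x + 2 * (\<Gamma> f g x * \<phi> x) + \<Gamma> g g x * \<phi> x"
      using Gamma_quadratic[OF f(1) g(1), of 1] by eventually_elim (simp add: algebra_simps)
  qed (intro borel_measurable_integrable Bochner_Integration.integrable_add integrable_mult_right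
      Gamma_mult_integrable s f g \<phi>)+
  also have "\<dots> = (\<integral>x. \<Gamma> f f x * \<phi> x \<partial>M) + 2 * (\<integral>x. \<Gamma> f g x * \<phi> x \<partial>M) + (\<integral>x. \<Gamma> g g x * \<phi> x \<partial>M)"
    using Gamma_mult_integrable f g \<phi> by simp
  finally have "2 * (\<integral>x. \<Gamma> f g x * \<phi> x \<partial>M) = (\<integral>x. \<Gamma> ?s ?s x * \<phi> x \<partial>M)
      - (\<integral>x. \<Gamma> f f x * \<phi> x \<partial>M) - (\<integral>x. \<Gamma> g g x * \<phi> x \<partial>M)" by simp
  also have "\<dots> = (\<E> ?s (\<lambda>x. ?s x * \<phi> x) - 1/2 * \<E> (\<lambda>x. (?s x)\<^sup>2) \<phi>)
      - (\<E> f (\<lambda>x. f x * \<phi> x) - 1/2 * \<E> (\<lambda>x. (f x)\<^sup>2) \<phi>) - (\<E> g (\<lambda>x. g x * \<phi> x) - 1/2 * \<E> (\<lambda>x. (g x)\<^sup>2) \<phi>)"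
    by (intro arg_cong2[where f="(-)"] Gamma_E_mult IntI s f g \<phi>)
  also have "(\<lambda>x. ?s x * \<phi> x) = (\<lambda>x. f x * \<phi> x + g x * \<phi> x)" by (auto simp: algebra_simps)
  also have "(\<lambda>x. (?s x)\<^sup>2) = (\<lambda>x. ((f x)\<^sup>2 + 2 * (f x * g x)) + (g x)\<^sup>2)" by (auto simp: power2_sum)
  also have "\<E> ?s (\<lambda>x. f x * \<phi> x + g x * \<phi> x) = \<E> f (\<lambda>x. f x * \<phi> x) + \<E> f (\<lambda>x. g x * \<phi> x)
      + \<E> g (\<lambda>x. f x * \<phi> x) + \<E> g (\<lambda>x. g x * \<phi> x)"
    using f g prods by (simp add: E_bilinear V_add)
  also have "\<E> (\<lambda>x. ((f x)\<^sup>2 + 2 * (f x * g x)) + (g x)\<^sup>2) \<phi> = \<E> (\<lambda>x. (f x)\<^sup>2) \<phi>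
      + 2 * \<E> (\<lambda>x. f x * g x) \<phi> + \<E> (\<lambda>x. (g x)\<^sup>2) \<phi>"
    using \<phi> prods by (simp add: E_bilinear V_add V_scale)
  finally show ?thesis by (simp add: field_simps)
qed

text \<open>
  Add the polarised identities for \<open>\<Gamma>(f,g)\<close> tested with \<open>\<phi>\<close> and for \<open>\<Gamma>(f,\<phi>)\<close> tested with \<open>g\<close>: the terms that are
  not \<open>\<E>(f, g \<phi>)\<close> cancel by the symmetry of the form.
\<close>
lemma E_Leibniz:
  assumes f: "f \<in> V" "f \<in> Linf M" and g: "g \<in> V" "g \<in> Linf M" and \<phi>: "\<phi> \<in> V" "\<phi> \<in> Linf M"
  shows "\<E> f (\<lambda>x. g x * \<phi> x) = (\<integral>x. \<Gamma> f g x * \<phi> x \<partial>M) + (\<integral>x. \<Gamma> f \<phi> x * g x \<partial>M)"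
proof -
  have c: "(\<lambda>x. \<phi> x * g x) = (\<lambda>x. g x * \<phi> x)" "(\<lambda>x. \<phi> x * f x) = (\<lambda>x. f x * \<phi> x)"
    "(\<lambda>x. g x * f x) = (\<lambda>x. f x * g x)"
    by (auto simp: mult.commute)
  show ?thesis
    using Gamma_polarized[OF f g \<phi>] Gamma_polarized[OF f \<phi> g] E_sym[OF g(1) V_mult[OF f \<phi>]]
      E_sym[OF \<phi>(1) V_mult[OF f g]]
    unfolding c by linarith
qed

text \<open>
  The carre du champ is the limit of the rescaled variances of the resolvent, and inherits
  their inequalities.
\<close>
lemma Gamma_resolvent_tendsto:
  assumes f: "f \<in> V" "f \<in> Linf M" and \<psi>: "\<psi> \<in> V" "\<psi> \<in> Linf M"
  shows "(\<lambda>n. real (Suc n) / 2 * (\<integral>x. (resolvent (real (Suc n)) (\<lambda>x. (f x)\<^sup>2) x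
      - 2 * f x * resolvent (real (Suc n)) f x + (f x)\<^sup>2) * \<psi> x \<partial>M)) \<longlonglongrightarrow> (\<integral>x. \<Gamma> f f x * \<psi> x \<partial>M)"
proof -
  define F where "F = (\<lambda>x. (f x)\<^sup>2)"
  have F: "F \<in> V" unfolding F_def by (rule V_square[OF f])
  note f2 = V_imp_L2[OF f(1)] and F2 = V_imp_L2[OF F] and \<psi>2 = V_imp_L2[OF \<psi>(1)]
  have f\<psi>: "(\<lambda>x. f x * \<psi> x) \<in> V" by (rule V_mult[OF f \<psi>])
  have RV: "resolvent (real (Suc n)) h \<in> V" if "h \<in> L2 M" for n h by (rule resolvent_V[OF _ that]) simp
  have "(\<lambda>n. \<E> (resolvent (real (Suc n)) f) (\<lambda>x. f x * \<psi> x) - 1/2 * \<E> (resolvent (real (Suc n)) F) \<psi>)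
      \<longlonglongrightarrow> \<E> f (\<lambda>x. f x * \<psi> x) - 1/2 * \<E> F \<psi>"
    by (intro tendsto_intros E_tendsto[OF RV[OF f2] f(1) f\<psi> resolvent_tendsto_V[OF f(1)]]
      E_tendsto[OF RV[OF F2] F \<psi>(1) resolvent_tendsto_V[OF F]])
  also have "\<E> f (\<lambda>x. f x * \<psi> x) - 1/2 * \<E> F \<psi> = (\<integral>x. \<Gamma> f f x * \<psi> x \<partial>M)"
    unfolding F_def by (rule Gamma_E_mult[symmetric]) (use f \<psi> in auto)
  also have "(\<lambda>n. \<E> (resolvent (real (Suc n)) f) (\<lambda>x. f x * \<psi> x) - 1/2 * \<E> (resolvent (real (Suc n)) F) \<psi>)
    = (\<lambda>n. real (Suc n) / 2 * (\<integral>x. (resolvent (real (Suc n)) F x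
      - 2 * f x * resolvent (real (Suc n)) f x + F x) * \<psi> x \<partial>M))"
  proof
    fix n
    let ?l = "real (Suc n)" let ?R = "resolvent ?l"
    have l: "0 < ?l" by simp
    have i1: "integrable M (\<lambda>x. (f x - ?R f x) * (f x * \<psi> x))"
      by (intro L2_mult_integrable L2_diff f2 resolvent_L2[OF l] V_imp_L2[OF f\<psi>])
    have i2: "integrable M (\<lambda>x. (F x - ?R F x) * \<psi> x)"
      by (intro L2_mult_integrable L2_diff F2 resolvent_L2[OF l] \<psi>2)
    have "\<E> (?R f) (\<lambda>x. f x * \<psi> x) - 1/2 * \<E> (?R F) \<psi>
      = ?l * ((\<integral>x. (f x - ?R f x) * (f x * \<psi> x) \<partial>M) - 1/2 * (\<integral>x. (F x - ?R F x) * \<psi> x \<partial>M))"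
      unfolding E_resolvent[OF l f2 f\<psi>] E_resolvent[OF l F2 \<psi>(1)] L2_inner_def by (simp add: algebra_simps)
    also have "(\<integral>x. (f x - ?R f x) * (f x * \<psi> x) \<partial>M) - 1/2 * (\<integral>x. (F x - ?R F x) * \<psi> x \<partial>M)
      = (\<integral>x. (f x - ?R f x) * (f x * \<psi> x) - 1/2 * ((F x - ?R F x) * \<psi> x) \<partial>M)"
      using i1 i2 by simp
    also have "\<dots> = (\<integral>x. 1/2 * ((?R F x - 2 * f x * ?R f x + F x) * \<psi> x) \<partial>M)"
      by (intro Bochner_Integration.integral_cong) (auto simp: F_def power2_eq_square algebra_simps)
    finally show "\<E> (?R f) (\<lambda>x. f x * \<psi> x) - 1/2 * \<E> (?R F) \<psi>
      = ?l / 2 * (\<integral>x. (?R F x - 2 * f x * ?R f x + F x) * \<psi> x \<partial>M)" by simp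
  qed
  finally show ?thesis unfolding F_def .
qed

lemma Gamma_nonneg:
  assumes f: "f \<in> V" "f \<in> Linf M"
  shows "AE x in M. 0 \<le> \<Gamma> f f x"
proof (rule AE_nonneg_of_V_tests[OF Gamma_integrable[OF f(1) f(1)]])
  fix \<psi> assume \<psi>: "\<psi> \<in> V" "\<psi> \<in> Linf M" "AE x in M. 0 \<le> \<psi> x"
  show "0 \<le> (\<integral>x. \<Gamma> f f x * \<psi> x \<partial>M)"
  proof (rule LIMSEQ_le_const[OF Gamma_resolvent_tendsto[OF f \<psi>(1,2)]], intro exI allI impI)
    fix n
    have "AE x in M. 0 \<le> (resolvent (real (Suc n)) (\<lambda>x. (f x)\<^sup>2) x
      - 2 * f x * resolvent (real (Suc n)) f x + (f x)\<^sup>2) * \<psi> x"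
      using resolvent_variance_nonneg[OF _ V_imp_L2[OF f(1)] f(2), of "real (Suc n)", simplified] \<psi>(3)
      by eventually_elim simp
    then show "0 \<le> real (Suc n) / 2 * (\<integral>x. (resolvent (real (Suc n)) (\<lambda>x. (f x)\<^sup>2) x
      - 2 * f x * resolvent (real (Suc n)) f x + (f x)\<^sup>2) * \<psi> x \<partial>M)"
      by (intro mult_nonneg_nonneg integral_nonneg_AE) auto
  qed
qed

lemma Gamma_square_le:
  assumes f: "f \<in> V" and C: "0 \<le> C" "AE x in M. \<bar>f x\<bar> \<le> C"
  shows "AE x in M. \<Gamma> (\<lambda>x. (f x)\<^sup>2) (\<lambda>x. (f x)\<^sup>2) x \<le> 4 * C\<^sup>2 * \<Gamma> f f x"
proof -
  define F where "F = (\<lambda>x. (f x)\<^sup>2)"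
  have f2: "f \<in> L2 M" by (rule V_imp_L2[OF f])
  have fi: "f \<in> Linf M" by (rule LinfI[OF L2_measurable[OF f2] C(2)])
  have F: "F \<in> V" "F \<in> Linf M" unfolding F_def by (rule V_square[OF f fi], rule L2_square[OF f2 fi])
  note F2 = L2_square[OF V_imp_L2[OF F(1)] F(2)]
  note ff = Gamma_integrable[OF f f] and FF = Gamma_integrable[OF F(1) F(1)]
  have "AE x in M. 0 \<le> 4 * C\<^sup>2 * \<Gamma> f f x - \<Gamma> F F x"
  proof (rule AE_nonneg_of_V_tests)
    show "integrable M (\<lambda>x. 4 * C\<^sup>2 * \<Gamma> f f x - \<Gamma> F F x)" using ff FF by simp
    fix \<psi> assume \<psi>: "\<psi> \<in> V" "\<psi> \<in> Linf M" "AE x in M. 0 \<le> \<psi> x"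
    have "(\<integral>x. \<Gamma> F F x * \<psi> x \<partial>M) \<le> 4 * C\<^sup>2 * (\<integral>x. \<Gamma> f f x * \<psi> x \<partial>M)"
    proof (rule LIMSEQ_le[OF Gamma_resolvent_tendsto[OF F \<psi>(1,2)]
          tendsto_mult_left[OF Gamma_resolvent_tendsto[OF f fi \<psi>(1,2)]]], intro exI allI impI)
      fix n
      let ?l = "real (Suc n)" let ?R = "resolvent ?l"
      have l: "0 < ?l" by simp
      let ?a = "\<lambda>x. ?R (\<lambda>x. (F x)\<^sup>2) x - 2 * F x * ?R F x + (F x)\<^sup>2"
      let ?b = "\<lambda>x. ?R (\<lambda>x. (f x)\<^sup>2) x - 2 * f x * ?R f x + (f x)\<^sup>2"
      have int: "integrable M (\<lambda>x. (?R (\<lambda>x. (h x)\<^sup>2) x - 2 * h x * ?R h x + (h x)\<^sup>2) * \<psi> x)"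
        if h: "h \<in> L2 M" "h \<in> Linf M" for h
      proof -
        note \<psi>2 = V_imp_L2[OF \<psi>(1)] and sq = L2_square(1)[OF h]
        have 1: "integrable M (\<lambda>x. ?R (\<lambda>x. (h x)\<^sup>2) x * \<psi> x)"
          by (rule L2_mult_integrable[OF resolvent_L2[OF l sq] \<psi>2])
        have 2: "integrable M (\<lambda>x. 2 * h x * ?R h x * \<psi> x)"
          by (rule integrable_mult_Linf[OF L2_mult_integrable[OF L2_scale[OF h(1)] resolvent_L2[OF l h(1)]] \<psi>(2)])
        have 3: "integrable M (\<lambda>x. (h x)\<^sup>2 * \<psi> x)" by (rule L2_mult_integrable[OF sq \<psi>2])
        show ?thesis
          using Bochner_Integration.integrable_add[OF Bochner_Integration.integrable_diff[OF 1 2] 3]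
          by (simp only: distrib_right left_diff_distrib)
      qed
      have ia: "integrable M (\<lambda>x. ?a x * \<psi> x)" and ib: "integrable M (\<lambda>x. ?b x * \<psi> x)"
        by (rule int[OF V_imp_L2[OF F(1)] F(2)], rule int[OF f2 fi])
      have "(\<integral>x. ?a x * \<psi> x \<partial>M) \<le> (\<integral>x. 4 * C\<^sup>2 * (?b x * \<psi> x) \<partial>M)"
      proof (rule integral_mono_AE[OF ia])
        show "integrable M (\<lambda>x. 4 * C\<^sup>2 * (?b x * \<psi> x))" using ib by simp
        show "AE x in M. ?a x * \<psi> x \<le> 4 * C\<^sup>2 * (?b x * \<psi> x)"
          using resolvent_variance_square_le[OF l f2 C] \<psi>(3)
        proof eventually_elim
          case (elim x)
          from mult_right_mono[OF elim] show ?case by (simp add: F_def mult.assoc)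
        qed
      qed
      then have "(\<integral>x. ?a x * \<psi> x \<partial>M) \<le> 4 * C\<^sup>2 * (\<integral>x. ?b x * \<psi> x \<partial>M)" by simp
      from mult_left_mono[OF this, of "?l / 2"]
      show "?l / 2 * (\<integral>x. ?a x * \<psi> x \<partial>M) \<le> 4 * C\<^sup>2 * (?l / 2 * (\<integral>x. ?b x * \<psi> x \<partial>M))"
        by (simp add: ac_simps)
    qed
    moreover have "4 * C\<^sup>2 * (\<integral>x. \<Gamma> f f x * \<psi> x \<partial>M) - (\<integral>x. \<Gamma> F F x * \<psi> x \<partial>M)
        = (\<integral>x. (4 * C\<^sup>2 * \<Gamma> f f x - \<Gamma> F F x) * \<psi> x \<partial>M)"
      using Gamma_mult_integrable[OF f f \<psi>(2)] Gamma_mult_integrable[OF F(1) F(1) \<psi>(2)]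
      by (simp add: left_diff_distrib mult.assoc)
    ultimately show "0 \<le> (\<integral>x. (4 * C\<^sup>2 * \<Gamma> f f x - \<Gamma> F F x) * \<psi> x \<partial>M)" by simp
  qed
  then show ?thesis unfolding F_def by eventually_elim simp
qed

lemma Gamma_Cauchy_Schwarz:
  assumes f: "f \<in> V" "f \<in> Linf M" and g: "g \<in> V" "g \<in> Linf M"
  shows "AE x in M. (\<Gamma> f g x)\<^sup>2 \<le> \<Gamma> f f x * \<Gamma> g g x"
proof -
  have "AE x in M. \<forall>t\<in>UNIV. 0 \<le> \<Gamma> f f x + 2 * t * \<Gamma> f g x + t\<^sup>2 * \<Gamma> g g x"
  proof (rule AE_all_of_continuous)
    fix t :: real
    have s: "(\<lambda>y. f y + t * g y) \<in> V" "(\<lambda>y. f y + t * g y) \<in> Linf M"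
      by (intro V_add V_scale Linf_add Linf_scale f g)+
    show "AE x in M. 0 \<le> \<Gamma> f f x + 2 * t * \<Gamma> f g x + t\<^sup>2 * \<Gamma> g g x"
      using Gamma_nonneg[OF s] Gamma_quadratic[OF f(1) g(1), of t] by eventually_elim simp
  qed (intro continuous_intros)
  then show ?thesis using Gamma_nonneg[OF g]
    by eventually_elim (rule quadratic_nonneg_imp, auto)
qed

section \<open>The gradient estimate\<close>

text \<open>
  The identity \<open>\<Delta>(f\<^sup>2) = 2 f \<Delta>f + 2 \<Gamma>(f)\<close> holds weakly. Applying \<open>R\<close> to it and truncating \<open>\<Gamma>(f) \<ge> 0\<close>, which is only
  integrable, to a square integrable function leaves an inequality between functions in \<open>L\<^sup>2\<close>.
\<close>
lemma square_subsolution: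
  assumes f: "f \<in> V" "f \<in> Linf M" and D: "has_laplacian M V \<E> f D" "D \<in> Linf M"
    and l: "0 < l" and k: "0 \<le> k"
  defines "p \<equiv> \<lambda>x. f x * D x + cutoff k (\<Gamma> f f) x"
  shows "p \<in> L2 M" "p \<in> Linf M"
    and "AE x in M. 2 * resolvent l p x \<le> l * (resolvent l (\<lambda>x. (f x)\<^sup>2) x - (f x)\<^sup>2)"
proof -
  define F where "F = (\<lambda>x. (f x)\<^sup>2)"
  define G where "G = \<Gamma> f f"
  have F: "F \<in> V" "F \<in> Linf M" unfolding F_def by (rule V_square[OF f], rule L2_square[OF V_imp_L2[OF f(1)] f(2)])
  have G: "integrable M G" unfolding G_def by (rule Gamma_integrable[OF f(1) f(1)])
  note f2 = V_imp_L2[OF f(1)] and D2 = has_laplacianD(2)[OF D(1)] and F2 = V_imp_L2[OF F(1)]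
  have g2: "cutoff k G \<in> L2 M" by (rule cutoff_L2_of_integrable[OF G k])
  have gi: "cutoff k G \<in> Linf M" by (rule LinfI[OF L2_measurable[OF g2], of k]) (intro AE_I2 cutoff_le k)
  have fD: "(\<lambda>x. f x * D x) \<in> L2 M"
    using f(2) by (rule LinfE) (rule L2_mult_bounded[OF D2 L2_measurable[OF f2]])
  show p2: "p \<in> L2 M" unfolding p_def by (intro L2_add fD g2[unfolded G_def])
  show pi: "p \<in> Linf M" unfolding p_def by (intro Linf_add Linf_mult f D gi[unfolded G_def])
  have RF: "resolvent l F \<in> L2 M" and Rp: "resolvent l p \<in> L2 M" by (intro resolvent_L2 l F2 p2)+
  have "AE x in M. 0 \<le> l * (resolvent l F x - F x) - 2 * resolvent l p x"
  proof (rule AE_nonneg_of_tests)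
    show "integrable M (\<lambda>x. l * (resolvent l F x - F x) - 2 * resolvent l p x)
      \<or> (\<lambda>x. l * (resolvent l F x - F x) - 2 * resolvent l p x) \<in> L2 M"
      by (intro disjI2 L2_diff L2_scale RF Rp F2)
    fix \<psi> assume \<psi>: "\<psi> \<in> L2 M" and b: "\<And>x. 0 \<le> \<psi> x" "\<And>x. \<psi> x \<le> 1"
    define r where "r = resolvent l \<psi>"
    have rV: "r \<in> V" unfolding r_def by (rule resolvent_V[OF l \<psi>])
    have r01: "AE x in M. 0 \<le> r x \<and> r x \<le> 1"
      unfolding r_def by (rule resolvent_markov[OF l \<psi>]) (use b in auto)
    then have "AE x in M. \<bar>r x\<bar> \<le> 1" by eventually_elim auto
    then have ri: "r \<in> Linf M" by (rule LinfI[OF L2_measurable[OF V_imp_L2[OF rV]]])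
    have Gr: "integrable M (\<lambda>x. G x * r x)" by (rule integrable_mult_Linf[OF G ri])
    have gr: "integrable M (\<lambda>x. cutoff k G x * r x)" by (rule L2_mult_integrable[OF g2 V_imp_L2[OF rV]])
    have fDr: "integrable M (\<lambda>x. f x * D x * r x)" by (rule L2_mult_integrable[OF fD V_imp_L2[OF rV]])
    have "l * (L2_inner M (resolvent l F) \<psi> - L2_inner M F \<psi>) = - \<E> F r"
      using E_resolvent[OF l \<psi> F(1)] resolvent_sym[OF l F2 \<psi>] E_sym[OF F(1) rV]
      by (simp add: r_def L2_inner_diff_left L2_inner_diff_right \<psi> resolvent_L2[OF l \<psi>] F2 L2_inner_commute[of M _ F] algebra_simps)
    also have "\<dots> = 2 * ((\<integral>x. f x * D x * r x \<partial>M) + (\<integral>x. G x * r x \<partial>M))"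
      using Gamma_E_mult[of f r] has_laplacianD(3)[OF D(1) V_mult[OF f rV ri]] f rV ri
      by (simp add: G_def F_def L2_inner_def mult.assoc mult.left_commute)
    also have "\<dots> \<ge> 2 * ((\<integral>x. f x * D x * r x \<partial>M) + (\<integral>x. cutoff k G x * r x \<partial>M))"
    proof -
      have "AE x in M. cutoff k G x * r x \<le> G x * r x"
        using Gamma_nonneg[OF f] r01
        by eventually_elim (auto simp: G_def cutoff_def intro!: mult_right_mono)
      then have "(\<integral>x. cutoff k G x * r x \<partial>M) \<le> (\<integral>x. G x * r x \<partial>M)"
        by (rule integral_mono_AE[OF gr Gr])
      then show ?thesis by simp
    qed
    also have "(\<integral>x. f x * D x * r x \<partial>M) + (\<integral>x. cutoff k G x * r x \<partial>M) = L2_inner M p r"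
      using fDr gr by (simp add: p_def G_def L2_inner_def distrib_right)
    also have "\<dots> = L2_inner M (resolvent l p) \<psi>"
      unfolding r_def by (rule resolvent_sym[OF l p2 \<psi>, symmetric])
    finally have "0 \<le> l * (L2_inner M (resolvent l F) \<psi> - L2_inner M F \<psi>) - 2 * L2_inner M (resolvent l p) \<psi>"
      by simp
    also have "\<dots> = L2_inner M (\<lambda>x. l * (resolvent l F x - F x) - 2 * resolvent l p x) \<psi>"
      by (simp add: L2_inner_bilinear L2_diff L2_scale RF Rp F2 \<psi>)
    finally show "0 \<le> (\<integral>x. (l * (resolvent l F x - F x) - 2 * resolvent l p x) * \<psi> x \<partial>M)"
      unfolding L2_inner_def .
  qed
  then show "AE x in M. 2 * resolvent l p x \<le> l * (resolvent l (\<lambda>x. (f x)\<^sup>2) x - (f x)\<^sup>2)"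
    unfolding F_def by eventually_elim simp
qed

text \<open>
  The Bakry-Emery inequality is tested with \<open>R (C\<^sup>2 \<eta> - f\<^sup>2)\<close>, where \<open>\<eta> = max 1\<^sub>A (f\<^sup>2 / C\<^sup>2)\<close>. This choice of
  \<open>\<eta>\<close> keeps the argument nonnegative and square integrable while leaving \<open>f\<^sup>2\<close> uncut. The defect
  \<open>1 - R 1\<^sub>B\<close> measures how far \<open>R \<eta>\<close> is from the constant 1. Two sets \<open>B \<subseteq> A\<close> are used
  because \<open>A\<close> must exhaust the space before \<open>l\<close> grows, whereas \<open>B\<close> can do so only afterwards.
\<close>
lemma BE_cutoff_estimate:
  assumes BE: "BE M V \<E> \<Gamma> K \<infinity>"
    and f: "f \<in> dom_V M V \<E>" "f \<in> Linf M" and Di: "laplacian M V \<E> f \<in> Linf M"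
    and C: "0 < C" "AE x in M. \<bar>f x\<bar> \<le> C" and l: "0 < l" and k: "0 \<le> k"
    and A: "A \<in> sets M" "emeasure M A \<noteq> \<infinity>" and B: "B \<in> sets M" "emeasure M B \<noteq> \<infinity>" "B \<subseteq> A"
  defines "D \<equiv> laplacian M V \<E> f"
  shows "- \<bar>K\<bar> * C\<^sup>2 * (\<integral>x. \<Gamma> f f x \<partial>M) \<le>
      l * C\<^sup>2 / 2 * (\<integral>x. \<bar>\<Gamma> f f x\<bar> * (1 - indicator A x) \<partial>M)
      - (\<integral>x. \<Gamma> f f x * resolvent l (\<lambda>x. f x * D x + cutoff k (\<Gamma> f f) x) x \<partial>M)
      - C\<^sup>2 * (\<integral>x. \<Gamma> f D x \<partial>M)
      + C\<^sup>2 * ((\<integral>x. \<bar>\<Gamma> f D x\<bar> \<partial>M) - (\<integral>x. \<bar>\<Gamma> f D x\<bar> * resolvent l (indicator B) x \<partial>M))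
      + (\<integral>x. \<Gamma> f D x * resolvent l (\<lambda>x. (f x)\<^sup>2) x \<partial>M)"
proof -
  define F where "F = (\<lambda>x. (f x)\<^sup>2)"
  define G where "G = \<Gamma> f f"
  define H where "H = \<Gamma> f D"
  define c where "c = C\<^sup>2"
  define p where "p = (\<lambda>x. f x * D x + cutoff k G x)"
  have c: "0 < c" using C(1) by (simp add: c_def)
  have lap: "has_laplacian M V \<E> f D" unfolding D_def using f(1) by (intro has_laplacian_laplacian) (simp add: dom_V_def)
  have fV: "f \<in> V" by (rule has_laplacianD(1)[OF lap])
  have DV: "D \<in> V" using f(1) by (simp add: dom_V_def D_def)
  have G: "integrable M G" and H: "integrable M H"
    unfolding G_def H_def by (intro Gamma_integrable fV DV)+
  have [measurable]: "G \<in> borel_measurable M" "H \<in> borel_measurable M" using G H by auto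
  have F: "F \<in> V" "F \<in> Linf M" unfolding F_def by (rule V_square[OF fV f(2)], rule L2_square[OF V_imp_L2[OF fV] f(2)])
  note F2 = V_imp_L2[OF F(1)]
  have Fc: "AE x in M. 0 \<le> F x \<and> F x \<le> c"
    using C(2) by eventually_elim (use C(1) in \<open>auto simp: F_def c_def abs_le_square_iff[symmetric]\<close>)
  have G0: "AE x in M. 0 \<le> G x" unfolding G_def by (rule Gamma_nonneg[OF fV f(2)])
  have sub: "p \<in> L2 M" "p \<in> Linf M" "AE x in M. 2 * resolvent l p x \<le> l * (resolvent l F x - F x)"
    unfolding p_def F_def G_def using square_subsolution[OF fV f(2) lap Di[folded D_def] l k] by auto
  define \<eta> where "\<eta> = (\<lambda>x. max (indicator A x) (1 / c * F x))"
  define b :: "'a \<Rightarrow> real" where "b = indicator B"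
  have [measurable]: "A \<in> sets M" "B \<in> sets M" "F \<in> borel_measurable M"
    by (rule A, rule B, rule L2_measurable[OF F2])
  have b2: "b \<in> L2 M" unfolding b_def by (rule L2_indicator[OF B(1,2)])
  have bi: "b \<in> Linf M" by (rule LinfI[OF L2_measurable[OF b2], of 1]) (auto simp: b_def indicator_def)
  have \<eta>m: "\<eta> \<in> borel_measurable M" unfolding \<eta>_def by measurable
  have \<eta>01: "AE x in M. 0 \<le> \<eta> x \<and> \<eta> x \<le> 1"
    using Fc by eventually_elim (use c in \<open>auto simp: \<eta>_def indicator_def field_simps\<close>)
  have \<eta>2: "\<eta> \<in> L2 M"
  proof (rule L2_bound[OF _ \<eta>m])
    show "(\<lambda>x. indicator A x + 1 / c * F x) \<in> L2 M" by (intro L2_add L2_scale L2_indicator A F2)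
    show "AE x in M. \<bar>\<eta> x\<bar> \<le> \<bar>indicator A x + 1 / c * F x\<bar>"
      using Fc by eventually_elim (use c in \<open>auto simp: \<eta>_def indicator_def max_def\<close>)
  qed
  have "AE x in M. \<bar>\<eta> x\<bar> \<le> 1" using \<eta>01 by eventually_elim auto
  then have \<eta>i: "\<eta> \<in> Linf M" by (rule LinfI[OF \<eta>m])
  define w where "w = (\<lambda>x. c * \<eta> x + (-1) * F x)"
  have w: "w \<in> L2 M" "w \<in> Linf M" unfolding w_def by (intro L2_add L2_scale Linf_add Linf_scale \<eta>2 \<eta>i F2 F)+
  define \<phi> where "\<phi> = resolvent l w"
  have \<phi>dom: "\<phi> \<in> dom_Linf M V \<E>" and \<phi>lap: "AE x in M. laplacian M V \<E> \<phi> x = l * (\<phi> x - w x)"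
    unfolding \<phi>_def by (rule resolvent_dom_Linf[OF l w])+
  have w0c: "AE x in M. 0 \<le> w x \<and> w x \<le> c"
    using \<eta>01 Fc
  proof eventually_elim
    case (elim x)
    have "1 / c * F x \<le> \<eta> x" by (simp add: \<eta>_def)
    then have "F x \<le> c * \<eta> x" using c by (simp add: field_simps)
    moreover have "c * \<eta> x \<le> c * 1" using elim c by (intro mult_left_mono) auto
    ultimately show ?case using elim by (simp add: w_def)
  qed
  have \<phi>0c: "AE x in M. 0 \<le> \<phi> x \<and> \<phi> x \<le> c"
    unfolding \<phi>_def by (rule resolvent_between[OF l w(1) less_imp_le[OF c] w0c])
  have \<phi>eq: "AE x in M. \<phi> x = c * resolvent l \<eta> x - resolvent l F x"
    using resolvent_lin[OF l \<eta>2 F2, of c "-1"] unfolding \<phi>_def w_def by simp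
  have R\<eta>: "AE x in M. 0 \<le> resolvent l \<eta> x \<and> resolvent l \<eta> x \<le> 1" by (rule resolvent_markov[OF l \<eta>2 \<eta>01])
  have Rb: "AE x in M. resolvent l b x \<le> resolvent l \<eta> x"
    by (rule resolvent_mono[OF l b2 bi \<eta>2 \<eta>i]) (use B(3) in \<open>auto simp: b_def \<eta>_def indicator_def\<close>)
  note RF = resolvent_Linf[OF l F2 F(2)] and Rp = resolvent_Linf[OF l sub(1,2)] and Rbi = resolvent_Linf[OF l b2 bi]
  have \<phi>i: "\<phi> \<in> Linf M" "laplacian M V \<E> \<phi> \<in> Linf M" using \<phi>dom by (auto simp: dom_Linf_def)
  have iA: "integrable M (\<lambda>x. \<bar>G x\<bar> * (1 - indicator A x))"
    by (rule Bochner_Integration.integrable_bound[OF G]) (auto simp: indicator_def)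
  have ints: "integrable M (\<lambda>x. G x * laplacian M V \<E> \<phi> x)" "integrable M (\<lambda>x. H x * \<phi> x)"
    "integrable M (\<lambda>x. G x * \<phi> x)" "integrable M (\<lambda>x. G x * resolvent l p x)"
    "integrable M (\<lambda>x. \<bar>H x\<bar> * resolvent l b x)" "integrable M (\<lambda>x. H x * resolvent l F x)"
    by (intro integrable_mult_Linf integrable_abs G H \<phi>i RF Rp Rbi)+
  let ?U = "\<lambda>x. l * c / 2 * (\<bar>G x\<bar> * (1 - indicator A x)) - G x * resolvent l p x - c * H x
      + c * (\<bar>H x\<bar> - \<bar>H x\<bar> * resolvent l b x) + H x * resolvent l F x"
  have "- (\<bar>K\<bar> * c * (\<integral>x. G x \<partial>M)) \<le> K * (\<integral>x. G x * \<phi> x \<partial>M)"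
  proof -
    have "\<bar>\<integral>x. G x * \<phi> x \<partial>M\<bar> \<le> c * (\<integral>x. \<bar>G x\<bar> \<partial>M)"
      by (rule abs_integral_mult_le(2)[OF G]) (use \<phi>0c Linf_measurable[OF \<phi>i(1)] in \<open>auto elim: eventually_mono\<close>)
    also have "(\<integral>x. \<bar>G x\<bar> \<partial>M) = (\<integral>x. G x \<partial>M)"
      using G0 by (intro integral_cong_AE) auto
    finally have "\<bar>K\<bar> * \<bar>\<integral>x. G x * \<phi> x \<partial>M\<bar> \<le> \<bar>K\<bar> * (c * (\<integral>x. G x \<partial>M))"
      by (rule mult_left_mono) simp
    then show ?thesis
      using abs_mult[of K "\<integral>x. G x * \<phi> x \<partial>M"] by (simp add: mult.assoc)
  qed
  also have "K * (\<integral>x. G x * \<phi> x \<partial>M) \<le> Gamma2 M V \<E> \<Gamma> f \<phi>"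
  proof -
    have "AE x in M. \<phi> x \<ge> 0" using \<phi>0c by eventually_elim simp
    with BE f(1) \<phi>dom have "Gamma2 M V \<E> \<Gamma> f \<phi> \<ge> K * (\<integral>x. \<Gamma> f f x * \<phi> x \<partial>M)
          + real_of_ereal (1 / \<infinity>) * (\<integral>x. (laplacian M V \<E> f x)\<^sup>2 * \<phi> x \<partial>M)"
      unfolding BE_def by blast
    then show ?thesis by (simp add: G_def)
  qed
  also have "\<dots> = (\<integral>x. 1/2 * (G x * laplacian M V \<E> \<phi> x) - H x * \<phi> x \<partial>M)"
    by (simp add: Gamma2_def G_def H_def D_def)
  also have "\<dots> \<le> (\<integral>x. ?U x \<partial>M)"
  proof (rule integral_mono_AE)
    show "integrable M (\<lambda>x. 1/2 * (G x * laplacian M V \<E> \<phi> x) - H x * \<phi> x)" using ints by simp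
    show "integrable M ?U" using ints iA H by simp
    \<comment> \<open>Pointwise, \<open>R \<eta> \<le> 1\<close> bounds \<open>\<Delta>\<phi>\<close> from above, and \<open>R 1\<^sub>B \<le> R \<eta> \<le> 1\<close> controls the term with \<open>\<Gamma>(f,\<Delta>f)\<close>, which has no sign.\<close>
    show "AE x in M. 1/2 * (G x * laplacian M V \<E> \<phi> x) - H x * \<phi> x \<le> ?U x"
      using \<phi>lap \<phi>eq R\<eta> Rb sub(3) G0
    proof eventually_elim
      case (elim x)
      have "indicator A x \<le> \<eta> x" by (simp add: \<eta>_def)
      then have "l * c * \<eta> x \<ge> l * c * indicator A x" using l c by (intro mult_left_mono) auto
      moreover have "l * c * resolvent l \<eta> x \<le> l * c * 1" using elim(3) l c by (intro mult_left_mono) auto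
      moreover have "laplacian M V \<E> \<phi> x = l * c * resolvent l \<eta> x - l * c * \<eta> x - l * (resolvent l F x - F x)"
        unfolding elim(1) elim(2) by (simp add: w_def algebra_simps)
      ultimately have "laplacian M V \<E> \<phi> x \<le> l * c * (1 - indicator A x) - 2 * resolvent l p x"
        using elim(5) by (simp add: algebra_simps)
      then have "G x * laplacian M V \<E> \<phi> x \<le> G x * (l * c * (1 - indicator A x) - 2 * resolvent l p x)"
        using elim(6) by (rule mult_left_mono)
      moreover have "- (c * (H x * resolvent l \<eta> x)) \<le> c * (- H x + (\<bar>H x\<bar> - \<bar>H x\<bar> * resolvent l b x))"
      proof -
        have "H x * (1 - resolvent l \<eta> x) \<le> \<bar>H x\<bar> * (1 - resolvent l \<eta> x)"
          using elim(3) by (intro mult_right_mono) auto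
        also have "\<dots> \<le> \<bar>H x\<bar> * (1 - resolvent l b x)"
          using elim(4) by (intro mult_left_mono) auto
        finally have "- (H x * resolvent l \<eta> x) \<le> - H x + (\<bar>H x\<bar> - \<bar>H x\<bar> * resolvent l b x)"
          by (simp add: algebra_simps)
        from mult_left_mono[OF this less_imp_le[OF c]] show ?thesis by simp
      qed
      moreover have "H x * \<phi> x = c * (H x * resolvent l \<eta> x) - H x * resolvent l F x"
        unfolding elim(2) by (simp add: algebra_simps)
      ultimately show ?case using elim(6) by (simp add: algebra_simps)
    qed
  qed
  also have "\<dots> = l * c / 2 * (\<integral>x. \<bar>G x\<bar> * (1 - indicator A x) \<partial>M) - (\<integral>x. G x * resolvent l p x \<partial>M)
      - c * (\<integral>x. H x \<partial>M) + c * ((\<integral>x. \<bar>H x\<bar> \<partial>M) - (\<integral>x. \<bar>H x\<bar> * resolvent l b x \<partial>M))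
      + (\<integral>x. H x * resolvent l F x \<partial>M)"
    using ints iA H by simp
  finally show ?thesis
    unfolding G_def H_def F_def p_def b_def c_def by simp
qed

text \<open>
  Three limits in this order: \<open>A\<close> exhausts the space, \<open>l \<rightarrow> \<infinity>\<close>, \<open>B\<close> exhausts the space.
\<close>
lemma BE_limit_estimate:
  assumes BE: "BE M V \<E> \<Gamma> K \<infinity>"
    and f: "f \<in> dom_V M V \<E>" "f \<in> Linf M" and Di: "laplacian M V \<E> f \<in> Linf M"
    and C: "0 < C" "AE x in M. \<bar>f x\<bar> \<le> C" and k: "0 \<le> k"
  defines "D \<equiv> laplacian M V \<E> f"
  shows "- \<bar>K\<bar> * C\<^sup>2 * (\<integral>x. \<Gamma> f f x \<partial>M) \<le>
      - (\<integral>x. \<Gamma> f f x * (f x * D x + cutoff k (\<Gamma> f f) x) \<partial>M) - C\<^sup>2 * (\<integral>x. \<Gamma> f D x \<partial>M)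
      + (\<integral>x. \<Gamma> f D x * (f x)\<^sup>2 \<partial>M)"
proof -
  obtain A :: "nat \<Rightarrow> 'a set" where A: "\<And>i. A i \<in> sets M" "\<And>i. emeasure M (A i) \<noteq> \<infinity>" "incseq A" "(\<Union>i. A i) = space M"
    by (rule exhaustion) blast
  have lap: "has_laplacian M V \<E> f D" unfolding D_def using f(1) by (intro has_laplacian_laplacian) (simp add: dom_V_def)
  have fV: "f \<in> V" by (rule has_laplacianD(1)[OF lap])
  have DV: "D \<in> V" using f(1) by (simp add: dom_V_def D_def)
  have G: "integrable M (\<Gamma> f f)" and H: "integrable M (\<Gamma> f D)"
    by (intro Gamma_integrable fV DV)+
  let ?F = "\<lambda>x. (f x)\<^sup>2" and ?p = "\<lambda>x. f x * D x + cutoff k (\<Gamma> f f) x"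
  have F: "?F \<in> L2 M" "?F \<in> Linf M" by (rule L2_square[OF V_imp_L2[OF fV] f(2)])+
  have p: "?p \<in> L2 M" "?p \<in> Linf M"
    by (rule square_subsolution[OF fV f(2) lap Di[folded D_def] _ k, of 1]; simp)+
  have ind: "(indicator (A j) :: 'a \<Rightarrow> real) \<in> L2 M" "(indicator (A j) :: 'a \<Rightarrow> real) \<in> Linf M" for j
    by (rule L2_indicator[OF A(1,2)], rule LinfI[OF L2_measurable[OF L2_indicator[OF A(1,2)]], where C=1])
      (auto simp: indicator_def)
  let ?T = "\<lambda>n j. - (\<integral>x. \<Gamma> f f x * resolvent (real (Suc n)) ?p x \<partial>M) - C\<^sup>2 * (\<integral>x. \<Gamma> f D x \<partial>M)
      + C\<^sup>2 * ((\<integral>x. \<bar>\<Gamma> f D x\<bar> \<partial>M) - (\<integral>x. \<bar>\<Gamma> f D x\<bar> * resolvent (real (Suc n)) (indicator (A j)) x \<partial>M))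
      + (\<integral>x. \<Gamma> f D x * resolvent (real (Suc n)) ?F x \<partial>M)"
  let ?L = "- \<bar>K\<bar> * C\<^sup>2 * (\<integral>x. \<Gamma> f f x \<partial>M)"
  have 1: "?L \<le> ?T n j" for n j
  proof -
    let ?l = "real (Suc n)"
    have "(\<lambda>i. ?l * C\<^sup>2 / 2 * (\<integral>x. \<bar>\<Gamma> f f x\<bar> * (1 - indicator (A i) x) \<partial>M) + ?T n j) \<longlonglongrightarrow> ?l * C\<^sup>2 / 2 * 0 + ?T n j"
      by (intro tendsto_add[OF tendsto_mult[OF tendsto_const] tendsto_const] exhaustion_tail A G)
    moreover have "?L \<le> ?l * C\<^sup>2 / 2 * (\<integral>x. \<bar>\<Gamma> f f x\<bar> * (1 - indicator (A i) x) \<partial>M) + ?T n j" if "i \<ge> j" for i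
      using BE_cutoff_estimate[OF BE f Di C, of ?l k "A i" "A j"] k A incseqD[OF A(3) that] unfolding D_def by simp
    ultimately have "?L \<le> ?l * C\<^sup>2 / 2 * 0 + ?T n j" by (intro LIMSEQ_le_const) blast+
    then show ?thesis by simp
  qed
  let ?S = "\<lambda>j. - (\<integral>x. \<Gamma> f f x * ?p x \<partial>M) - C\<^sup>2 * (\<integral>x. \<Gamma> f D x \<partial>M)
      + C\<^sup>2 * ((\<integral>x. \<bar>\<Gamma> f D x\<bar> \<partial>M) - (\<integral>x. \<bar>\<Gamma> f D x\<bar> * indicator (A j) x \<partial>M))
      + (\<integral>x. \<Gamma> f D x * ?F x \<partial>M)"
  have 2: "?L \<le> ?S j" for j
  proof -
    have "(\<lambda>n. ?T n j) \<longlonglongrightarrow> ?S j"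
      by (intro tendsto_intros resolvent_weak_tendsto G H integrable_abs F p ind)
    then show ?thesis by (rule LIMSEQ_le_const) (use 1 in blast)
  qed
  have "(\<lambda>j. (\<integral>x. \<bar>\<Gamma> f D x\<bar> * (1 - indicator (A j) x) \<partial>M)) \<longlonglongrightarrow> 0"
    by (rule exhaustion_tail[OF A(1,3,4) H])
  moreover have "(\<integral>x. \<bar>\<Gamma> f D x\<bar> * (1 - indicator (A j) x) \<partial>M)
      = (\<integral>x. \<bar>\<Gamma> f D x\<bar> \<partial>M) - (\<integral>x. \<bar>\<Gamma> f D x\<bar> * indicator (A j) x \<partial>M)" for j
    using integrable_mult_Linf[OF integrable_abs[OF H] ind(2), of j] H by (simp add: right_diff_distrib)
  ultimately have t: "(\<lambda>j. (\<integral>x. \<bar>\<Gamma> f D x\<bar> \<partial>M) - (\<integral>x. \<bar>\<Gamma> f D x\<bar> * indicator (A j) x \<partial>M)) \<longlonglongrightarrow> 0" by simp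
  have "?S \<longlonglongrightarrow> - (\<integral>x. \<Gamma> f f x * ?p x \<partial>M) - C\<^sup>2 * (\<integral>x. \<Gamma> f D x \<partial>M) + C\<^sup>2 * 0 + (\<integral>x. \<Gamma> f D x * ?F x \<partial>M)"
    by (intro tendsto_add[OF tendsto_add[OF tendsto_const tendsto_mult[OF tendsto_const t]] tendsto_const])
  then have "?L \<le> - (\<integral>x. \<Gamma> f f x * ?p x \<partial>M) - C\<^sup>2 * (\<integral>x. \<Gamma> f D x \<partial>M) + C\<^sup>2 * 0 + (\<integral>x. \<Gamma> f D x * ?F x \<partial>M)"
    by (rule LIMSEQ_le_const) (use 2 in blast)
  then show ?thesis by simp
qed

lemma Gamma_mixed_L2:
  assumes f: "f \<in> V" "f \<in> Linf M" and g: "g \<in> V" "g \<in> Linf M"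
    and G: "\<Gamma> f f \<in> L2 M" "\<Gamma> g g \<in> L2 M"
  shows "\<Gamma> f g \<in> L2 M" "(L2_norm M (\<Gamma> f g))\<^sup>2 \<le> L2_norm M (\<Gamma> f f) * L2_norm M (\<Gamma> g g)"
proof -
  note i = L2_mult_integrable[OF G]
  have [measurable]: "\<Gamma> f g \<in> borel_measurable M" using Gamma_integrable[OF f(1) g(1)] by auto
  have s: "integrable M (\<lambda>x. (\<Gamma> f g x)\<^sup>2)"
  proof (rule Bochner_Integration.integrable_bound[OF i])
    show "AE x in M. norm ((\<Gamma> f g x)\<^sup>2) \<le> norm (\<Gamma> f f x * \<Gamma> g g x)"
      using Gamma_Cauchy_Schwarz[OF f g] by eventually_elim auto
  qed measurable
  then show "\<Gamma> f g \<in> L2 M" by (simp add: L2_def)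
  have "(L2_norm M (\<Gamma> f g))\<^sup>2 \<le> (\<integral>x. \<Gamma> f f x * \<Gamma> g g x \<partial>M)"
    unfolding L2_norm_sq by (rule integral_mono_AE[OF s i Gamma_Cauchy_Schwarz[OF f g]])
  also have "\<dots> \<le> L2_norm M (\<Gamma> f f) * L2_norm M (\<Gamma> g g)"
    using L2_Cauchy_Schwarz[OF G] by simp
  finally show "(L2_norm M (\<Gamma> f g))\<^sup>2 \<le> L2_norm M (\<Gamma> f f) * L2_norm M (\<Gamma> g g)" .
qed

text \<open>
  Since the truncation satisfies \<open>\<Gamma>(f) cutoff k \<Gamma>(f) = (cutoff k \<Gamma>(f))\<^sup>2\<close>, the limit estimate bounds the square integrals
  of the truncations uniformly. This gives square integrability with a bound that still contains
  \<open>\<Gamma>(f)\<close> linearly, which is then absorbed.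
\<close>
lemma gradient_interpolation_regular:
  assumes BE: "BE M V \<E> \<Gamma> K \<infinity>"
    and f: "f \<in> dom_V M V \<E>" "f \<in> Linf M" and Di: "laplacian M V \<E> f \<in> Linf M"
    and C: "0 < C" "AE x in M. \<bar>f x\<bar> \<le> C"
  shows "\<Gamma> f f \<in> L2 M"
    and "(L2_norm M (\<Gamma> f f))\<^sup>2 \<le> C\<^sup>2 * (2 * \<bar>K\<bar> * \<E> f f + 11 * (L2_norm M (laplacian M V \<E> f))\<^sup>2)"
proof -
  define D where "D = laplacian M V \<E> f"
  define F where "F = (\<lambda>x. (f x)\<^sup>2)"
  have lap: "has_laplacian M V \<E> f D" unfolding D_def using f(1) by (intro has_laplacian_laplacian) (simp add: dom_V_def)
  have fV: "f \<in> V" by (rule has_laplacianD(1)[OF lap])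
  have DV: "D \<in> V" using f(1) by (simp add: dom_V_def D_def)
  note Di = Di[folded D_def]
  note f2 = V_imp_L2[OF fV] and D2 = V_imp_L2[OF DV]
  have F: "F \<in> V" "F \<in> Linf M" unfolding F_def by (rule V_square[OF fV f(2)], rule L2_square[OF f2 f(2)])
  have G: "integrable M (\<Gamma> f f)" by (rule Gamma_integrable[OF fV fV])
  have fDi: "(\<lambda>x. f x * D x) \<in> Linf M" by (rule Linf_mult[OF f(2) Di])
  have fD2: "(\<lambda>x. f x * D x) \<in> L2 M" by (rule L2_mult_bounded[OF D2 L2_measurable[OF f2] C(2)])
  have GfD: "integrable M (\<lambda>x. \<Gamma> f f x * (f x * D x))" by (rule integrable_mult_Linf[OF G fDi])
  let ?a = "\<integral>x. \<Gamma> f f x * (f x * D x) \<partial>M" and ?b = "\<integral>x. \<Gamma> f F x * D x \<partial>M"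
  let ?d = "(L2_norm M D)\<^sup>2"
  have HE: "(\<integral>x. \<Gamma> f D x \<partial>M) = - ?d"
    using Gamma_E[OF fV DV] has_laplacianD(3)[OF lap DV] by (simp add: L2_inner_self)
  have HF: "(\<integral>x. \<Gamma> f D x * F x \<partial>M) \<le> - ?b"
  proof -
    have "0 \<le> L2_inner M D (\<lambda>x. D x * F x)"
      unfolding L2_inner_def
    proof (rule Bochner_Integration.integral_nonneg)
      have "D x * (D x * F x) = (D x * f x)\<^sup>2" for x by (simp add: F_def power2_eq_square mult_ac)
      then show "0 \<le> D x * (D x * F x)" for x by simp
    qed
    then show ?thesis
      using E_Leibniz[OF fV f(2) DV Di F] has_laplacianD(3)[OF lap V_mult[OF DV Di F]] by simp
  qed
  have bound: "(\<integral>x. (cutoff (real k) (\<Gamma> f f) x)\<^sup>2 \<partial>M) \<le> \<bar>K\<bar> * C\<^sup>2 * \<E> f f - ?a + C\<^sup>2 * ?d - ?b" for k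
  proof -
    let ?g = "cutoff (real k) (\<Gamma> f f)"
    have gi: "?g \<in> Linf M"
    proof (rule LinfI)
      show "?g \<in> borel_measurable M" using G by (intro cutoff_measurable) auto
      show "AE x in M. \<bar>?g x\<bar> \<le> real k" by (intro AE_I2 cutoff_le) simp
    qed
    have "(\<integral>x. \<Gamma> f f x * (f x * D x + ?g x) \<partial>M) = ?a + (\<integral>x. \<Gamma> f f x * ?g x \<partial>M)"
      using GfD integrable_mult_Linf[OF G gi] by (simp add: distrib_left)
    moreover have "(\<integral>x. \<Gamma> f f x * ?g x \<partial>M) = (\<integral>x. (?g x)\<^sup>2 \<partial>M)"
      by (intro Bochner_Integration.integral_cong) (auto simp: cutoff_def power2_eq_square)
    moreover have "- \<bar>K\<bar> * C\<^sup>2 * (\<integral>x. \<Gamma> f f x \<partial>M) \<le>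
      - (\<integral>x. \<Gamma> f f x * (f x * D x + ?g x) \<partial>M) - C\<^sup>2 * (\<integral>x. \<Gamma> f D x \<partial>M) + (\<integral>x. \<Gamma> f D x * F x \<partial>M)"
      using BE_limit_estimate[OF BE f Di[unfolded D_def] C, of "real k"] unfolding D_def F_def by simp
    ultimately show ?thesis using HF unfolding HE Gamma_E[OF fV fV] by simp
  qed
  note G2 = cutoff_bounded_imp_L2[OF G bound]
  show "\<Gamma> f f \<in> L2 M" by (rule G2(1))
  let ?n = "L2_norm M (\<Gamma> f f)" and ?m = "L2_norm M D"
  \<comment> \<open>Cauchy-Schwarz and \<open>\<Gamma>(f\<^sup>2) \<le> 4 C\<^sup>2 \<Gamma>(f)\<close> replace the chain rule \<open>\<Gamma>(f,f\<^sup>2) = 2 f \<Gamma>(f)\<close>.\<close>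
  have Fsq: "AE x in M. (\<Gamma> f F x)\<^sup>2 \<le> (2 * C * \<Gamma> f f x)\<^sup>2"
    using Gamma_Cauchy_Schwarz[OF fV f(2) F] Gamma_square_le[OF fV less_imp_le[OF C(1)] C(2), folded F_def] Gamma_nonneg[OF fV f(2)]
  proof eventually_elim
    case (elim x)
    from mult_left_mono[OF elim(2,3)] elim(1) show ?case by (simp add: power2_eq_square mult_ac)
  qed
  have FF: "\<Gamma> f F \<in> L2 M" "L2_norm M (\<Gamma> f F) \<le> 2 * C * ?n"
  proof -
    have m: "\<Gamma> f F \<in> borel_measurable M" using Gamma_integrable[OF fV F(1)] by auto
    have le: "AE x in M. \<bar>\<Gamma> f F x\<bar> \<le> \<bar>2 * C * \<Gamma> f f x\<bar>" using Fsq by (simp only: abs_le_square_iff)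
    show "\<Gamma> f F \<in> L2 M" by (rule L2_bound[OF L2_scale[OF G2(1)] m le])
    show "L2_norm M (\<Gamma> f F) \<le> 2 * C * ?n"
      using L2_norm_mono[OF L2_scale[OF G2(1)] m le] C(1) by (simp add: L2_norm_scale)
  qed
  have a: "\<bar>?a\<bar> \<le> C * (?n * ?m)"
  proof -
    have "L2_norm M (\<lambda>x. f x * D x) \<le> L2_norm M (\<lambda>x. C * D x)"
    proof (rule L2_norm_mono[OF L2_scale[OF D2] L2_measurable[OF fD2]])
      show "AE x in M. \<bar>f x * D x\<bar> \<le> \<bar>C * D x\<bar>"
        using C(2) by eventually_elim (use C(1) in \<open>auto simp: abs_mult intro!: mult_right_mono\<close>)
    qed
    also have "\<dots> = C * ?m" using C(1) by (simp add: L2_norm_scale)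
    finally have "?n * L2_norm M (\<lambda>x. f x * D x) \<le> ?n * (C * ?m)" by (rule mult_left_mono) simp
    with L2_Cauchy_Schwarz[OF G2(1) fD2] show ?thesis by (simp only: mult.left_commute)
  qed
  have b: "\<bar>?b\<bar> \<le> 2 * C * (?n * ?m)"
  proof -
    have "\<bar>?b\<bar> \<le> L2_norm M (\<Gamma> f F) * ?m" by (rule L2_Cauchy_Schwarz[OF FF(1) D2])
    also have "\<dots> \<le> 2 * C * ?n * ?m" by (intro mult_right_mono FF) simp
    finally show ?thesis by (simp add: mult_ac)
  qed
  have "?n\<^sup>2 \<le> \<bar>K\<bar> * C\<^sup>2 * \<E> f f - ?a + C\<^sup>2 * ?d - ?b"
    using G2(2) by (simp only: L2_norm_sq)
  also have "\<dots> \<le> \<bar>K\<bar> * C\<^sup>2 * \<E> f f + C\<^sup>2 * ?m\<^sup>2 + 3 * (?n * (C * ?m))"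
    using a b by (simp add: mult_ac)
  also have "3 * (?n * (C * ?m)) \<le> 1/2 * ?n\<^sup>2 + 9/2 * (C * ?m)\<^sup>2"
    using zero_le_power2[of "?n - 3 * (C * ?m)"] by (simp add: power2_eq_square algebra_simps)
  finally show "?n\<^sup>2 \<le> C\<^sup>2 * (2 * \<bar>K\<bar> * \<E> f f + 11 * (L2_norm M (laplacian M V \<E> f))\<^sup>2)"
    unfolding D_def[symmetric] by (simp add: power_mult_distrib algebra_simps)
qed

text \<open>
  The bound must be uniform along the resolvents of \<open>f\<close>: apart from \<open>K\<close> it depends only on a bound for \<open>f\<close> and on the
  \<open>L\<^sup>2\<close> norms of \<open>f\<close> and \<open>\<Delta>f\<close>, none of which \<open>R\<close> increases.
\<close>
lemma gradient_interpolation: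
  assumes BE: "BE M V \<E> \<Gamma> K \<infinity>" and f: "f \<in> dom_L2 M V \<E>" "f \<in> Linf M"
  obtains B where "\<And>l. 0 < l \<Longrightarrow> \<Gamma> (resolvent l f) (resolvent l f) \<in> L2 M"
    "\<And>l. 0 < l \<Longrightarrow> L2_norm M (\<Gamma> (resolvent l f) (resolvent l f)) \<le> B" "\<Gamma> f f \<in> L2 M"
proof -
  define D where "D = laplacian M V \<E> f"
  have lap: "has_laplacian M V \<E> f D" unfolding D_def by (rule has_laplacian_laplacian[OF f(1)])
  note fV = has_laplacianD(1)[OF lap] and D2 = has_laplacianD(2)[OF lap]
  note f2 = V_imp_L2[OF fV]
  obtain C0 where C0: "0 \<le> C0" "AE x in M. \<bar>f x\<bar> \<le> C0" using f(2) by (rule LinfE)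
  \<comment> \<open>The regular estimate is stated for a strictly positive bound.\<close>
  define C where "C = C0 + 1"
  have C: "0 < C" "AE x in M. \<bar>f x\<bar> \<le> C"
    using C0(1) by (simp add: C_def) (use C0(2) in \<open>auto simp: C_def elim!: eventually_mono\<close>)
  define B where "B = sqrt (C\<^sup>2 * (2 * \<bar>K\<bar> * (L2_norm M D * L2_norm M f) + 11 * (L2_norm M D)\<^sup>2))"
  have reg: "\<Gamma> (resolvent l f) (resolvent l f) \<in> L2 M \<and> L2_norm M (\<Gamma> (resolvent l f) (resolvent l f)) \<le> B"
    if l: "0 < l" for l
  proof -
    let ?f = "resolvent l f" and ?D = "laplacian M V \<E> (resolvent l f)"
    note dom = resolvent_regular[OF l f]
    have nV: "?f \<in> V" by (rule resolvent_V[OF l f2])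
    have D'2: "?D \<in> L2 M"
      using dom(2) has_laplacianD(2)[OF has_laplacian_laplacian] by (auto simp: dom_Linf_def)
    have nD: "L2_norm M ?D = L2_norm M (resolvent l D)"
      by (rule L2_norm_cong_AE[OF L2_measurable[OF D'2] L2_measurable[OF resolvent_L2[OF l D2]]])
        (use dom(3) in \<open>simp add: D_def\<close>)
    have "\<E> ?f ?f = - L2_inner M (resolvent l D) ?f"
      by (rule has_laplacianD(3)[OF has_laplacian_resolvent_commute[OF l lap] nV])
    also have "\<dots> \<le> L2_norm M (resolvent l D) * L2_norm M ?f"
      using L2_inner_le[OF resolvent_L2[OF l D2] V_imp_L2[OF nV]] by linarith
    also have "\<dots> \<le> L2_norm M D * L2_norm M f"
      by (intro mult_mono resolvent_contraction l D2 f2 L2_norm_nonneg)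
    finally have e: "\<E> ?f ?f \<le> L2_norm M D * L2_norm M f" .
    have inf: "?f \<in> Linf M" "?D \<in> Linf M" using dom(2) by (auto simp: dom_Linf_def)
    note g = gradient_interpolation_regular[OF BE dom(1) inf C(1) resolvent_abs_le[OF l f2 less_imp_le[OF C(1)] C(2)]]
    have "(L2_norm M (\<Gamma> ?f ?f))\<^sup>2 \<le> C\<^sup>2 * (2 * \<bar>K\<bar> * \<E> ?f ?f + 11 * (L2_norm M ?D)\<^sup>2)"
      by (rule g(2))
    also have "\<dots> \<le> C\<^sup>2 * (2 * \<bar>K\<bar> * (L2_norm M D * L2_norm M f) + 11 * (L2_norm M D)\<^sup>2)"
      unfolding nD using e resolvent_contraction[OF l D2]
      by (intro mult_left_mono add_mono power_mono) auto
    finally have "L2_norm M (\<Gamma> ?f ?f) \<le> B" unfolding B_def by (rule real_le_rsqrt)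
    with g(1) show ?thesis by simp
  qed
  let ?f = "\<lambda>n. resolvent (real (Suc n)) f"
  have nV: "?f n \<in> V" for n by (rule resolvent_V[OF _ f2]) simp
  have conv: "(\<lambda>n. \<integral>x. \<bar>\<Gamma> (?f n) (?f n) x - \<Gamma> f f x\<bar> \<partial>M) \<longlonglongrightarrow> 0"
    by (rule Gamma_continuous[OF nV nV fV fV resolvent_tendsto_V[OF fV] resolvent_tendsto_V[OF fV]])
  have "\<Gamma> f f \<in> L2 M"
    by (rule L1_limit_in_L2(1)[OF _ _ _ conv, where B=B]) (use reg in \<open>auto intro: Gamma_integrable nV fV\<close>)
  with reg show ?thesis by (intro that) auto
qed

section \<open>Passage to square integrable Laplacians\<close>

lemma BE_imp_BE_infinity:
  assumes N: "1 \<le> N" and BE: "BE M V \<E> \<Gamma> K N"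
  shows "BE M V \<E> \<Gamma> K \<infinity>"
  unfolding BE_def
proof (intro ballI impI)
  fix f \<phi> assume f: "f \<in> dom_V M V \<E>" and \<phi>: "\<phi> \<in> dom_Linf M V \<E>" and pos: "AE x in M. \<phi> x \<ge> 0"
  have "0 \<le> real_of_ereal (1 / N)"
    using N by (cases N) (auto simp: one_ereal_def)
  moreover have "0 \<le> (\<integral>x. (laplacian M V \<E> f x)\<^sup>2 * \<phi> x \<partial>M)"
    using pos by (intro integral_nonneg_AE) (auto elim!: eventually_mono)
  ultimately have "0 \<le> real_of_ereal (1 / N) * (\<integral>x. (laplacian M V \<E> f x)\<^sup>2 * \<phi> x \<partial>M)"
    by (rule mult_nonneg_nonneg)
  moreover have "Gamma2 M V \<E> \<Gamma> f \<phi> \<ge> K * (\<integral>x. \<Gamma> f f x * \<phi> x \<partial>M)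
          + real_of_ereal (1 / N) * (\<integral>x. (laplacian M V \<E> f x)\<^sup>2 * \<phi> x \<partial>M)"
    using BE f \<phi> pos unfolding BE_def by blast
  ultimately show "Gamma2 M V \<E> \<Gamma> f \<phi> \<ge> K * (\<integral>x. \<Gamma> f f x * \<phi> x \<partial>M)
          + real_of_ereal (1 / \<infinity>) * (\<integral>x. (laplacian M V \<E> f x)\<^sup>2 * \<phi> x \<partial>M)"
    by simp
qed

text \<open>
  This removes \<open>\<Delta>f\<close> from under \<open>\<Gamma>\<close>, so that the right-hand side makes sense, and is continuous, when \<open>\<Delta>f\<close> is
  merely square integrable.
\<close>
lemma Gamma2_by_parts:
  assumes f: "f \<in> dom_V M V \<E>" "f \<in> Linf M" "laplacian M V \<E> f \<in> Linf M" and \<phi>: "\<phi> \<in> dom_Linf M V \<E>"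
  shows "Gamma2 M V \<E> \<Gamma> f \<phi> = 1/2 * (\<integral>x. \<Gamma> f f x * laplacian M V \<E> \<phi> x \<partial>M)
    + (\<integral>x. \<Gamma> f \<phi> x * laplacian M V \<E> f x \<partial>M) + (\<integral>x. laplacian M V \<E> f x * \<phi> x * laplacian M V \<E> f x \<partial>M)"
proof -
  let ?D = "laplacian M V \<E> f"
  have lap: "has_laplacian M V \<E> f ?D" using f(1) by (intro has_laplacian_laplacian) (simp add: dom_V_def)
  note fV = has_laplacianD(1)[OF lap]
  have DV: "?D \<in> V" using f(1) by (simp add: dom_V_def)
  have \<phi>i: "\<phi> \<in> Linf M" "laplacian M V \<E> \<phi> \<in> Linf M" and \<phi>V: "\<phi> \<in> V"
    using \<phi> has_laplacianD(1)[OF has_laplacian_laplacian] by (auto simp: dom_Linf_def)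
  have "Gamma2 M V \<E> \<Gamma> f \<phi> = (\<integral>x. 1/2 * (\<Gamma> f f x * laplacian M V \<E> \<phi> x) - \<Gamma> f ?D x * \<phi> x \<partial>M)"
    by (simp add: Gamma2_def)
  also have "\<dots> = 1/2 * (\<integral>x. \<Gamma> f f x * laplacian M V \<E> \<phi> x \<partial>M) - (\<integral>x. \<Gamma> f ?D x * \<phi> x \<partial>M)"
    using Gamma_mult_integrable[OF fV fV \<phi>i(2)] Gamma_mult_integrable[OF fV DV \<phi>i(1)] by simp
  finally show ?thesis
    using E_Leibniz[OF fV f(2) DV f(3) \<phi>V \<phi>i(1)] has_laplacianD(3)[OF lap V_mult[OF DV f(3) \<phi>V \<phi>i(1)]]
    by (simp add: L2_inner_def mult_ac)
qed

text \<open>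
  Every term of the integrated inequality for \<open>R\<^sub>n f\<close> and \<open>R\<^sub>n \<phi>\<close> is a product of a factor converging weakly
  and a factor converging strongly in \<open>L\<^sup>2\<close>.
\<close>
lemma BE_weak:
  assumes N: "1 \<le> N" and BE: "BE M V \<E> \<Gamma> K N"
    and f: "f \<in> dom_L2 M V \<E>" "f \<in> Linf M" and \<phi>: "\<phi> \<in> dom_L2 M V \<E>" "\<phi> \<in> Linf M" and pos: "AE x in M. \<phi> x \<ge> 0"
  defines "D \<equiv> laplacian M V \<E> f"
  shows "K * (\<integral>x. \<Gamma> f f x * \<phi> x \<partial>M) + real_of_ereal (1 / N) * (\<integral>x. D x * \<phi> x * D x \<partial>M)
    \<le> 1/2 * (\<integral>x. \<Gamma> f f x * laplacian M V \<E> \<phi> x \<partial>M) + (\<integral>x. \<Gamma> f \<phi> x * D x \<partial>M) + (\<integral>x. D x * \<phi> x * D x \<partial>M)"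
proof -
  note BEi = BE_imp_BE_infinity[OF N BE]
  define L where "L = laplacian M V \<E> \<phi>"
  define R where "R = (\<lambda>n. resolvent (real (Suc n)))"
  define Dn where "Dn = (\<lambda>n. laplacian M V \<E> (R n f))"
  define Ln where "Ln = (\<lambda>n. laplacian M V \<E> (R n \<phi>))"
  have l: "0 < real (Suc n)" for n by simp
  have lapf: "has_laplacian M V \<E> f D" and lapg: "has_laplacian M V \<E> \<phi> L"
    unfolding D_def L_def by (intro has_laplacian_laplacian f \<phi>)+
  note V = has_laplacianD(1)[OF lapf] has_laplacianD(1)[OF lapg]
  note L2s = V_imp_L2[OF V(1)] V_imp_L2[OF V(2)] has_laplacianD(2)[OF lapf] has_laplacianD(2)[OF lapg]
  have R2: "R n h \<in> L2 M" if "h \<in> L2 M" for n h unfolding R_def by (rule resolvent_L2[OF l that])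
  have nV: "R n f \<in> V" "R n \<phi> \<in> V" for n
    unfolding R_def by (intro resolvent_V[OF l] L2s)+
  have fdom: "R n f \<in> dom_V M V \<E>" "R n f \<in> Linf M" "Dn n \<in> Linf M" "R n f \<in> dom_L2 M V \<E>" for n
    using resolvent_regular[OF l f, of n] by (auto simp: R_def Dn_def dom_Linf_def)
  have gdom: "R n \<phi> \<in> dom_Linf M V \<E>" "R n \<phi> \<in> Linf M" "Ln n \<in> Linf M" "R n \<phi> \<in> dom_L2 M V \<E>" for n
    using resolvent_regular[OF l \<phi>, of n] by (auto simp: R_def Ln_def dom_Linf_def)
  have D2: "Dn n \<in> L2 M" and Ln2: "Ln n \<in> L2 M" for n
    unfolding Dn_def Ln_def using has_laplacianD(2)[OF has_laplacian_laplacian] fdom(4) gdom(4) by blast+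
  have Dae: "AE x in M. Dn n x = R n D x" and Lae: "AE x in M. Ln n x = R n L x" for n
    unfolding Dn_def Ln_def D_def L_def R_def by (intro resolvent_regular l f \<phi>)+
  have normD: "L2_norm M (Dn n) \<le> L2_norm M D" for n
    using L2_norm_cong_AE[OF L2_measurable[OF D2] L2_measurable[OF R2[OF L2s(3)]] Dae, of n]
      resolvent_contraction[OF l L2s(3), of n] by (simp add: R_def)
  have R_conv: "(\<lambda>n. L2_norm M (\<lambda>x. R n h x - h x)) \<longlonglongrightarrow> 0" if "h \<in> L2 M" for h
    unfolding R_def by (rule resolvent_tendsto_L2[OF that])
  have Dconv: "(\<lambda>n. L2_norm M (\<lambda>x. Dn n x - D x)) \<longlonglongrightarrow> 0"
  proof -
    have "L2_norm M (\<lambda>x. Dn n x - D x) = L2_norm M (\<lambda>x. R n D x - D x)" for n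
    proof (rule L2_norm_cong_AE)
      show "AE x in M. Dn n x - D x = R n D x - D x" using Dae[of n] by eventually_elim simp
    qed (intro L2_measurable L2_diff D2 L2s R2)+
    with R_conv[OF L2s(3)] show ?thesis by simp
  qed
  have Lconv: "(\<lambda>n. L2_norm M (\<lambda>x. Ln n x - L x)) \<longlonglongrightarrow> 0"
  proof -
    have "L2_norm M (\<lambda>x. Ln n x - L x) = L2_norm M (\<lambda>x. R n L x - L x)" for n
    proof (rule L2_norm_cong_AE)
      show "AE x in M. Ln n x - L x = R n L x - L x" using Lae[of n] by eventually_elim simp
    qed (intro L2_measurable L2_diff Ln2 L2s R2)+
    with R_conv[OF L2s(4)] show ?thesis by simp
  qed
  note gconv = R_conv[OF L2s(2)]
  have fV: "(\<lambda>n. form_norm M \<E> (\<lambda>x. R n f x - f x)) \<longlonglongrightarrow> 0"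
    and gV: "(\<lambda>n. form_norm M \<E> (\<lambda>x. R n \<phi> x - \<phi> x)) \<longlonglongrightarrow> 0"
    unfolding R_def by (intro resolvent_tendsto_V V)+
  obtain B where B: "\<And>n. \<Gamma> (R n f) (R n f) \<in> L2 M" "\<And>n. L2_norm M (\<Gamma> (R n f) (R n f)) \<le> B"
    unfolding R_def using gradient_interpolation[OF BEi f] l by metis
  obtain B' where B': "\<And>n. \<Gamma> (R n \<phi>) (R n \<phi>) \<in> L2 M" "\<And>n. L2_norm M (\<Gamma> (R n \<phi>) (R n \<phi>)) \<le> B'"
    unfolding R_def using gradient_interpolation[OF BEi \<phi>] l by metis
  note mixed = Gamma_mixed_L2[OF nV(1) fdom(2) nV(2) gdom(2) B(1) B'(1)]
  have mB: "L2_norm M (\<Gamma> (R n f) (R n \<phi>)) \<le> sqrt (B * B')" for n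
  proof (rule real_le_rsqrt)
    have "0 \<le> B" using B(2)[of n] L2_norm_nonneg[of M "\<Gamma> (R n f) (R n f)"] by linarith
    then have "L2_norm M (\<Gamma> (R n f) (R n f)) * L2_norm M (\<Gamma> (R n \<phi>) (R n \<phi>)) \<le> B * B'"
      by (intro mult_mono B B' L2_norm_nonneg)
    with mixed(2)[of n n] show "(L2_norm M (\<Gamma> (R n f) (R n \<phi>)))\<^sup>2 \<le> B * B'" by linarith
  qed
  note Gi = Gamma_integrable
  have 1: "(\<lambda>n. \<integral>x. \<Gamma> (R n f) (R n f) x * Ln n x \<partial>M) \<longlonglongrightarrow> (\<integral>x. \<Gamma> f f x * L x \<partial>M)"
    by (rule weak_strong_tendsto[OF B(1) Gi[OF nV(1) nV(1)] Gi[OF V(1) V(1)]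
        Gamma_continuous[OF nV(1) nV(1) V(1) V(1) fV fV] B(2) Ln2 L2s(4) Lconv])
  have 2: "(\<lambda>n. \<integral>x. \<Gamma> (R n f) (R n f) x * R n \<phi> x \<partial>M) \<longlonglongrightarrow> (\<integral>x. \<Gamma> f f x * \<phi> x \<partial>M)"
    by (rule weak_strong_tendsto[OF B(1) Gi[OF nV(1) nV(1)] Gi[OF V(1) V(1)]
        Gamma_continuous[OF nV(1) nV(1) V(1) V(1) fV fV] B(2) V_imp_L2[OF nV(2)] L2s(2) gconv])
  have 3: "(\<lambda>n. \<integral>x. \<Gamma> (R n f) (R n \<phi>) x * Dn n x \<partial>M) \<longlonglongrightarrow> (\<integral>x. \<Gamma> f \<phi> x * D x \<partial>M)"
    by (rule weak_strong_tendsto[OF mixed(1) Gi[OF nV(1) nV(2)] Gi[OF V(1) V(2)]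
        Gamma_continuous[OF nV(1) nV(2) V(1) V(2) fV gV] mB D2 L2s(3) Dconv])
  have 4: "(\<lambda>n. \<integral>x. Dn n x * R n \<phi> x * Dn n x \<partial>M) \<longlonglongrightarrow> (\<integral>x. D x * \<phi> x * D x \<partial>M)"
  proof -
    obtain C where C: "0 \<le> C" "AE x in M. \<bar>\<phi> x\<bar> \<le> C" using \<phi>(2) by (rule LinfE)
    have Cn: "AE x in M. \<bar>R n \<phi> x\<bar> \<le> C" for n unfolding R_def by (rule resolvent_abs_le[OF l L2s(2) C])
    have L: "(\<lambda>x. Dn n x * R n \<phi> x) \<in> L2 M" for n
      using L2_mult_bounded[OF D2 L2_measurable[OF V_imp_L2[OF nV(2)]] Cn, of n n] by (simp add: mult.commute)
    have N: "L2_norm M (\<lambda>x. Dn n x * R n \<phi> x) \<le> C * L2_norm M D" for n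
    proof -
      have "L2_norm M (\<lambda>x. Dn n x * R n \<phi> x) \<le> L2_norm M (\<lambda>x. C * Dn n x)"
      proof (rule L2_norm_mono[OF L2_scale[OF D2] L2_measurable[OF L]])
        show "AE x in M. \<bar>Dn n x * R n \<phi> x\<bar> \<le> \<bar>C * Dn n x\<bar>"
          using Cn[of n]
        proof eventually_elim
          case (elim x)
          from mult_right_mono[OF elim, of "\<bar>Dn n x\<bar>"] show ?case using C(1) by (simp add: abs_mult mult.commute)
        qed
      qed
      also have "\<dots> = C * L2_norm M (Dn n)" using C(1) by (simp add: L2_norm_scale)
      also have "\<dots> \<le> C * L2_norm M D" by (rule mult_left_mono[OF normD C(1)])
      finally show ?thesis .
    qed
    show ?thesis
      by (rule weak_strong_tendsto[OF L L2_mult_integrable[OF D2 V_imp_L2[OF nV(2)]] L2_mult_integrable[OF L2s(3) L2s(2)]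
          L2_norm_tendsto_integral[OF D2 L2s(3) V_imp_L2[OF nV(2)] L2s(2) Dconv gconv] N D2 L2s(3) Dconv])
  qed
  have "K * (\<integral>x. \<Gamma> f f x * \<phi> x \<partial>M) + real_of_ereal (1 / N) * (\<integral>x. D x * \<phi> x * D x \<partial>M)
    \<le> 1/2 * (\<integral>x. \<Gamma> f f x * L x \<partial>M) + (\<integral>x. \<Gamma> f \<phi> x * D x \<partial>M) + (\<integral>x. D x * \<phi> x * D x \<partial>M)"
  proof (rule LIMSEQ_le)
    show "(\<lambda>n. K * (\<integral>x. \<Gamma> (R n f) (R n f) x * R n \<phi> x \<partial>M) + real_of_ereal (1 / N) * (\<integral>x. Dn n x * R n \<phi> x * Dn n x \<partial>M))
      \<longlonglongrightarrow> K * (\<integral>x. \<Gamma> f f x * \<phi> x \<partial>M) + real_of_ereal (1 / N) * (\<integral>x. D x * \<phi> x * D x \<partial>M)"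
      by (intro tendsto_intros 2 4)
    show "(\<lambda>n. 1/2 * (\<integral>x. \<Gamma> (R n f) (R n f) x * Ln n x \<partial>M) + (\<integral>x. \<Gamma> (R n f) (R n \<phi>) x * Dn n x \<partial>M)
        + (\<integral>x. Dn n x * R n \<phi> x * Dn n x \<partial>M))
      \<longlonglongrightarrow> 1/2 * (\<integral>x. \<Gamma> f f x * L x \<partial>M) + (\<integral>x. \<Gamma> f \<phi> x * D x \<partial>M) + (\<integral>x. D x * \<phi> x * D x \<partial>M)"
      by (intro tendsto_intros 1 3 4)
    have "K * (\<integral>x. \<Gamma> (R n f) (R n f) x * R n \<phi> x \<partial>M) + real_of_ereal (1 / N) * (\<integral>x. Dn n x * R n \<phi> x * Dn n x \<partial>M)
      \<le> 1/2 * (\<integral>x. \<Gamma> (R n f) (R n f) x * Ln n x \<partial>M) + (\<integral>x. \<Gamma> (R n f) (R n \<phi>) x * Dn n x \<partial>M)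
        + (\<integral>x. Dn n x * R n \<phi> x * Dn n x \<partial>M)" for n
    proof -
      have "AE x in M. - 0 \<le> R n \<phi> x"
        unfolding R_def by (rule resolvent_lower[OF l L2s(2) \<phi>(2)]) (use pos in simp_all)
      then have "AE x in M. 0 \<le> R n \<phi> x" by simp
      with BE fdom(1)[of n] gdom(1)[of n] have "Gamma2 M V \<E> \<Gamma> (R n f) (R n \<phi>) \<ge> K * (\<integral>x. \<Gamma> (R n f) (R n f) x * R n \<phi> x \<partial>M)
          + real_of_ereal (1 / N) * (\<integral>x. (Dn n x)\<^sup>2 * R n \<phi> x \<partial>M)"
        unfolding BE_def Dn_def by blast
      then show ?thesis
        unfolding Gamma2_by_parts[OF fdom(1,2) fdom(3)[unfolded Dn_def] gdom(1)] Dn_def[symmetric] Ln_def[symmetric]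
        by (simp add: Dn_def Ln_def power2_eq_square mult_ac)
    qed
    then show "\<exists>n0. \<forall>n\<ge>n0. K * (\<integral>x. \<Gamma> (R n f) (R n f) x * R n \<phi> x \<partial>M) + real_of_ereal (1 / N) * (\<integral>x. Dn n x * R n \<phi> x * Dn n x \<partial>M)
      \<le> 1/2 * (\<integral>x. \<Gamma> (R n f) (R n f) x * Ln n x \<partial>M) + (\<integral>x. \<Gamma> (R n f) (R n \<phi>) x * Dn n x \<partial>M)
        + (\<integral>x. Dn n x * R n \<phi> x * Dn n x \<partial>M)" by blast
  qed
  then show ?thesis unfolding L_def .
qed

lemma Gamma_L2:
  assumes "BE M V \<E> \<Gamma> K \<infinity>" and f: "f \<in> dom_L2 M V \<E> \<inter> Linf M" and g: "g \<in> dom_L2 M V \<E> \<inter> Linf M"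
  shows "\<Gamma> f g \<in> L2 M"
proof -
  have V: "h \<in> V" if "h \<in> dom_L2 M V \<E> \<inter> Linf M" for h
    using that has_laplacianD(1)[OF has_laplacian_laplacian] by blast
  have G: "\<Gamma> h h \<in> L2 M" if "h \<in> dom_L2 M V \<E> \<inter> Linf M" for h
    by (rule gradient_interpolation[OF assms(1) IntD1[OF that] IntD2[OF that]])
  show ?thesis
    by (rule Gamma_mixed_L2(1)[OF V[OF f] IntD2[OF f] V[OF g] IntD2[OF g] G[OF f] G[OF g]])
qed

end

theorem corollary4p3:
  fixes M :: "'a::polish_space measure"
    and V :: "('a \<Rightarrow> real) set"
    and \<E> :: "('a \<Rightarrow> real) \<Rightarrow> ('a \<Rightarrow> real) \<Rightarrow> real"
    and \<Gamma> :: "('a \<Rightarrow> real) \<Rightarrow> ('a \<Rightarrow> real) \<Rightarrow> ('a \<Rightarrow> real)"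
    and P :: "real \<Rightarrow> ('a \<Rightarrow> real) \<Rightarrow> ('a \<Rightarrow> real)"
  assumes "mass_preserving_dirichlet_form M V \<E> \<Gamma> P"
  shows
    "((\<exists>K. BE M V \<E> \<Gamma> K \<infinity>) \<longrightarrow>
       (\<forall>f \<in> dom_L2 M V \<E> \<inter> Linf M. \<forall>g \<in> dom_L2 M V \<E> \<inter> Linf M. \<forall>\<phi> \<in> dom_L2 M V \<E> \<inter> Linf M.
          integrable M (\<lambda>x. \<Gamma> f g x * laplacian M V \<E> \<phi> x) \<and>
          integrable M (\<lambda>x. laplacian M V \<E> f x * \<Gamma> g \<phi> x) \<and>
          integrable M (\<lambda>x. laplacian M V \<E> g x * \<Gamma> f \<phi> x) \<and>
          integrable M (\<lambda>x. 2 * \<phi> x * laplacian M V \<E> f x * laplacian M V \<E> g x) \<and>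
          integrable M (\<lambda>x. 1/2 * (\<Gamma> f g x * laplacian M V \<E> \<phi> x
            + laplacian M V \<E> f x * \<Gamma> g \<phi> x
            + laplacian M V \<E> g x * \<Gamma> f \<phi> x
            + 2 * \<phi> x * laplacian M V \<E> f x * laplacian M V \<E> g x))))
     \<and>
     (\<forall>(K::real) (N::ereal). 1 \<le> N \<longrightarrow> BE M V \<E> \<Gamma> K N \<longrightarrow>
       (\<forall>f \<in> dom_L2 M V \<E> \<inter> Linf M. \<forall>\<phi> \<in> dom_L2 M V \<E> \<inter> Linf M. (AE x in M. \<phi> x \<ge> 0) \<longrightarrow>
          (\<integral>x. 1/2 * \<Gamma> f f x * laplacian M V \<E> \<phi> x
                + laplacian M V \<E> f x * \<Gamma> f \<phi> x
                + \<phi> x * (laplacian M V \<E> f x)\<^sup>2 \<partial>M)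
          \<ge> K * (\<integral>x. \<Gamma> f f x * \<phi> x \<partial>M)
            + real_of_ereal (1 / N) * (\<integral>x. (laplacian M V \<E> f x)\<^sup>2 * \<phi> x \<partial>M)))"
proof -
  interpret mass_preserving_dirichlet_form M V \<E> \<Gamma> P by (rule assms)
  let ?S = "dom_L2 M V \<E> \<inter> Linf M" and ?\<Delta> = "laplacian M V \<E>"
  have lap: "?\<Delta> f \<in> L2 M" if "f \<in> ?S" for f
    using that has_laplacianD(2)[OF has_laplacian_laplacian] by blast
  have triple: "integrable M (\<lambda>x. \<phi> x * ?\<Delta> f x * ?\<Delta> g x)" if "f \<in> ?S" "g \<in> ?S" "\<phi> \<in> ?S" for f g \<phi>
  proof -
    from that(3) obtain C where "AE x in M. \<bar>\<phi> x\<bar> \<le> C" by (auto elim: LinfE)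
    then have "(\<lambda>x. \<phi> x * ?\<Delta> f x) \<in> L2 M"
      using that(3) by (intro L2_mult_bounded lap[OF that(1)] Linf_measurable) auto
    then show ?thesis by (rule L2_mult_integrable[OF _ lap[OF that(2)]])
  qed
  show ?thesis
  proof (intro conjI impI ballI allI)
    fix f g \<phi> assume "\<exists>K. BE M V \<E> \<Gamma> K \<infinity>" and S: "f \<in> ?S" "g \<in> ?S" "\<phi> \<in> ?S"
    then obtain K where K: "BE M V \<E> \<Gamma> K \<infinity>" by blast
    show 1: "integrable M (\<lambda>x. \<Gamma> f g x * ?\<Delta> \<phi> x)"
      and 2: "integrable M (\<lambda>x. ?\<Delta> f x * \<Gamma> g \<phi> x)"
      and 3: "integrable M (\<lambda>x. ?\<Delta> g x * \<Gamma> f \<phi> x)"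
      by (intro L2_mult_integrable lap Gamma_L2[OF K] S)+
    show 4: "integrable M (\<lambda>x. 2 * \<phi> x * ?\<Delta> f x * ?\<Delta> g x)"
      using integrable_mult_right[OF triple[OF S], of 2] by (simp add: mult.assoc)
    show "integrable M (\<lambda>x. 1/2 * (\<Gamma> f g x * ?\<Delta> \<phi> x + ?\<Delta> f x * \<Gamma> g \<phi> x
            + ?\<Delta> g x * \<Gamma> f \<phi> x + 2 * \<phi> x * ?\<Delta> f x * ?\<Delta> g x))"
      by (intro integrable_mult_right Bochner_Integration.integrable_add 1 2 3 4)
  next
    fix K :: real and N :: ereal and f \<phi>
    assume N: "1 \<le> N" and BE: "BE M V \<E> \<Gamma> K N" and S: "f \<in> ?S" "\<phi> \<in> ?S" and pos: "AE x in M. \<phi> x \<ge> 0"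
    note K = BE_imp_BE_infinity[OF N BE]
    have 1: "integrable M (\<lambda>x. \<Gamma> f f x * ?\<Delta> \<phi> x)" and 2: "integrable M (\<lambda>x. \<Gamma> f \<phi> x * ?\<Delta> f x)"
      by (intro L2_mult_integrable lap Gamma_L2[OF K] S)+
    have 3: "integrable M (\<lambda>x. ?\<Delta> f x * \<phi> x * ?\<Delta> f x)"
      using triple[OF S(1,1,2)] by (simp add: mult_ac)
    have "(\<integral>x. 1/2 * \<Gamma> f f x * ?\<Delta> \<phi> x + ?\<Delta> f x * \<Gamma> f \<phi> x + \<phi> x * (?\<Delta> f x)\<^sup>2 \<partial>M)
      = (\<integral>x. 1/2 * (\<Gamma> f f x * ?\<Delta> \<phi> x) + \<Gamma> f \<phi> x * ?\<Delta> f x + ?\<Delta> f x * \<phi> x * ?\<Delta> f x \<partial>M)"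
      by (intro Bochner_Integration.integral_cong) (auto simp: power2_eq_square)
    also have "\<dots> = 1/2 * (\<integral>x. \<Gamma> f f x * ?\<Delta> \<phi> x \<partial>M) + (\<integral>x. \<Gamma> f \<phi> x * ?\<Delta> f x \<partial>M)
        + (\<integral>x. ?\<Delta> f x * \<phi> x * ?\<Delta> f x \<partial>M)"
      using 1 2 3 by simp
    also have "\<dots> \<ge> K * (\<integral>x. \<Gamma> f f x * \<phi> x \<partial>M) + real_of_ereal (1 / N) * (\<integral>x. ?\<Delta> f x * \<phi> x * ?\<Delta> f x \<partial>M)"
      using S by (intro BE_weak[OF N BE _ _ _ _ pos]) auto
    also have "(\<integral>x. ?\<Delta> f x * \<phi> x * ?\<Delta> f x \<partial>M) = (\<integral>x. (?\<Delta> f x)\<^sup>2 * \<phi> x \<partial>M)"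
      by (intro Bochner_Integration.integral_cong) (auto simp: power2_eq_square)
    finally show "K * (\<integral>x. \<Gamma> f f x * \<phi> x \<partial>M) + real_of_ereal (1 / N) * (\<integral>x. (?\<Delta> f x)\<^sup>2 * \<phi> x \<partial>M)
      \<le> (\<integral>x. 1/2 * \<Gamma> f f x * ?\<Delta> \<phi> x + ?\<Delta> f x * \<Gamma> f \<phi> x + \<phi> x * (?\<Delta> f x)\<^sup>2 \<partial>M)" .
  qed
qed

end
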